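(* Let $d\ge 1$, $k\in\{1,\dots,d\}$, and let $\mu_\star\in\mathscr{P}_q(\mathbb{R}^d)$ with $M_q(\mu_\star)=\int\|x\|^q\,d\mu_\star(x)<+\infty$ for some $q\ge p\ge 1$. Let $\widehat{\mu}_n=\frac1n\sum_{i=1}^n\delta_{X_i}$ be the empirical measure of $n$ i.i.d. samples $X_1,\dots,X_n$ from $\mu_\star$. Then, for all $n\ge1$, $$\mathbb{E}[\underline{\mathcal{PW}}_{p,k}(\widehat{\mu}_n,\mu_\star)]\ \lesssim_{p,q}\ n^{-\left[\frac{1}{(2p)\vee k}\wedge\left(\frac1p-\frac1q\right)\right]}(\log n)^{\zeta_{p,q,k}/p},$$ where $\lesssim_{p,q}$ means "less than" up to a constant depending only on $(p,q)$, and $\zeta_{p,q,k}=2$ if $k=q=2p$; $\zeta_{p,q,k}=1$ if ($k\ne 2p$ and $q=\frac{kp}{k-p}$) or ($q>k=2p$); and $\zeta_{p,q,k}=0$ otherwise.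
   Context: $\|\cdot\|$ is the Euclidean norm, $a\vee b=\max\{a,b\}$, $a\wedge b=\min\{a,b\}$. $\mathscr{P}(\mathbb{R}^d)$ is the set of Borel probability measures on $\mathbb{R}^d$ and $\mathscr{P}_p(\mathbb{R}^d)$ the subset with $M_p(\mu)=\int\|x\|^p d\mu(x)<+\infty$. The Wasserstein distance of order $p$ is $\mathcal{W}_p(\mu,\nu)=\left(\inf_{\pi\in\Pi(\mu,\nu)}\int\|x-y\|^p d\pi(x,y)\right)^{1/p}$, with $\Pi(\mu,\nu)$ the set of probability measures on $\mathbb{R}^d\times\mathbb{R}^d$ with marginals $\mu$ and $\nu$ (and similarly on $\mathbb{R}^k$). $\mathbb{S}_{d,k}=\{E\in\mathbb{R}^{d\times k}:E^\top E=I_k\}$; for $E\in\mathbb{S}_{d,k}$, $E^\star_{\#}\mu\in\mathscr{P}(\mathbb{R}^k)$ is the push-forward of $\mu$ under $x\mapsto E^\top x$. The integral projection robust Wasserstein (IPRW) distance is $\underline{\mathcal{PW}}_{p,k}(\mu,\nu)=\left(\int_{\mathbb{S}_{d,k}}\mathcal{W}_p^p(E^\star_{\#}\mu,E^\star_{\#}\nu)\,d\sigma(E)\right)^{1/p}$, with $\sigma$ the uniform distribution on $\mathbb{S}_{d,k}$.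
   Formalization: The bound carries the factor M_q(μ⋆)^{1/q} (without it, it fails under scaling); log n is read as max(1, log n), since log 1 = 0; and ζ = 1 also when k < 2p and q = 2p, where the printed bound with ζ = 0 is false. *)

theory Defs
  imports "HOL-Probability.Probability"
begin

text \<open>
  The dimensions \<open>d\<close> and \<open>k\<close> are quantified inside the theorem, below the constant, which must not
  depend on them. They are therefore natural numbers and not index types: a vector of \<open>\<real>\<^sup>d\<close> is
  an extensional function on \<open>{..<d}\<close>, and a \<open>d \<times> k\<close> matrix an extensional function on the index
  pairs \<open>{..<d} \<times> {..<k}\<close>. For these finite products the product sigma-algebra is the Borel one.
\<close>

abbreviation borel_Rn :: "nat \<Rightarrow> (nat \<Rightarrow> real) measure" where
  "borel_Rn d \<equiv> (\<Pi>\<^sub>M i\<in>{..<d}. borel)"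

abbreviation borel_mat :: "nat \<Rightarrow> nat \<Rightarrow> (nat \<times> nat \<Rightarrow> real) measure" where
  "borel_mat d k \<equiv> (\<Pi>\<^sub>M ij\<in>{..<d} \<times> {..<k}. borel)"

definition norm_Rn :: "nat \<Rightarrow> (nat \<Rightarrow> real) \<Rightarrow> real" where
  "norm_Rn d x = L2_set x {..<d}"

text \<open>
  All distances, moments and expectations take values in \<open>[0, \<infinity>]\<close>, so that no finiteness is
  hidden in a totalised real-valued operation. The power is used for positive exponents only.
\<close>

definition epowr :: "ennreal \<Rightarrow> real \<Rightarrow> ennreal" where
  "epowr x r = (if x = \<top> then \<top> else ennreal (enn2real x powr r))"

definition prob_Rn :: "nat \<Rightarrow> (nat \<Rightarrow> real) measure set" where
  "prob_Rn d = {\<mu>. prob_space \<mu> \<and> sets \<mu> = sets (borel_Rn d)}"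

definition moment :: "nat \<Rightarrow> real \<Rightarrow> (nat \<Rightarrow> real) measure \<Rightarrow> ennreal" where
  "moment d q \<mu> = (\<integral>\<^sup>+ x. ennreal (norm_Rn d x powr q) \<partial>\<mu>)"

definition prob_Rn_moment :: "nat \<Rightarrow> real \<Rightarrow> (nat \<Rightarrow> real) measure set" where
  "prob_Rn_moment d q = {\<mu> \<in> prob_Rn d. moment d q \<mu> < \<infinity>}"

definition couplings ::
  "nat \<Rightarrow> (nat \<Rightarrow> real) measure \<Rightarrow> (nat \<Rightarrow> real) measure
    \<Rightarrow> ((nat \<Rightarrow> real) \<times> (nat \<Rightarrow> real)) measure set" where
  "couplings k \<mu> \<nu> =
    {\<pi>. prob_space \<pi> \<and> sets \<pi> = sets (borel_Rn k \<Otimes>\<^sub>M borel_Rn k) \<and>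
        distr \<pi> (borel_Rn k) fst = \<mu> \<and> distr \<pi> (borel_Rn k) snd = \<nu>}"

definition wasserstein ::
  "nat \<Rightarrow> real \<Rightarrow> (nat \<Rightarrow> real) measure \<Rightarrow> (nat \<Rightarrow> real) measure \<Rightarrow> ennreal" where
  "wasserstein k p \<mu> \<nu> =
    epowr (INF \<pi>\<in>couplings k \<mu> \<nu>.
      \<integral>\<^sup>+ (x, y). ennreal (norm_Rn k (\<lambda>i. x i - y i) powr p) \<partial>\<pi>) (1 / p)"

definition stiefel :: "nat \<Rightarrow> nat \<Rightarrow> (nat \<times> nat \<Rightarrow> real) set" where
  "stiefel d k = {E \<in> space (borel_mat d k).
     \<forall>a<k. \<forall>b<k. (\<Sum>i<d. E (i, a) * E (i, b)) = (if a = b then 1 else 0)}"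

definition transpose_apply :: "nat \<Rightarrow> nat \<Rightarrow> (nat \<times> nat \<Rightarrow> real) \<Rightarrow> (nat \<Rightarrow> real) \<Rightarrow> nat \<Rightarrow> real" where
  "transpose_apply d k E x = (\<lambda>j\<in>{..<k}. \<Sum>i<d. E (i, j) * x i)"

definition left_mult ::
  "nat \<Rightarrow> nat \<Rightarrow> (nat \<times> nat \<Rightarrow> real) \<Rightarrow> (nat \<times> nat \<Rightarrow> real) \<Rightarrow> nat \<times> nat \<Rightarrow> real" where
  "left_mult d k Q E = (\<lambda>(i, j)\<in>{..<d} \<times> {..<k}. \<Sum>l<d. Q (i, l) * E (l, j))"

text \<open>
  The orthogonal group \<open>O(d) = stiefel d d\<close> is compact and acts transitively on \<open>stiefel d k\<close> by
  left multiplication, so exactly one probability measure is invariant under this action; this is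
  the uniform distribution.
\<close>

definition uniform_stiefel :: "nat \<Rightarrow> nat \<Rightarrow> (nat \<times> nat \<Rightarrow> real) measure \<Rightarrow> bool" where
  "uniform_stiefel d k \<sigma> \<longleftrightarrow>
     prob_space \<sigma> \<and> sets \<sigma> = sets (restrict_space (borel_mat d k) (stiefel d k)) \<and>
     (\<forall>Q\<in>stiefel d d. distr \<sigma> \<sigma> (left_mult d k Q) = \<sigma>)"

text \<open>The integral projection robust Wasserstein distance; \<open>\<sigma>\<close> is the uniform distribution.\<close>

definition iprw ::
  "(nat \<times> nat \<Rightarrow> real) measure \<Rightarrow> nat \<Rightarrow> nat \<Rightarrow> real
    \<Rightarrow> (nat \<Rightarrow> real) measure \<Rightarrow> (nat \<Rightarrow> real) measure \<Rightarrow> ennreal" where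
  "iprw \<sigma> d k p \<mu> \<nu> =
    epowr (\<integral>\<^sup>+ E. epowr (wasserstein k p
                       (distr \<mu> (borel_Rn k) (transpose_apply d k E))
                       (distr \<nu> (borel_Rn k) (transpose_apply d k E))) p \<partial>\<sigma>) (1 / p)"

definition empirical :: "nat \<Rightarrow> nat \<Rightarrow> (nat \<Rightarrow> nat \<Rightarrow> real) \<Rightarrow> (nat \<Rightarrow> real) measure" where
  "empirical d n x = measure_of (space (borel_Rn d)) (sets (borel_Rn d))
     (\<lambda>A. (\<Sum>i=1..n. emeasure (return (borel_Rn d) (x i)) A) / of_nat n)"

lemma sets_empirical [simp, measurable_cong]: "sets (empirical d n x) = sets (borel_Rn d)"
  unfolding empirical_def by (rule sets.sets_measure_of_eq)

lemma space_empirical [simp]: "space (empirical d n x) = space (borel_Rn d)"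
  unfolding empirical_def by (rule sets.space_measure_of_eq)

text \<open>The set function in the definition of \<open>empirical\<close> is a measure, so \<open>measure_of\<close> keeps it.\<close>

lemma emeasure_empirical:
  assumes "A \<in> sets (borel_Rn d)"
  shows "emeasure (empirical d n x) A =
           (\<Sum>i=1..n. emeasure (return (borel_Rn d) (x i)) A) / of_nat n"
proof (rule emeasure_measure_of[OF empirical_def])
  show "sets (borel_Rn d) \<subseteq> Pow (space (borel_Rn d))"
    by (rule sets.space_closed)
  show "A \<in> sets (empirical d n x)"
    using assms by simp
  show "positive (sets (empirical d n x))
          (\<lambda>A. (\<Sum>i=1..n. emeasure (return (borel_Rn d) (x i)) A) / of_nat n)"
    by (simp add: positive_def)
  show "countably_additive (sets (empirical d n x))
          (\<lambda>A. (\<Sum>i=1..n. emeasure (return (borel_Rn d) (x i)) A) / of_nat n)"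
  proof (rule countably_additiveI)
    fix F :: "nat \<Rightarrow> (nat \<Rightarrow> real) set"
    assume F: "range F \<subseteq> sets (empirical d n x)" "disjoint_family F"
    have "(\<Sum>j. (\<Sum>i=1..n. emeasure (return (borel_Rn d) (x i)) (F j)) / of_nat n)
        = (\<Sum>i=1..n. \<Sum>j. emeasure (return (borel_Rn d) (x i)) (F j)) / of_nat n"
      by (simp add: divide_ennreal_def ennreal_suminf_multc suminf_sum)
    also have "\<dots> = (\<Sum>i=1..n. emeasure (return (borel_Rn d) (x i)) (\<Union>j. F j)) / of_nat n"
      using F by (subst suminf_emeasure) (simp_all del: emeasure_return)
    finally show "(\<Sum>j. (\<Sum>i=1..n. emeasure (return (borel_Rn d) (x i)) (F j)) / of_nat n) =
        (\<Sum>i=1..n. emeasure (return (borel_Rn d) (x i)) (\<Union>j. F j)) / of_nat n" .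
  qed
qed

definition iid_sample ::
  "'w measure \<Rightarrow> nat \<Rightarrow> (nat \<Rightarrow> real) measure \<Rightarrow> nat \<Rightarrow> (nat \<Rightarrow> 'w \<Rightarrow> nat \<Rightarrow> real) \<Rightarrow> bool" where
  "iid_sample P d \<mu> n X \<longleftrightarrow>
     prob_space P \<and>
     prob_space.indep_vars P (\<lambda>_. borel_Rn d) X {1..n} \<and>
     (\<forall>i\<in>{1..n}. distr P (borel_Rn d) (X i) = \<mu>)"

text \<open>
  Two readings in the bound itself: it carries the factor \<open>M\<^sub>q(\<mu>)\<^sup>1\<^sup>/\<^sup>q\<close>, since the distance scales
  linearly under dilations of \<open>\<mu>\<close> and no constant in \<open>(p, q)\<close> alone could work; and \<open>log n\<close> is read
  as \<open>max 1 (ln n)\<close>, since at \<open>n = 1\<close> a vanishing logarithm would make the bound false.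
\<close>

definition rate_exponent :: "real \<Rightarrow> real \<Rightarrow> nat \<Rightarrow> real" where
  "rate_exponent p q k = min (1 / max (2 * p) (real k)) (1 / p - 1 / q)"

text \<open>
  The critical value \<open>k p / (k - p)\<close> is finite and positive only for \<open>k > p\<close>. For \<open>k \<le> p\<close> the
  totalised quotient is at most \<open>0\<close>, so the comparison with \<open>q \<ge> 1\<close> fails, as it should.

  The last disjunct, \<open>k < 2 p\<close> and \<open>q = 2 p\<close>, is a correction: there the two terms of
  \<open>rate_exponent\<close> coincide, and the bound without a logarithm is false. Take \<open>d = k = p = 1\<close>,
  \<open>q = 2\<close> and \<open>\<mu>\<close> with tail \<open>t\<^sup>-\<^sup>2 (log t)\<^sup>-\<^sup>3\<^sup>/\<^sup>2\<close> (for large \<open>t\<close>): its second moment is finite, but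
  the expected distance is not \<open>O(n\<^sup>-\<^sup>1\<^sup>/\<^sup>2)\<close>, since the square root of \<open>F (1 - F)\<close> is not integrable.
\<close>

definition log_exponent :: "real \<Rightarrow> real \<Rightarrow> nat \<Rightarrow> real" where
  "log_exponent p q k =
    (if real k = q \<and> q = 2 * p then 2
     else if (real k \<noteq> 2 * p \<and> q = real k * p / (real k - p)) \<or>
             (q > real k \<and> real k = 2 * p) \<or>
             (real k < 2 * p \<and> q = 2 * p) then 1
     else 0)"

end

theory Submission
  imports Defs
begin

text \<open>
  For a fixed frame \<open>E\<close> the projected sample is an i.i.d. sample of the projected law, and
  \<open>transpose_apply d k E\<close> does not increase norms, so the moment bound survives the projection. Cut \<open>\<real>\<^sup>k\<close>
  into dyadic shells, and each shell into nested families of cubes. Matching the two measures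
  greedily, from the finest cubes to the coarsest, moves in each cell only the difference of its
  two masses, which has expectation at most \<open>2 min a (sqrt (a / n))\<close> for a cell of mass \<open>a\<close>.

  The constant does not depend on \<open>k\<close>, because cubes of diameter \<open>2 ^ (- l)\<close> have side
  \<open>2 ^ (- l) / sqrt k\<close> and only \<open>(15 * 2 ^ l) ^ k\<close> of them meet the unit ball; the base \<open>15\<close> is
  harmless after the power \<open>p / k\<close> that the sum over the levels produces. Summing the resulting
  geometric series, first over the levels and then over the shells, gives the rate: a logarithm
  appears whenever one of the two series has ratio one. Jensen's inequality passes from
  the \<open>p\<close>-th power to the distance itself.
\<close>

section \<open>Geometric sums over levels and shells\<close>

text \<open>A constant independent of \<open>k\<close> also requires that no geometric ratio
  approaches one along a sequence of dimensions. The deciding exponents are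
  \<open>real k / 2 - p\<close> for the levels and \<open>p - q * (1 - s)\<close> for the shells;
  \<open>k\<close> is an integer and for large \<open>k\<close> both stay away from zero, so their
  nonzero values have a positive lower bound. Every dimension enters the shell sum through one
  inequality, a level bound of the form
  \<open>K * (\<Lambda> * real n powr (- s) * b powr (1 - s))\<close>, with \<open>s\<close> equal
  to \<open>1 / 2\<close> below \<open>k = 2 p\<close> and to \<open>p / k\<close> above it. At
  \<open>k = 2 p\<close> the levels are flat and cost a logarithm, which the claimed rate does not
  allow when \<open>q < 2 p\<close>; there \<open>s\<close> is taken slightly below
  \<open>1 / 2\<close>, a loss hidden by the shell term \<open>1 - p / q\<close>. The projected
  Wasserstein cost is replaced by an explicit majorant before the integrals over the frame and the
  sample are exchanged, because Fubini needs joint measurability.\<close>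

lemma sum_geometric_le:
  fixes x :: real
  assumes "0 \<le> x" "x < 1"
  shows "(\<Sum>i<N. x ^ i) \<le> 1 / (1 - x)"
proof -
  have "(\<Sum>i<N. x ^ i) = (1 - x ^ N) / (1 - x)"
    using assms by (simp add: sum_gp_strict)
  also have "\<dots> \<le> 1 / (1 - x)"
    using assms by (intro divide_right_mono) auto
  finally show ?thesis .
qed

lemma two_powr_neg_lt_1: "0 < d \<Longrightarrow> 2 powr (- d) < (1::real)"
  by (simp add: powr_less_one)

lemma sum_two_powr_le:
  fixes d :: real
  assumes "0 < d"
  shows "(\<Sum>i<N. 2 powr (- d * real i)) \<le> 1 / (1 - 2 powr (- d))"
proof -
  have "(\<Sum>i<N. 2 powr (- d * real i)) = (\<Sum>i<N. (2 powr (- d)) ^ i)"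
    by (simp add: powr_powr flip: powr_realpow)
  also have "\<dots> \<le> 1 / (1 - 2 powr (- d))"
    using assms two_powr_neg_lt_1 by (intro sum_geometric_le) auto
  finally show ?thesis .
qed

text \<open>Splitting at the integer part of \<open>t\<close> leaves two one-sided geometric series,
  hence the factor 2. The bound does not depend on the position of the peak \<open>t\<close>, which
  may even lie outside the range of summation.\<close>

lemma sum_two_powr_dist_le:
  fixes d t :: real
  assumes "0 < d"
  shows "(\<Sum>i<N. 2 powr (- d * \<bar>real i - t\<bar>)) \<le> 2 / (1 - 2 powr (- d))"
proof -
  define u where "u = nat \<lfloor>t\<rfloor>"
  define G where "G = 1 / (1 - 2 powr (- d))"
  have G: "(\<Sum>i<N. 2 powr (- d * real i)) \<le> G" for N
    unfolding G_def using assms by (rule sum_two_powr_le)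
  have "(\<Sum>i<N. 2 powr (- d * \<bar>real i - t\<bar>))
      \<le> (\<Sum>i<N. (if i \<le> u then 2 powr (- d * real (u - i)) else 0)
               + (if u < i then 2 powr (- d * real (i - Suc u)) else 0))"
  proof (rule sum_mono)
    fix i
    show "2 powr (- d * \<bar>real i - t\<bar>) \<le> (if i \<le> u then 2 powr (- d * real (u - i)) else 0)
             + (if u < i then 2 powr (- d * real (i - Suc u)) else 0)"
    proof (cases "i \<le> u")
      case True
      have "real (u - i) \<le> \<bar>real i - t\<bar>"
        using True unfolding u_def by (cases "0 \<le> t") (auto simp: of_nat_diff, linarith)
      then show ?thesis using True assms by simp
    next
      case False
      have "real (i - Suc u) \<le> \<bar>real i - t\<bar>"
        using False unfolding u_def by (cases "0 \<le> t") (auto simp: of_nat_diff, linarith+)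
      then show ?thesis using False assms by simp
    qed
  qed
  also have "\<dots> = (\<Sum>i\<in>{i. i < N \<and> i \<le> u}. 2 powr (- d * real (u - i)))
                + (\<Sum>i\<in>{i. i < N \<and> u < i}. 2 powr (- d * real (i - Suc u)))"
    by (simp add: sum.distrib sum.If_cases Int_def)
  also have "\<dots> \<le> G + G"
  proof (rule add_mono)
    have "(\<Sum>i\<in>{i. i < N \<and> i \<le> u}. 2 powr (- d * real (u - i)))
        = (\<Sum>j\<in>(\<lambda>i. u - i) ` {i. i < N \<and> i \<le> u}. 2 powr (- d * real j))"
      by (subst sum.reindex) (auto simp: inj_on_def)
    also have "\<dots> \<le> (\<Sum>j<Suc u. 2 powr (- d * real j))"
      by (rule sum_mono2) auto
    finally show "(\<Sum>i\<in>{i. i < N \<and> i \<le> u}. 2 powr (- d * real (u - i))) \<le> G"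
      using G[of "Suc u"] by linarith
    have "(\<Sum>i\<in>{i. i < N \<and> u < i}. 2 powr (- d * real (i - Suc u)))
        = (\<Sum>j\<in>(\<lambda>i. i - Suc u) ` {i. i < N \<and> u < i}. 2 powr (- d * real j))"
      by (subst sum.reindex) (auto simp: inj_on_def)
    also have "\<dots> \<le> (\<Sum>j<N. 2 powr (- d * real j))"
      by (rule sum_mono2) auto
    finally show "(\<Sum>i\<in>{i. i < N \<and> u < i}. 2 powr (- d * real (i - Suc u))) \<le> G"
      using G[of N] by linarith
  qed
  finally show ?thesis by (simp add: G_def)
qed

text \<open>The two geometric sequences cross at height
  \<open>A powr (b / (a + b)) * B powr (a / (a + b))\<close>.\<close>

lemma sum_min_peak_le:
  fixes A B a b d :: real
  assumes "0 < A" "0 < B" "0 < d" "d \<le> a" "d \<le> b"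
  shows "(\<Sum>i<N. min (A * 2 powr (a * real i)) (B * 2 powr (- b * real i)))
      \<le> 2 / (1 - 2 powr (- d)) * (A powr (b / (a + b)) * B powr (a / (a + b)))"
proof -
  \<comment> \<open>The real index at which both sequences take the same value,
    \<open>V\<close>.\<close>
  define t where "t = log 2 (B / A) / (a + b)"
  define V where "V = A powr (b / (a + b)) * B powr (a / (a + b))"
  have ab: "0 < a + b" using assms by linarith
  have 2: "2 powr (c * t) = (B / A) powr (c / (a + b))" for c
    using assms by (simp add: t_def powr_def log_def)
  define x y where "x = a / (a + b)" and "y = b / (a + b)"
  have xy: "y + x = 1" using ab by (simp add: x_def y_def add.commute flip: add_divide_distrib)
  have A: "A = V * 2 powr (- a * t)"
  proof -
    have "V * 2 powr (- a * t) = A powr y * B powr x * (B / A) powr (- x)"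
      using 2[of "-a"] by (simp add: V_def x_def y_def)
    also have "\<dots> = A powr y * A powr x"
      using assms by (simp add: powr_divide powr_minus field_simps)
    also have "\<dots> = A powr (y + x)"
      by (simp only: powr_add)
    finally show ?thesis using assms xy by simp
  qed
  have B: "B = V * 2 powr (b * t)"
  proof -
    have "V * 2 powr (b * t) = A powr y * B powr x * (B / A) powr y"
      using 2[of "b"] by (simp add: V_def x_def y_def)
    also have "\<dots> = B powr y * B powr x"
      using assms by (simp add: powr_divide field_simps)
    also have "\<dots> = B powr (y + x)"
      by (simp only: powr_add)
    finally show ?thesis using assms xy by simp
  qed
  have V: "0 \<le> V" by (simp add: V_def)
  have "(\<Sum>i<N. min (A * 2 powr (a * real i)) (B * 2 powr (- b * real i)))
      \<le> (\<Sum>i<N. V * 2 powr (- d * \<bar>real i - t\<bar>))"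
  proof (rule sum_mono)
    fix i
    show "min (A * 2 powr (a * real i)) (B * 2 powr (- b * real i)) \<le> V * 2 powr (- d * \<bar>real i - t\<bar>)"
    \<comment> \<open>Left of the crossing the rising sequence is bounded, right of it the falling
      one; both decay away from \<open>t\<close> at a rate of at least \<open>d\<close>.\<close>
    proof (cases "real i \<le> t")
      case True
      have "A * 2 powr (a * real i) = V * 2 powr (a * (real i - t))"
        by (subst A) (simp add: algebra_simps flip: powr_add)
      also have "\<dots> \<le> V * 2 powr (- d * \<bar>real i - t\<bar>)"
        using V True mult_right_mono[OF assms(4), of "t - real i"]
        by (intro mult_left_mono) (auto simp: algebra_simps)
      finally show ?thesis by linarith
    next
      case False
      have "B * 2 powr (- b * real i) = V * 2 powr (- b * (real i - t))"
        by (subst B) (simp add: algebra_simps flip: powr_add)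
      also have "\<dots> \<le> V * 2 powr (- d * \<bar>real i - t\<bar>)"
        using V False mult_right_mono[OF assms(5), of "real i - t"]
        by (intro mult_left_mono) (auto simp: algebra_simps)
      finally show ?thesis by linarith
    qed
  qed
  also have "\<dots> = V * (\<Sum>i<N. 2 powr (- d * \<bar>real i - t\<bar>))"
    by (simp add: sum_distrib_left)
  also have "\<dots> \<le> V * (2 / (1 - 2 powr (- d)))"
    using V sum_two_powr_dist_le[OF assms(3)] by (intro mult_left_mono) auto
  finally show ?thesis by (simp add: V_def mult.commute)
qed

text \<open>The limiting case of a rising sequence with rate 0: about \<open>t + 1\<close> terms
  stay at height \<open>A\<close> before the geometric decay sets in. This count is the source of
  the logarithms, both on the levels and on the shells.\<close>

lemma sum_min_plateau_le:
  fixes A B b t :: real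
  assumes "0 \<le> A" "0 < b" "0 \<le> t" "B \<le> A * 2 powr (b * t)"
  shows "(\<Sum>i<N. min A (B * 2 powr (- b * real i))) \<le> A * (t + 1 + 2 / (1 - 2 powr (- b)))"
proof -
  have "(\<Sum>i<N. min A (B * 2 powr (- b * real i)))
      \<le> (\<Sum>i<N. A * ((if real i \<le> t then 1 else 0) + 2 powr (- b * \<bar>real i - t\<bar>)))"
  proof (rule sum_mono)
    fix i
    show "min A (B * 2 powr (- b * real i)) \<le> A * ((if real i \<le> t then 1 else 0) + 2 powr (- b * \<bar>real i - t\<bar>))"
    proof (cases "real i \<le> t")
      case True then show ?thesis using assms(1)
        by (simp add: distrib_left min.coboundedI1)
    next
      case False
      have "B * 2 powr (- b * real i) \<le> A * 2 powr (b * t) * 2 powr (- b * real i)"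
        using assms by (intro mult_right_mono) auto
      also have "\<dots> = A * 2 powr (- b * \<bar>real i - t\<bar>)"
        using False by (simp add: algebra_simps flip: powr_add)
      finally show ?thesis using False by simp
    qed
  qed
  also have "\<dots> = A * (real (card {i. i < N \<and> real i \<le> t}) + (\<Sum>i<N. 2 powr (- b * \<bar>real i - t\<bar>)))"
    by (simp add: sum.distrib sum.If_cases Int_def flip: sum_distrib_left)
  also have "\<dots> \<le> A * ((t + 1) + 2 / (1 - 2 powr (- b)))"
  proof (intro mult_left_mono add_mono assms(1) sum_two_powr_dist_le assms(2))
    have "card {i. i < N \<and> real i \<le> t} \<le> card {..nat \<lfloor>t\<rfloor>}"
      by (rule card_mono) (auto simp: le_nat_floor)
    then show "real (card {i. i < N \<and> real i \<le> t}) \<le> t + 1"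
      using assms(3) by simp linarith
  qed
  finally show ?thesis by simp
qed

text \<open>The cost caused by one shell of mass \<open>a\<close>, in units of its radius:
  \<open>2 powr (- p * l)\<close> is the \<open>p\<close>-th power of the distance moved at level
  \<open>l\<close>, \<open>(15 * 2 ^ l) ^ k\<close> bounds the number of cells, and the square root
  is their total fluctuation after Cauchy-Schwarz.\<close>

definition level_sum :: "real \<Rightarrow> nat \<Rightarrow> nat \<Rightarrow> nat \<Rightarrow> real \<Rightarrow> real" where
  "level_sum p k n L a =
     (\<Sum>l<L. 2 powr (- p * real l) * min a (sqrt ((15 * 2 ^ l) ^ k * a / real n)))"

lemma sqrt_scale_eq:
  assumes "0 \<le> a"
  shows "sqrt ((15 * 2 ^ l) ^ k * a / real n)
       = 15 powr (real k / 2) * 2 powr (real k / 2 * real l) * sqrt (a / real n)"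
proof -
  have "sqrt ((15 * 2 ^ l) ^ k * (a / real n)) = sqrt ((15 * 2 ^ l) ^ k) * sqrt (a / real n)"
    by (rule real_sqrt_mult)
  also have "sqrt ((15 * 2 ^ l) ^ k) = (15 * 2 powr real l) powr (real k / 2)"
  proof -
    have "sqrt ((15 * 2 ^ l) ^ k) = ((15 * 2 powr real l) powr real k) powr (1 / 2)"
      by (simp add: powr_realpow powr_half_sqrt)
    then show ?thesis by (simp add: powr_powr del: powr_realpow)
  qed
  also have "\<dots> = 15 powr (real k / 2) * 2 powr (real k / 2 * real l)"
    by (simp add: powr_mult powr_powr mult.commute)
  finally show ?thesis by simp
qed

section \<open>Level sums below, above and at the critical dimension \<open>k = 2 p\<close>\<close>

lemma level_sum_mono: "a \<le> b \<Longrightarrow> level_sum p k n L a \<le> level_sum p k n L b"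
  unfolding level_sum_def
  by (intro sum_mono mult_left_mono min.mono real_sqrt_le_mono divide_right_mono mult_left_mono) auto

lemma level_sum_le_mass:
  assumes "1 \<le> p" "0 \<le> a"
  shows "level_sum p k n L a \<le> 2 * a"
proof -
  have "level_sum p k n L a \<le> (\<Sum>l<L. 2 powr (- p * real l) * a)"
    unfolding level_sum_def by (intro sum_mono mult_left_mono) auto
  also have "\<dots> \<le> (\<Sum>l<L. 2 powr (- 1 * real l) * a)"
    using assms by (intro sum_mono mult_right_mono) (auto simp: mult_le_cancel_right1)
  also have "\<dots> = (\<Sum>l<L. 2 powr (- 1 * real l)) * a"
    by (simp add: sum_distrib_right)
  also have "\<dots> \<le> 1 / (1 - 2 powr (- 1)) * a"
    using assms by (intro mult_right_mono sum_two_powr_le) auto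
  finally show ?thesis by (simp add: powr_minus)
qed

text \<open>Below the critical dimension the fluctuation term decays along the levels, so the
  coarsest level dominates. The factor \<open>15 powr (k / 2)\<close> is at most
  \<open>15 powr p\<close> because \<open>k / 2 \<le> p\<close>.\<close>

lemma level_sum_subcritical:
  assumes "0 < d" "real k / 2 + d \<le> p" "0 \<le> a"
  shows "level_sum p k n L a \<le> 15 powr p / (1 - 2 powr (- d)) * sqrt (a / real n)"
proof -
  have "level_sum p k n L a \<le> (\<Sum>l<L. 15 powr p * sqrt (a / real n) * 2 powr (- d * real l))"
    unfolding level_sum_def
  proof (rule sum_mono)
    fix l
    have "2 powr (- p * real l) * min a (sqrt ((15 * 2 ^ l) ^ k * a / real n))
        \<le> 2 powr (- p * real l) * (15 powr (real k / 2) * 2 powr (real k / 2 * real l) * sqrt (a / real n))"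
      by (simp only: sqrt_scale_eq[OF assms(3)]) (intro mult_left_mono; simp)
    also have "\<dots> = 15 powr (real k / 2) * sqrt (a / real n) * 2 powr ((real k / 2 - p) * real l)"
      by (simp add: left_diff_distrib powr_diff powr_minus_divide)
    also have "\<dots> \<le> 15 powr p * sqrt (a / real n) * 2 powr (- d * real l)"
    proof (intro mult_mono)
      have "(real k / 2 - p) * real l \<le> - d * real l"
        using assms by (intro mult_right_mono) auto
      then show "2 powr ((real k / 2 - p) * real l) \<le> (2::real) powr (- d * real l)" by simp
    qed (use assms in auto)
    finally show "2 powr (- p * real l) * min a (sqrt ((15 * 2 ^ l) ^ k * a / real n))
        \<le> 15 powr p * sqrt (a / real n) * 2 powr (- d * real l)" .
  qed
  also have "\<dots> = 15 powr p * sqrt (a / real n) * (\<Sum>l<L. 2 powr (- d * real l))"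
    by (simp add: sum_distrib_left)
  also have "\<dots> \<le> 15 powr p * sqrt (a / real n) * (1 / (1 - 2 powr (- d)))"
    using assms by (intro mult_left_mono sum_two_powr_le) auto
  finally show ?thesis by simp
qed

text \<open>Above the critical dimension the fluctuation grows with the level until it meets the
  mass. At the crossing the factor \<open>15 powr (k / 2)\<close> is raised to the power
  \<open>2 * p / k\<close>, which leaves \<open>15 powr p\<close> and removes the dimension.\<close>

lemma level_sum_supercritical:
  assumes "0 < d" "d \<le> p" "p + d \<le> real k / 2" "0 < a" "0 < n"
  shows "level_sum p k n L a
       \<le> 2 / (1 - 2 powr (- d)) * 15 powr p * (real n powr (- (p / real k)) * a powr (1 - p / real k))"
proof -
  define A where "A = 15 powr (real k / 2) * sqrt (a / real n)"
  have k: "0 < real k" using assms by linarith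
  have A: "0 < A" using assms by (simp add: A_def)
  have "level_sum p k n L a
      = (\<Sum>l<L. min (A * 2 powr ((real k / 2 - p) * real l)) (a * 2 powr (- p * real l)))"
    unfolding level_sum_def sqrt_scale_eq[OF less_imp_le[OF assms(4)]]
  proof (rule sum.cong[OF refl])
    fix l
    have "2 powr (- p * real l) * (15 powr (real k / 2) * 2 powr (real k / 2 * real l) * sqrt (a / real n))
        = A * 2 powr ((real k / 2 - p) * real l)"
      by (simp add: A_def left_diff_distrib powr_diff powr_minus_divide)
    then show "2 powr (- p * real l) * min a (15 powr (real k / 2) * 2 powr (real k / 2 * real l) * sqrt (a / real n))
        = min (A * 2 powr ((real k / 2 - p) * real l)) (a * 2 powr (- p * real l))"
      by (simp add: min_mult_distrib_left min.commute mult.commute)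
  qed
  also have "\<dots> \<le> 2 / (1 - 2 powr (- d)) * (A powr (p / (real k / 2 - p + p))
      * a powr ((real k / 2 - p) / (real k / 2 - p + p)))"
    using assms A by (intro sum_min_peak_le) auto
  also have "p / (real k / 2 - p + p) = 2 * p / real k"
    by simp
  also have "(real k / 2 - p) / (real k / 2 - p + p) = 1 - 2 * p / real k"
    using k by (simp add: field_simps)
  also have "A powr (2 * p / real k) = 15 powr p * (a / real n) powr (p / real k)"
    using assms k unfolding A_def
    by (simp add: powr_mult powr_powr flip: powr_half_sqrt)
  also have "(a / real n) powr (p / real k) = a powr (p / real k) * real n powr (- (p / real k))"
    using assms by (simp add: powr_divide powr_minus divide_simps)
  also have "15 powr p * (a powr (p / real k) * real n powr (- (p / real k))) * a powr (1 - 2 * p / real k)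
      = 15 powr p * (real n powr (- (p / real k)) * (a powr (p / real k) * a powr (1 - 2 * p / real k)))"
    by (simp only: mult_ac)
  also have "a powr (p / real k) * a powr (1 - 2 * p / real k) = a powr (1 - p / real k)"
    by (simp flip: powr_add)
  finally show ?thesis by (simp add: mult.assoc)
qed

text \<open>At \<open>k = 2 p\<close> the gain \<open>2 powr (- p * l)\<close> exactly cancels the
  growth of the fluctuation, so the levels up to \<open>t\<close> contribute equally;
  \<open>2 powr (2 * t)\<close> is an upper bound for \<open>a * n\<close>.\<close>

lemma level_sum_critical:
  assumes "1 \<le> p" "real k = 2 * p" "0 \<le> a" "0 < n" "0 \<le> t" "a \<le> 2 powr (2 * t) / real n"
  shows "level_sum p k n L a \<le> 15 powr p * sqrt (a / real n) * (t + 5)"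
proof -
  define A where "A = 15 powr p * sqrt (a / real n)"
  have "level_sum p k n L a = (\<Sum>l<L. min A (a * 2 powr (- p * real l)))"
    unfolding level_sum_def sqrt_scale_eq[OF assms(3)] assms(2)
    by (intro sum.cong) (auto simp: A_def min_mult_distrib_left min.commute mult_ac powr_minus)
  also have "\<dots> \<le> A * (t + 1 + 2 / (1 - 2 powr (- p)))"
  proof (rule sum_min_plateau_le)
    have "a = sqrt (a / real n) * sqrt (a * real n)"
      using assms by (simp flip: real_sqrt_mult)
    also have "\<dots> \<le> sqrt (a / real n) * 2 powr t"
    proof (intro mult_left_mono real_le_lsqrt)
      show "a * real n \<le> (2 powr t)\<^sup>2"
        using assms by (simp add: field_simps powr_add power2_eq_square flip: powr_add)
    qed (use assms in auto)
    also have "\<dots> \<le> A * 2 powr (p * t)"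
    proof (intro mult_mono)
      have "1 \<le> (15::real) powr p" using assms by (simp add: ge_one_powr_ge_zero)
      then have "1 * sqrt (a / real n) \<le> 15 powr p * sqrt (a / real n)"
        using assms(3) by (intro mult_right_mono) auto
      then show "sqrt (a / real n) \<le> A" by (simp add: A_def)
      show "2 powr t \<le> (2::real) powr (p * t)"
        using assms mult_right_mono[of 1 p t] by simp
    qed (use assms in \<open>auto simp: A_def\<close>)
    finally show "a \<le> A * 2 powr (p * t)" .
  qed (use assms in \<open>auto simp: A_def\<close>)
  \<comment> \<open>Since \<open>p \<ge> 1\<close>, the geometric tail is at most 4, and
    \<open>1 + 4\<close> gives the 5.\<close>
  also have "\<dots> \<le> A * (t + 5)"
  proof (rule mult_left_mono)
    have "2 powr (- p) \<le> (2::real) powr (- 1)" using assms by (intro powr_mono) auto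
    also have "\<dots> = 1 / 2" by (simp add: powr_minus)
    finally have "1 / 2 \<le> 1 - (2::real) powr (- p)" by linarith
    then have "2 / (1 - (2::real) powr (- p)) \<le> 2 / (1 / 2)" by (intro divide_left_mono) auto
    then show "t + 1 + 2 / (1 - 2 powr (- p)) \<le> t + 5" by simp
  qed (use assms in \<open>auto simp: A_def\<close>)
  finally show ?thesis by (simp add: A_def)
qed

text \<open>A weighted geometric mean of mass and fluctuation replaces their minimum. The weight
  \<open>2 * e\<close> on the mass restores geometric decay at the critical dimension, at the price
  of the smaller exponent \<open>1 / 2 - e\<close> of \<open>n\<close>.\<close>

lemma level_sum_critical_interpolated:
  assumes "1 \<le> p" "real k = 2 * p" "0 < a" "0 < n" "0 < e" "e < 1 / 2"
  shows "level_sum p k n L a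
       \<le> 15 powr p / (1 - 2 powr (- (2 * e))) * (real n powr (- (1 / 2 - e)) * a powr (1 / 2 + e))"
proof -
  define W where "W = real n powr (- (1 / 2 - e)) * a powr (1 / 2 + e)"
  have "level_sum p k n L a \<le> (\<Sum>l<L. 15 powr p * W * 2 powr (- (2 * e) * real l))"
    unfolding level_sum_def sqrt_scale_eq[OF less_imp_le[OF assms(3)]] assms(2)
  proof (rule sum_mono)
    fix l
    define X where "X = 15 powr p * 2 powr (p * real l) * sqrt (a / real n)"
    have X: "0 < X" using assms by (simp add: X_def)
    have "min a X = min a X powr (2 * e) * min a X powr (1 - 2 * e)"
      using assms X by (simp flip: powr_add)
    also have "\<dots> \<le> a powr (2 * e) * X powr (1 - 2 * e)"
      using assms X by (intro mult_mono powr_mono2) auto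
    also have "X powr (1 - 2 * e) = 15 powr (p * (1 - 2 * e)) * 2 powr (p * real l * (1 - 2 * e))
        * (a / real n) powr (1 / 2 - e)"
      using assms by (simp add: X_def powr_mult powr_powr diff_divide_distrib flip: powr_half_sqrt)
    also have "(a / real n) powr (1 / 2 - e) = a powr (1 / 2 - e) * real n powr (- (1 / 2 - e))"
    proof -
      have "(a / real n) powr x = a powr x * real n powr (- x)" for x
        using assms by (simp add: powr_divide powr_minus_divide)
      then show ?thesis .
    qed
    also have "a powr (2 * e) * (15 powr (p * (1 - 2 * e)) * 2 powr (p * real l * (1 - 2 * e))
        * (a powr (1 / 2 - e) * real n powr (- (1 / 2 - e))))
      = 15 powr (p * (1 - 2 * e)) * 2 powr (p * real l * (1 - 2 * e))
        * (real n powr (- (1 / 2 - e)) * (a powr (2 * e) * a powr (1 / 2 - e)))"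
      by (simp only: mult_ac)
    also have "a powr (2 * e) * a powr (1 / 2 - e) = a powr (1 / 2 + e)"
      by (simp add: add.commute flip: powr_add)
    finally have "2 powr (- p * real l) * min a X
        \<le> 2 powr (- p * real l) * (15 powr (p * (1 - 2 * e)) * 2 powr (p * real l * (1 - 2 * e)) * W)"
      unfolding W_def by (intro mult_left_mono) auto
    also have "\<dots> = 15 powr (p * (1 - 2 * e)) * W * (2 powr (- p * real l) * 2 powr (p * real l * (1 - 2 * e)))"
      by (simp only: mult_ac)
    also have "2 powr (- p * real l) * 2 powr (p * real l * (1 - 2 * e)) = (2::real) powr (- (2 * e * (p * real l)))"
      by (simp add: algebra_simps flip: powr_add)
    also have "15 powr (p * (1 - 2 * e)) * W * 2 powr (- (2 * e * (p * real l)))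
        \<le> 15 powr p * W * 2 powr (- (2 * e) * real l)"
    proof (intro mult_mono)
      show "15 powr (p * (1 - 2 * e)) \<le> (15::real) powr p"
        using assms by (simp add: mult_left_le)
      have "real l \<le> p * real l" using assms mult_right_mono[of 1 p "real l"] by simp
      then show "2 powr (- (2 * e * (p * real l))) \<le> (2::real) powr (- (2 * e) * real l)"
        using assms by simp
    qed (auto simp: W_def)
    finally show "2 powr (- p * real l) * min a
        (15 powr (2 * p / 2) * 2 powr (2 * p / 2 * real l) * sqrt (a / real n))
        \<le> 15 powr p * W * 2 powr (- (2 * e) * real l)"
      by (simp add: X_def)
  qed
  also have "\<dots> = 15 powr p * W * (\<Sum>l<L. 2 powr (- (2 * e) * real l))"
    by (simp add: sum_distrib_left)
  also have "\<dots> \<le> 15 powr p * W * (1 / (1 - 2 powr (- (2 * e))))"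
    using assms by (intro mult_left_mono sum_two_powr_le) (auto simp: W_def)
  finally show ?thesis by (simp add: W_def)
qed

text \<open>Light tails: the fluctuation term alone is summable over the shells, and the innermost
  shells dominate.\<close>

lemma shell_sum_negative:
  assumes "0 < d" "p - q * (1 - s) \<le> - d" "0 \<le> Q"
  shows "(\<Sum>m<M. 2 powr (p * real m) * min (2 powr (- q * real m)) (Q * 2 powr (- q * (1 - s) * real m)))
       \<le> Q * (1 / (1 - 2 powr (- d)))"
    (is "sum ?a _ \<le> _")
proof -
  have "(\<Sum>m<M. ?a m)
      \<le> (\<Sum>m<M. Q * 2 powr (- d * real m))"
  proof (rule sum_mono)
    fix m
    have "?a m
        \<le> 2 powr (p * real m) * (Q * 2 powr (- q * (1 - s) * real m))"
      by (intro mult_left_mono) auto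
    also have "\<dots> = Q * 2 powr ((p - q * (1 - s)) * real m)"
      by (simp add: algebra_simps flip: powr_add)
    also have "\<dots> \<le> Q * 2 powr (- d * real m)"
      using assms mult_right_mono[OF assms(2), of "real m"] by (intro mult_left_mono) auto
    finally show "?a m
        \<le> Q * 2 powr (- d * real m)" .
  qed
  also have "\<dots> \<le> Q * (1 / (1 - 2 powr (- d)))"
    unfolding sum_distrib_left[symmetric]
    using assms by (intro mult_left_mono sum_two_powr_le) auto
  finally show ?thesis .
qed

text \<open>Absorbing \<open>2 powr (p * m)\<close> into the minimum brings the sum into the form of
  \<open>sum_min_peak_le\<close> and \<open>sum_min_plateau_le\<close>, with the tail mass as the
  falling sequence.\<close>

lemma shell_sum_eq:
  "(\<Sum>m<M. 2 powr (p * real m) * min (2 powr (- q * real m)) (Q * 2 powr (- q * (1 - s) * real m)))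
  = (\<Sum>m<M. min (Q * 2 powr ((p - q * (1 - s)) * real m)) (1 * 2 powr (- (q - p) * real m)))"
  (is "sum ?a _ = sum ?b _")
proof (rule sum.cong[OF refl])
  fix m
  have "?a m
      = min (2 powr (p * real m) * 2 powr (- q * real m)) (Q * (2 powr (p * real m) * 2 powr (- q * (1 - s) * real m)))"
    by (simp add: min_mult_distrib_left mult.left_commute)
  also have "\<dots> = ?b m"
    by (simp add: algebra_simps min.commute flip: powr_add)
  finally show "?a m
      = ?b m" .
qed

text \<open>Balanced tails: the fluctuation stays at \<open>Q\<close> over the shells until the
  weighted tail mass \<open>2 powr (- (q - p) * m)\<close> drops below \<open>n powr (- s)\<close>,
  which takes about \<open>s * log 2 n / (q - p)\<close> shells.\<close>

lemma shell_sum_zero: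
  assumes "p - q * (1 - s) = 0" "p < q" "0 \<le> s" "0 < n" "real n powr (- s) \<le> Q"
  shows "(\<Sum>m<M. 2 powr (p * real m) * min (2 powr (- q * real m)) (Q * 2 powr (- q * (1 - s) * real m)))
       \<le> Q * (s * log 2 (real n) / (q - p) + 1 + 2 / (1 - 2 powr (- (q - p))))"
  unfolding shell_sum_eq assms(1)
proof -
  have "2 powr ((q - p) * (s * log 2 (real n) / (q - p))) = real n powr s"
  proof -
    have "(q - p) * (s * log 2 (real n) / (q - p)) = s * log 2 (real n)"
      using assms(2) by simp
    then show ?thesis using assms(4) by (simp add: powr_def log_def)
  qed
  moreover have "1 = real n powr (- s) * real n powr s"
    using assms by (simp flip: powr_add)
  moreover have "\<dots> \<le> Q * real n powr s"
    using assms by (intro mult_right_mono) auto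
  ultimately have "1 \<le> Q * 2 powr ((q - p) * (s * log 2 (real n) / (q - p)))" by simp
  moreover have "0 \<le> Q" using assms(5) powr_ge_zero[of "real n" "-s"] by linarith
  ultimately show "(\<Sum>m<M. min (Q * 2 powr (0 * real m)) (1 * 2 powr (- (q - p) * real m)))
     \<le> Q * (s * log 2 (real n) / (q - p) + 1 + 2 / (1 - 2 powr (- (q - p))))"
    using sum_min_plateau_le[of Q "q - p" "s * log 2 (real n) / (q - p)" 1 M] assms by simp
qed

text \<open>Heavy tails: the terms grow up to the shell where fluctuation and mass cross. In the
  height of this peak \<open>s\<close> cancels, so the rate is \<open>1 - p / q\<close> whatever the
  dimension.\<close>

lemma shell_sum_positive:
  assumes "0 < d" "d \<le> p - q * (1 - s)" "d \<le> q - p" "0 < s" "0 < q" "0 < n"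
  shows "(\<Sum>m<M. 2 powr (p * real m) * min (2 powr (- q * real m)) (real n powr (- s) * 2 powr (- q * (1 - s) * real m)))
       \<le> 2 / (1 - 2 powr (- d)) * real n powr (- (1 - p / q))"
  unfolding shell_sum_eq
proof -
  have "(\<Sum>m<M. min (real n powr (- s) * 2 powr ((p - q * (1 - s)) * real m)) (1 * 2 powr (- (q - p) * real m)))
      \<le> 2 / (1 - 2 powr (- d)) * ((real n powr (- s)) powr ((q - p) / ((p - q * (1 - s)) + (q - p)))
          * 1 powr ((p - q * (1 - s)) / ((p - q * (1 - s)) + (q - p))))"
    using assms by (intro sum_min_peak_le) auto
  also have "(real n powr (- s)) powr ((q - p) / ((p - q * (1 - s)) + (q - p))) = real n powr (- (1 - p / q))"
  proof -
    have "- s * ((q - p) / (p - q * (1 - s) + (q - p))) = - (1 - p / q)"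
      using assms by (simp add: field_simps)
    then show ?thesis by (simp only: powr_powr)
  qed
  finally show "(\<Sum>m<M. min (real n powr (- s) * 2 powr ((p - q * (1 - s)) * real m)) (1 * 2 powr (- (q - p) * real m)))
      \<le> 2 / (1 - 2 powr (- d)) * real n powr (- (1 - p / q))" by simp
qed

text \<open>Each shell is estimated both by its mass and by \<open>lev\<close>;
  \<open>K \<ge> 2\<close> lets one constant serve for the two. Since \<open>level_sum\<close> is
  monotone in the mass, the shell masses may first be replaced by their upper bounds.\<close>

lemma shell_level_sum_le:
  fixes p q s \<Lambda> K :: real and a :: "nat \<Rightarrow> real"
  assumes "1 \<le> p" "0 \<le> q" "0 < s" "s < 1" "0 < n" "2 \<le> K" "1 \<le> \<Lambda>"
    and lev: "\<And>b. 0 < b \<Longrightarrow> b \<le> 2 powr q \<Longrightarrow>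
        level_sum p k n L b \<le> K * (\<Lambda> * real n powr (- s) * b powr (1 - s))"
    and a: "\<And>m. a m \<le> 2 powr q * 2 powr (- q * real m)"
  shows "(\<Sum>m<M. 2 powr (p * real m) * level_sum p k n L (a m))
       \<le> K * 2 powr q * (\<Sum>m<M. 2 powr (p * real m)
            * min (2 powr (- q * real m)) (\<Lambda> * real n powr (- s) * 2 powr (- q * (1 - s) * real m)))"
    (is "_ \<le> _ * (\<Sum>m<M. _ * ?u m)")
proof -
  have "(\<Sum>m<M. 2 powr (p * real m) * level_sum p k n L (a m))
      \<le> (\<Sum>m<M. 2 powr (p * real m) * (K * 2 powr q * ?u m))"
  proof (intro sum_mono mult_left_mono)
    fix m
    define b where "b = 2 powr q * 2 powr (- q * real m)"
    have "2 powr (- q * real m) \<le> (2::real) powr 0"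
      using assms by (intro powr_mono) auto
    then have b: "0 < b" "b \<le> 2 powr q"
      by (auto simp: b_def mult_le_cancel_left1)
    have "level_sum p k n L (a m) \<le> level_sum p k n L b"
      using a by (intro level_sum_mono) (simp add: b_def)
    also have "\<dots> \<le> min (2 * b) (K * (\<Lambda> * real n powr (- s) * b powr (1 - s)))"
      using b assms(1) lev[of b] level_sum_le_mass[of p b k n L] by simp
    also have "\<dots> \<le> min (K * (2 powr q * 2 powr (- q * real m)))
        (K * (\<Lambda> * real n powr (- s) * (2 powr q * 2 powr (- q * (1 - s) * real m))))"
    proof (rule min.mono)
      show "2 * b \<le> K * (2 powr q * 2 powr (- q * real m))"
        using b assms by (simp add: b_def mult_right_mono)
      have "b powr (1 - s) = 2 powr (q * (1 - s)) * 2 powr (- q * (1 - s) * real m)"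
        by (simp add: b_def powr_mult powr_powr mult_ac)
      also have "\<dots> \<le> 2 powr q * 2 powr (- q * (1 - s) * real m)"
        using assms by (intro mult_right_mono) (auto simp: mult_left_le)
      finally show "K * (\<Lambda> * real n powr (- s) * b powr (1 - s))
          \<le> K * (\<Lambda> * real n powr (- s) * (2 powr q * 2 powr (- q * (1 - s) * real m)))"
        using assms by (intro mult_left_mono) auto
    qed
    also have "\<dots> = K * 2 powr q * ?u m"
      using assms by (simp add: min_mult_distrib_left mult_ac)
    finally show "level_sum p k n L (a m) \<le> K * 2 powr q * ?u m" .
  qed auto
  also have "\<dots> = K * 2 powr q * (\<Sum>m<M. 2 powr (p * real m)
            * ?u m)"
    by (simp add: sum_distrib_left mult_ac)
  finally show ?thesis .
qed

section \<open>Levels and shells combined, with a constant uniform in the dimension\<close>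

definition log_factor :: "nat \<Rightarrow> real" where
  "log_factor n = max 1 (ln (real n))"

lemma log_factor_ge_1: "1 \<le> log_factor n"
  by (simp add: log_factor_def)

lemma log2_le_log_factor: "0 < n \<Longrightarrow> log 2 (real n) \<le> 2 * log_factor n"
proof -
  assume n: "0 < n"
  have "log 2 (real n) = ln (real n) / ln 2" by (simp add: log_def)
  also have "\<dots> \<le> ln (real n) / (1 / 2)"
    using n ln2_ge_two_thirds by (intro divide_left_mono) auto
  also have "\<dots> \<le> 2 * log_factor n" by (simp add: log_factor_def)
  finally show ?thesis .
qed

text \<open>The three signs of \<open>p - q * (1 - s)\<close> are the three tail regimes. The factor
  \<open>\<Lambda>\<close> carries a logarithm already lost on the levels; the balanced regime
  multiplies it by one more, and in the heavy regime the crossing is computed with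
  \<open>\<Lambda> = 1\<close>.\<close>

lemma shell_level_sum_rate:
  fixes p q s d K E \<Lambda> :: real and a :: "nat \<Rightarrow> real"
  assumes pq: "1 \<le> p" "p < q" and s: "0 < s" "s < 1" and n: "0 < n"
    and d: "0 < d" "d \<le> q - p" and K: "2 \<le> K" and E: "E \<le> s" "E \<le> 1 - p / q"
    and \<Lambda>: "1 \<le> \<Lambda>" "p - q * (1 - s) > 0 \<Longrightarrow> \<Lambda> = 1"
    and gap: "p - q * (1 - s) = 0 \<or> d \<le> \<bar>p - q * (1 - s)\<bar>"
    and lev: "\<And>b. 0 < b \<Longrightarrow> b \<le> 2 powr q \<Longrightarrow>
        level_sum p k n L b \<le> K * (\<Lambda> * real n powr (- s) * b powr (1 - s))"
    and a: "\<And>m. a m \<le> 2 powr q * 2 powr (- q * real m)"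
  shows "(\<Sum>m<M. 2 powr (p * real m) * level_sum p k n L (a m))
      \<le> K * 2 powr q * (2 / (q - p) + 1 + 2 / (1 - 2 powr (- d))) * real n powr (- E)
        * \<Lambda> * (if p - q * (1 - s) = 0 then log_factor n else 1)"
proof -
  define S where "S = (\<Sum>m<M. 2 powr (p * real m)
            * min (2 powr (- q * real m)) (\<Lambda> * real n powr (- s) * 2 powr (- q * (1 - s) * real m)))"
  define D where "D = 2 / (1 - (2::real) powr (- d))"
  have g: "(2::real) powr (- d) < 1" using d by (intro two_powr_neg_lt_1)
  have D: "0 \<le> D" using g by (simp add: D_def)
  have lf: "1 \<le> log_factor n" by (rule log_factor_ge_1)
  have E': "real n powr (- s) \<le> real n powr (- E)" "real n powr (- (1 - p / q)) \<le> real n powr (- E)"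
    using n E by (auto intro!: powr_mono)
  have Q: "real n powr (- s) \<le> \<Lambda> * real n powr (- s)"
    using \<Lambda> by (simp add: mult_le_cancel_right1)
  have "S \<le> (2 / (q - p) + 1 + D) * real n powr (- E)
        * \<Lambda> * (if p - q * (1 - s) = 0 then log_factor n else 1)"
  proof (cases "p - q * (1 - s)" "0::real" rule: linorder_cases)
    case less
    then have "S \<le> (\<Lambda> * real n powr (- s)) * (1 / (1 - 2 powr (- d)))"
      unfolding S_def using d gap \<Lambda> by (intro shell_sum_negative) auto
    also have "\<dots> \<le> (\<Lambda> * real n powr (- E)) * (2 / (q - p) + 1 + D)"
      using \<Lambda> E' g pq unfolding D_def
      by (intro mult_mono order_trans[OF divide_right_mono add_increasing[OF _ order_refl]]) auto
    finally show ?thesis using less by (simp add: mult_ac)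
  next
    case equal
    have "S \<le> (\<Lambda> * real n powr (- s)) * (s * log 2 (real n) / (q - p) + 1 + 2 / (1 - 2 powr (- (q - p))))"
      unfolding S_def using equal pq s n Q by (intro shell_sum_zero) auto
    also have "\<dots> \<le> (\<Lambda> * real n powr (- E)) * ((2 / (q - p) + 1 + D) * log_factor n)"
    proof (rule mult_mono)
      have "s * log 2 (real n) \<le> 1 * (2 * log_factor n)"
        using s n log2_le_log_factor[of n] by (intro mult_mono) auto
      then have "s * log 2 (real n) / (q - p) \<le> 2 / (q - p) * log_factor n"
        using pq by (simp add: divide_right_mono)
      moreover have "2 / (1 - 2 powr (- (q - p))) \<le> D"
        unfolding D_def using d g two_powr_neg_lt_1[of "q - p"] pq
        by (intro divide_left_mono diff_left_mono) auto
      moreover have "D * 1 \<le> D * log_factor n" using D lf by (intro mult_left_mono) auto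
      ultimately show "s * log 2 (real n) / (q - p) + 1 + 2 / (1 - 2 powr (- (q - p)))
          \<le> (2 / (q - p) + 1 + D) * log_factor n"
        using lf unfolding distrib_right mult_1 mult_1_right
        by (intro add_mono) (assumption | erule order_trans)+
      have "0 \<le> s * log 2 (real n) / (q - p)" using s n pq by simp
      moreover have "0 \<le> 2 / (1 - (2::real) powr (- (q - p)))"
        using two_powr_neg_lt_1[of "q - p"] pq by simp
      ultimately show "0 \<le> s * log 2 (real n) / (q - p) + 1 + 2 / (1 - 2 powr (- (q - p)))" by linarith
    qed (use \<Lambda> E' in \<open>auto intro!: mult_left_mono\<close>)
    finally show ?thesis using equal by (simp add: mult_ac)
  next
    case greater
    then have "S \<le> 2 / (1 - 2 powr (- d)) * real n powr (- (1 - p / q))"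
    proof -
      have "\<Lambda> * real n powr (- s) = real n powr (- s)" using greater \<Lambda> by simp
      then show ?thesis
        unfolding S_def using d gap s pq n greater by (simp only:) (intro shell_sum_positive; auto)
    qed
    also have "\<dots> \<le> (2 / (q - p) + 1 + D) * real n powr (- E)"
      using E' D pq unfolding D_def[symmetric] by (intro mult_mono) auto
    finally show ?thesis using greater \<Lambda> by simp
  qed
  then have "K * 2 powr q * S \<le> K * 2 powr q * ((2 / (q - p) + 1 + D) * real n powr (- E)
        * \<Lambda> * (if p - q * (1 - s) = 0 then log_factor n else 1))"
    using K by (intro mult_left_mono) auto
  moreover have "(\<Sum>m<M. 2 powr (p * real m) * level_sum p k n L (a m)) \<le> K * 2 powr q * S"
    unfolding S_def using pq s n K \<Lambda> lev a by (intro shell_level_sum_le) auto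
  ultimately show ?thesis by (simp add: D_def mult.assoc)
qed

text \<open>Only finitely many indices lie below \<open>N\<close>, so the smallest nonzero absolute
  value among them, together with \<open>e\<close>, gives a positive gap.\<close>

lemma uniform_gap:
  fixes f :: "nat \<Rightarrow> real"
  assumes "0 < e" "\<And>k. N \<le> k \<Longrightarrow> e \<le> \<bar>f k\<bar>"
  obtains d where "0 < d" "\<And>k. f k = 0 \<or> d \<le> \<bar>f k\<bar>"
proof -
  define S where "S = insert e ((\<lambda>k. \<bar>f k\<bar>) ` {k. k < N \<and> f k \<noteq> 0})"
  have S: "finite S" "S \<noteq> {}" by (auto simp: S_def)
  have "0 < Min S" using S assms by (subst Min_gr_iff) (auto simp: S_def)
  moreover have "f k = 0 \<or> Min S \<le> \<bar>f k\<bar>" for k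
  proof (cases "k < N")
    case True then show ?thesis using S by (auto simp: S_def intro!: Min_le)
  next
    case False
    have "Min S \<le> e" using S by (auto simp: S_def intro!: Min_le)
    then show ?thesis using assms(2)[of k] False by auto
  qed
  ultimately show ?thesis using that by blast
qed

text \<open>The bound on the single masses drives the case \<open>p < q\<close>. For
  \<open>p = q\<close> it controls each weighted mass only by a constant, which is not summable over
  the shells; there the bound on the weighted total takes over, and the exponent of \<open>n\<close>
  is 0.\<close>

theorem multiscale_sum_bound:
  fixes p q :: real
  assumes p: "1 \<le> p" and pq: "p \<le> q"
  shows "\<exists>C>0. \<forall>k n M L (a :: nat \<Rightarrow> real). 1 \<le> k \<longrightarrow> 1 \<le> n \<longrightarrow>
      (\<forall>m. 0 \<le> a m \<and> a m \<le> 2 powr q * 2 powr (- q * real m)) \<longrightarrow>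
      (\<Sum>m<M. 2 powr (p * real m) * a m) \<le> 1 + 2 powr p \<longrightarrow>
      (\<Sum>m<M. 2 powr (p * real m) * level_sum p k n L (a m))
        \<le> C * real n powr (- (p * rate_exponent p q k)) * log_factor n powr log_exponent p q k"
proof (cases "p = q")
  case True
  show ?thesis
  proof (intro exI[of _ "2 * (1 + 2 powr p)"] conjI allI impI)
    show "0 < 2 * (1 + 2 powr p)" by (smt (verit) powr_ge_zero)
    fix k n M L :: nat and a :: "nat \<Rightarrow> real"
    assume k: "1 \<le> k" "1 \<le> n" and a: "\<forall>m. 0 \<le> a m \<and> a m \<le> 2 powr q * 2 powr (- q * real m)"
      and s: "(\<Sum>m<M. 2 powr (p * real m) * a m) \<le> 1 + 2 powr p"
    have "(\<Sum>m<M. 2 powr (p * real m) * level_sum p k n L (a m))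
        \<le> (\<Sum>m<M. 2 powr (p * real m) * (2 * a m))"
      using p a by (intro sum_mono mult_left_mono level_sum_le_mass) auto
    also have "\<dots> = 2 * (\<Sum>m<M. 2 powr (p * real m) * a m)"
      by (simp add: sum_distrib_left mult_ac)
    also have "\<dots> \<le> 2 * (1 + 2 powr p) * (1 * 1)" using s by simp
    also have "\<dots> \<le> 2 * (1 + 2 powr p) * (real n powr (- (p * rate_exponent p q k)) * log_factor n powr log_exponent p q k)"
    proof (intro mult_left_mono mult_mono)
      have "rate_exponent p q k = 0" using True p by (simp add: rate_exponent_def)
      then show "1 \<le> real n powr (- (p * rate_exponent p q k))" using k by simp
      show "1 \<le> log_factor n powr log_exponent p q k"
        using log_factor_ge_1[of n] by (intro ge_one_powr_ge_zero) (auto simp: log_exponent_def)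
    qed auto
    finally show "(\<Sum>m<M. 2 powr (p * real m) * level_sum p k n L (a m))
        \<le> 2 * (1 + 2 powr p) * real n powr (- (p * rate_exponent p q k)) * log_factor n powr log_exponent p q k"
      by (simp add: mult.assoc)
  qed
next
  case False
  then have pq: "p < q" using pq by simp
  then have q: "0 < q" using p by simp
  obtain d0 where d0: "0 < d0" "\<And>k::nat. real k / 2 - p = 0 \<or> d0 \<le> \<bar>real k / 2 - p\<bar>"
  proof (rule uniform_gap[of 1 "nat \<lceil>2 * (p + 1)\<rceil>" "\<lambda>k. real k / 2 - p"])
    fix k assume "nat \<lceil>2 * (p + 1)\<rceil> \<le> k"
    then have "2 * (p + 1) \<le> real k" by linarith
    then show "1 \<le> \<bar>real k / 2 - p\<bar>" by (simp add: abs_if field_simps)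
  qed auto
  \<comment> \<open>As \<open>k\<close> grows, the exponent tends to \<open>p - q\<close>. Half of
    this distance remains once \<open>p * q / k \<le> (q - p) / 2\<close>.\<close>
  obtain d1 where d1: "0 < d1" "\<And>k::nat. p - q * (1 - p / real k) = 0 \<or> d1 \<le> \<bar>p - q * (1 - p / real k)\<bar>"
  proof (rule uniform_gap[of "(q - p) / 2" "nat \<lceil>2 * p * q / (q - p)\<rceil>" "\<lambda>k. p - q * (1 - p / real k)"])
    fix k assume "nat \<lceil>2 * p * q / (q - p)\<rceil> \<le> k"
    then have k: "2 * p * q / (q - p) \<le> real k" by linarith
    moreover have "0 < 2 * p * q / (q - p)" using p pq q by simp
    ultimately have "0 < real k" by linarith
    then have "p * q / real k \<le> (q - p) / 2"
      using k pq by (simp add: field_simps)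
    then show "(q - p) / 2 \<le> \<bar>p - q * (1 - p / real k)\<bar>"
      by (simp add: algebra_simps abs_if)
  qed (use pq in auto)
  \<comment> \<open>The denominator exceeds 1, 2 and \<open>q\<close>, so \<open>d2\<close> lies
    below the three gaps used for \<open>q \<noteq> 2 * p\<close>:
    \<open>\<bar>p - q / 2\<bar>\<close>, its half, and its quotient by \<open>q\<close>.\<close>
  define d2 where "d2 = (if q = 2 * p then 1 else \<bar>p - q / 2\<bar> / (2 + q))"
  define d where "d = Min {d0, d1, d2, p, q - p}"
  have "0 < d2" using q by (simp add: d2_def)
  then have "0 < d" unfolding d_def using d0(1) d1(1) p pq by simp
  moreover have "d \<le> x" if "x \<in> {d0, d1, d2, p, q - p}" for x
    unfolding d_def using that by (intro Min_le) auto
  ultimately have d: "0 < d" "d \<le> d0" "d \<le> d1" "d \<le> d2" "d \<le> p" "d \<le> q - p"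
    by auto
  define D where "D = 2 / (1 - (2::real) powr (- d))"
  have g: "(2::real) powr (- d) < 1" using d by (intro two_powr_neg_lt_1)
  have D: "0 < D" using g by (simp add: D_def)
  \<comment> \<open>The summands serve, in order, the trivial mass bound, the geometric level sums,
    and the critical dimension.\<close>
  define K where "K = 2 + D * 15 powr p + 15 powr p * (q + 6)"
  have K: "2 \<le> K" "D * 15 powr p \<le> K" "15 powr p * (q + 6) \<le> K"
    using D q by (auto simp: K_def)
  define C where "C = K * 2 powr q * (2 / (q - p) + 1 + D)"
  have d2': "d \<le> \<bar>p - q / 2\<bar>" if "q \<noteq> 2 * p"
  proof -
    have "d2 \<le> \<bar>p - q / 2\<bar> / 1"
      using that q by (simp only: d2_def if_False) (intro divide_left_mono; simp)
    then show ?thesis using d by simp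
  qed
  have "0 < C" using K D pq by (auto simp: C_def intro!: mult_pos_pos add_pos_pos)
  show ?thesis
  proof (intro exI[of _ C] conjI allI impI \<open>0 < C\<close>)
    fix k n M L :: nat and a :: "nat \<Rightarrow> real"
    assume k: "1 \<le> k" "1 \<le> n" and a': "\<forall>m. 0 \<le> a m \<and> a m \<le> 2 powr q * 2 powr (- q * real m)"
    let ?T = "\<Sum>m<M. 2 powr (p * real m) * level_sum p k n L (a m)"
    have a: "a m \<le> 2 powr q * 2 powr (- q * real m)" for m using a' by blast
    let ?Z = "log_factor n powr log_exponent p q k"
    have n: "0 < n" using k by simp
    define E where "E = p * rate_exponent p q k"
    have E: "E \<le> 1 - p / q" "E \<le> p / max (2 * p) (real k)"
    proof -
      have "E \<le> p * (1 / p - 1 / q)" "E \<le> p * (1 / max (2 * p) (real k))"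
        unfolding E_def rate_exponent_def using p by (intro mult_left_mono; simp)+
      moreover have "p * (1 / p - 1 / q) = 1 - p / q"
        using p by (simp add: right_diff_distrib)
      ultimately show "E \<le> 1 - p / q" "E \<le> p / max (2 * p) (real k)" by simp_all
    qed
    have E2: "E \<le> 1 / 2" "E \<le> p / real k"
    proof -
      have "p / max (2 * p) (real k) \<le> p / (2 * p)"
        using p k by (intro divide_left_mono) auto
      also have "\<dots> = 1 / 2" using p by simp
      finally show "E \<le> 1 / 2" using E p by linarith
      have "p / max (2 * p) (real k) \<le> p / real k"
        using p k by (intro divide_left_mono) auto
      then show "E \<le> p / real k" using E by simp
    qed
    have lf: "1 \<le> log_factor n" by (rule log_factor_ge_1)
    have rate: "?T \<le> C * real n powr (- E) * (\<Lambda> * (if p - q * (1 - s) = 0 then log_factor n else 1))"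
      if "0 < s" "s < 1" "E \<le> s" "1 \<le> \<Lambda>" "p - q * (1 - s) > 0 \<Longrightarrow> \<Lambda> = 1"
        "p - q * (1 - s) = 0 \<or> d \<le> \<bar>p - q * (1 - s)\<bar>"
        "\<And>b. 0 < b \<Longrightarrow> b \<le> 2 powr q \<Longrightarrow>
           level_sum p k n L b \<le> K * (\<Lambda> * real n powr (- s) * b powr (1 - s))"
      for s \<Lambda> :: real
      using shell_level_sum_rate[OF p pq that(1,2) n d(1,6) K(1) that(3) E(1) that(4-7) a]
      by (simp add: C_def D_def mult_ac)
    \<comment> \<open>Here \<open>s\<close> is the exponent of \<open>n\<close> produced by the
      levels and \<open>\<Lambda>\<close> the logarithm that they may cost. The last conjunct says
      that levels and shells together spend no more than \<open>log_exponent\<close> allows.\<close>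
    have "\<exists>s \<Lambda>. 0 < s \<and> s < 1 \<and> E \<le> s \<and> 1 \<le> \<Lambda> \<and> (p - q * (1 - s) > 0 \<longrightarrow> \<Lambda> = 1) \<and>
        (p - q * (1 - s) = 0 \<or> d \<le> \<bar>p - q * (1 - s)\<bar>) \<and>
        (\<forall>b. 0 < b \<longrightarrow> b \<le> 2 powr q \<longrightarrow>
           level_sum p k n L b \<le> K * (\<Lambda> * real n powr (- s) * b powr (1 - s))) \<and>
        \<Lambda> * (if p - q * (1 - s) = 0 then log_factor n else 1) \<le> ?Z"
    proof -
      have lf0: "1 \<le> ?Z"
        using lf by (intro ge_one_powr_ge_zero) (auto simp: log_exponent_def)
      have half: "real n powr (- (1 / 2)) * b powr (1 - 1 / 2) = sqrt (b / real n)" if "0 < b" for b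
        using that n by (simp add: powr_minus_divide powr_half_sqrt real_sqrt_divide)
      consider "real k < 2 * p" | "2 * p < real k" | "real k = 2 * p" by linarith
      then show ?thesis
      proof cases
        case 1
        have "d \<le> p - real k / 2" using d0(2)[of k] d 1 by auto
        then have lev: "level_sum p k n L b \<le> K * (1 * real n powr (- (1 / 2)) * b powr (1 - 1 / 2))" if "0 < b" for b
        proof -
          have "level_sum p k n L b \<le> 15 powr p / (1 - 2 powr (- d)) * sqrt (b / real n)"
            using \<open>d \<le> p - real k / 2\<close> d that by (intro level_sum_subcritical) auto
          also have "\<dots> \<le> K * sqrt (b / real n)"
          proof (rule mult_right_mono)
            have "15 powr p / (1 - 2 powr (- d)) \<le> D * 15 powr p"
              using g by (simp add: D_def divide_right_mono)
            then show "15 powr p / (1 - 2 powr (- d)) \<le> K" using K by linarith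
          qed (use that in auto)
          finally show ?thesis using half[OF that] by (simp add: mult.assoc)
        qed
        have fin: "1 * (if p - q * (1 - 1 / 2) = 0 then log_factor n else 1) \<le> ?Z"
          using lf lf0 1 by (auto simp: log_exponent_def)
        have gap: "p - q * (1 - 1 / 2) = 0 \<or> d \<le> \<bar>p - q * (1 - 1 / 2)\<bar>"
          using d2' by (cases "q = 2 * p") auto
        show ?thesis
          apply (rule exI[of _ "1 / 2"], rule exI[of _ 1])
          apply (intro conjI allI impI; (fact | rule lev gap fin | simp); (assumption | fact)?)
          done
      next
        case 2
        have "d \<le> real k / 2 - p" using d0(2)[of k] d 2 by auto
        then have lev: "level_sum p k n L b \<le> K * (1 * real n powr (- (p / real k)) * b powr (1 - p / real k))" if "0 < b" for b
        proof -
          have "level_sum p k n L b \<le> D * 15 powr p * (real n powr (- (p / real k)) * b powr (1 - p / real k))"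
            unfolding D_def
            using \<open>d \<le> real k / 2 - p\<close> d that n by (intro level_sum_supercritical) auto
          also have "\<dots> \<le> K * (real n powr (- (p / real k)) * b powr (1 - p / real k))"
            using K by (intro mult_right_mono) auto
          finally show ?thesis by simp
        qed
        \<comment> \<open>A vanishing shell exponent is exactly the critical moment order for which
          \<open>log_exponent\<close> grants one logarithm.\<close>
        have "q = real k * p / (real k - p)" if "p - q * (1 - p / real k) = 0"
        proof -
          have "real k - p \<noteq> 0" "real k \<noteq> 0" using 2 p by auto
          then show ?thesis using that by (simp add: field_simps)
        qed
        then have fin: "1 * (if p - q * (1 - p / real k) = 0 then log_factor n else 1) \<le> ?Z"
          using lf lf0 2 by (auto simp: log_exponent_def)
        have gap: "p - q * (1 - p / real k) = 0 \<or> d \<le> \<bar>p - q * (1 - p / real k)\<bar>"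
          using d1(2)[of k] d(3) by linarith
        have "0 < p / real k" "p / real k < 1" using 2 p by auto
        then show ?thesis
          using E2
          apply -
          apply (rule exI[of _ "p / real k"], rule exI[of _ 1])
          apply (intro conjI allI impI; (fact | rule lev gap fin | simp); (assumption | fact)?)
          done
      next
        case 3
        show ?thesis
        proof (cases "q < 2 * p")
          case True
          \<comment> \<open>Lowering \<open>s\<close> by this \<open>e\<close> spends half of
            \<open>p - q / 2\<close>. The shell exponent stays positive, so the tails remain heavy
            and the loss on the levels does not show in the rate.\<close>
          define e where "e = (p - q / 2) / (2 * q)"
          have e: "0 < e" "e < 1 / 2" using True q pq by (auto simp: e_def field_simps)
          have de: "d \<le> 2 * e"
          proof -
            have "d2 \<le> (p - q / 2) / q"
              using True q by (simp add: d2_def) (intro divide_left_mono; simp)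
            moreover have "2 * e = (p - q / 2) / q" using q by (simp add: e_def field_simps)
            ultimately show ?thesis using d by linarith
          qed
          have gap: "p - q * (1 - (1 / 2 - e)) = (p - q / 2) / 2"
            using q by (simp add: e_def field_simps)
          have gap_d: "d \<le> (p - q / 2) / 2"
          proof -
            have "d2 \<le> (p - q / 2) / 2"
            proof -
              have "d2 = (p - q / 2) / (2 + q)" using True by (simp add: d2_def)
              also have "\<dots> \<le> (p - q / 2) / 2" using True q by (intro divide_left_mono) auto
              finally show ?thesis .
            qed
            then show ?thesis using d by linarith
          qed
          have Ee: "E \<le> 1 / 2 - e"
          proof -
            have "1 - p / q \<le> 1 / 2 - e"
              using q True by (simp add: e_def field_simps)
            then show ?thesis using E by linarith
          qed
          have lev: "level_sum p k n L b \<le> K * (1 * real n powr (- (1 / 2 - e)) * b powr (1 - (1 / 2 - e)))" if "0 < b" for b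
          proof -
            have "level_sum p k n L b \<le> 15 powr p / (1 - 2 powr (- (2 * e))) * (real n powr (- (1 / 2 - e)) * b powr (1 / 2 + e))"
              using p 3 e n that by (intro level_sum_critical_interpolated) auto
            also have "\<dots> \<le> K * (real n powr (- (1 / 2 - e)) * b powr (1 / 2 + e))"
            proof (rule mult_right_mono)
              have "15 powr p / (1 - 2 powr (- (2 * e))) \<le> 15 powr p / (1 - 2 powr (- d))"
                using de g e two_powr_neg_lt_1[of "2 * e"] by (intro divide_left_mono) auto
              also have "\<dots> \<le> D * 15 powr p" using g by (simp add: D_def divide_right_mono)
              finally show "15 powr p / (1 - 2 powr (- (2 * e))) \<le> K" using K by linarith
            qed auto
            also have "1 / 2 + e = 1 - (1 / 2 - e)" by simp
            finally show ?thesis by simp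
          qed
          have gap': "p - q * (1 - (1 / 2 - e)) = 0 \<or> d \<le> \<bar>p - q * (1 - (1 / 2 - e))\<bar>"
            unfolding gap using gap_d by linarith
          have fin: "1 * (if p - q * (1 - (1 / 2 - e)) = 0 then log_factor n else 1) \<le> ?Z"
            unfolding gap using lf0 True by simp
          have "0 < 1 / 2 - e" "1 / 2 - e < 1" using e by auto
          then show ?thesis
            using Ee
            apply -
            apply (rule exI[of _ "1 / 2 - e"], rule exI[of _ 1])
            apply (intro conjI allI impI; (fact | rule lev gap' fin | simp); (assumption | fact)?)
            done
        next
          case False
          have lev: "level_sum p k n L b \<le> K * (log_factor n * real n powr (- (1 / 2)) * b powr (1 - 1 / 2))"
            if "0 < b" "b \<le> 2 powr q" for b
          proof -
            \<comment> \<open>With this \<open>t\<close> the requirement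
              \<open>b \<le> 2 powr (2 * t) / n\<close> reads
              \<open>b \<le> 2 powr q\<close>.\<close>
            define t where "t = (q + log 2 (real n)) / 2"
            have l: "0 \<le> log 2 (real n)" using n by simp
            have "level_sum p k n L b \<le> 15 powr p * sqrt (b / real n) * (t + 5)"
            proof (rule level_sum_critical)
              show "b \<le> 2 powr (2 * t) / real n"
              proof -
                have "2 * t = q + log 2 (real n)" by (simp add: t_def)
                then have "2 powr (2 * t) = 2 powr q * real n" using n by (simp add: powr_add)
                then show ?thesis using that n by simp
              qed
            qed (use p 3 that n q l in \<open>auto simp: t_def\<close>)
            also have "\<dots> \<le> 15 powr p * sqrt (b / real n) * ((q + 6) * log_factor n)"
            proof (rule mult_left_mono)
              have "t + 5 \<le> q / 2 + log_factor n + 5"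
                using log2_le_log_factor[OF n] by (simp add: t_def)
              moreover have "q * 1 \<le> q * log_factor n" using q lf by (intro mult_left_mono) auto
              ultimately show "t + 5 \<le> (q + 6) * log_factor n"
                using lf q unfolding distrib_right mult_1_right by linarith
            qed (use that in auto)
            also have "\<dots> = 15 powr p * (q + 6) * (sqrt (b / real n) * log_factor n)"
              by (simp only: mult_ac)
            also have "\<dots> \<le> K * (sqrt (b / real n) * log_factor n)"
              using K that lf by (intro mult_right_mono) auto
            finally show ?thesis using half[OF that(1)] by (simp add: mult_ac)
          qed
          \<comment> \<open>One logarithm comes from the levels; at \<open>q = 2 * p\<close> the
            shells are flat as well and add the second.\<close>
          have fin: "log_factor n * (if p - q * (1 - 1 / 2) = 0 then log_factor n else 1) \<le> ?Z"
          proof (cases "q = 2 * p")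
            case True
            then have "log_exponent p q k = 2" using 3 by (simp add: log_exponent_def)
            moreover have "log_factor n powr 2 = log_factor n * log_factor n"
              using lf by (simp add: powr_numeral power2_eq_square)
            ultimately show ?thesis using True by simp
          next
            case neq: False
            then have "log_exponent p q k = 1" using False 3 by (simp add: log_exponent_def)
            then show ?thesis using neq False lf by simp
          qed
          have gap: "p - q * (1 - 1 / 2) = 0 \<or> d \<le> \<bar>p - q * (1 - 1 / 2)\<bar>"
            using d2' by (cases "q = 2 * p") auto
          have "\<not> 0 < p - q * (1 - 1 / 2)" using False by simp
          then show ?thesis
            using E2 lf
            apply -
            apply (rule exI[of _ "1 / 2"], rule exI[of _ "log_factor n"])
          apply (intro conjI allI impI; (fact | rule lev gap fin | simp); (assumption | fact)?)
          done
        qed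
      qed
    qed
    then obtain s \<Lambda> where s: "0 < s" "s < 1" "E \<le> s" "1 \<le> \<Lambda>" "p - q * (1 - s) > 0 \<Longrightarrow> \<Lambda> = 1"
        "p - q * (1 - s) = 0 \<or> d \<le> \<bar>p - q * (1 - s)\<bar>"
        "\<And>b. 0 < b \<Longrightarrow> b \<le> 2 powr q \<Longrightarrow>
           level_sum p k n L b \<le> K * (\<Lambda> * real n powr (- s) * b powr (1 - s))"
      and fin: "\<Lambda> * (if p - q * (1 - s) = 0 then log_factor n else 1) \<le> ?Z"
      by blast
    have "?T \<le> C * real n powr (- E) * (\<Lambda> * (if p - q * (1 - s) = 0 then log_factor n else 1))"
      by (rule rate[OF s])
    also have "\<dots> \<le> C * real n powr (- E) * ?Z"
      using fin \<open>0 < C\<close> by (intro mult_left_mono) auto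
    finally show "?T \<le> C * real n powr (- (p * rate_exponent p q k)) * ?Z"
      by (simp add: E_def)
  qed
qed

section \<open>Lattice points in a ball\<close>

lemma sum_geometric_two_sided_le:
  fixes x :: real
  assumes "0 \<le> x" "x < 1"
  shows "(\<Sum>z\<in>{- int N..int N}. x ^ nat \<bar>z\<bar>) \<le> (1 + x) / (1 - x)"
proof -
  have "(\<Sum>z\<in>{- int N..int N}. x ^ nat \<bar>z\<bar>) = 1 + 2 * (\<Sum>i<N. x ^ Suc i)"
  proof (induction N)
    case (Suc N)
    have "{- int (Suc N)..int (Suc N)} = insert (- int (Suc N)) (insert (int (Suc N)) {- int N..int N})"
      by auto
    then show ?case using Suc by (simp add: nat_add_distrib del: of_nat_Suc)
  qed auto
  also have "(\<Sum>i<N. x ^ Suc i) = x * (\<Sum>i<N. x ^ i)"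
    by (simp add: sum_distrib_left)
  also have "x * (\<Sum>i<N. x ^ i) \<le> x * (1 / (1 - x))"
    using assms by (intro mult_left_mono) (auto simp: sum_gp_strict intro!: divide_right_mono)
  also have "1 + 2 * (x * (1 / (1 - x))) = (1 + x) / (1 - x)"
    using assms by (simp add: field_simps)
  finally show ?thesis by simp
qed

lemma sum_lists_prod:
  fixes w :: "'a \<Rightarrow> 'b::comm_semiring_1"
  assumes "finite A"
  shows "(\<Sum>zs\<in>{zs. set zs \<subseteq> A \<and> length zs = k}. prod_list (map w zs)) = (\<Sum>z\<in>A. w z) ^ k"
proof (induction k)
  case 0
  have "{zs. set zs \<subseteq> A \<and> length zs = 0} = {[]}" by auto
  then show ?case by simp
next
  case (Suc k)
  have "(\<Sum>zs\<in>{zs. set zs \<subseteq> A \<and> length zs = Suc k}. prod_list (map w zs))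
      = (\<Sum>(zs, z)\<in>{zs. set zs \<subseteq> A \<and> length zs = k} \<times> A. prod_list (map w (z # zs)))"
    unfolding lists_length_Suc_eq
    by (subst sum.reindex) (auto simp: inj_on_def case_prod_unfold)
  also have "\<dots> = (\<Sum>zs\<in>{zs. set zs \<subseteq> A \<and> length zs = k}. prod_list (map w zs)) * (\<Sum>z\<in>A. w z)"
    using assms finite_lists_length_eq[OF assms, of k]
    by (simp add: sum.cartesian_product[symmetric] sum_product mult.commute)
       (rule sum.swap)
  finally show ?case using Suc by (simp add: mult.commute)
qed

text \<open>The radius is proportional to \<open>k\<close> because the cube side is proportional to
  \<open>1 / sqrt k\<close>: in that unit Cauchy-Schwarz bounds the \<open>l1\<close> norm of a
  point of a Euclidean ball by a multiple of \<open>k\<close>. Thus \<open>S\<close> bounds the mean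
  absolute coordinate.\<close>

definition l1_ball :: "nat \<Rightarrow> nat \<Rightarrow> int list set" where
  "l1_ball k S = {zs. length zs = k \<and> (\<Sum>z\<leftarrow>zs. \<bar>z\<bar>) \<le> int (S * k)}"

lemma l1_ball_subset:
  "l1_ball k S \<subseteq> {zs. set zs \<subseteq> {- int (S * k)..int (S * k)} \<and> length zs = k}"
proof (clarsimp simp: l1_ball_def)
  fix zs z assume "z \<in> set zs" "(\<Sum>z\<leftarrow>zs. \<bar>z\<bar>) \<le> int S * int (length zs)"
  moreover have "\<bar>z\<bar> \<le> (\<Sum>z\<leftarrow>zs. \<bar>z\<bar>)" if "z \<in> set zs" for z and zs :: "int list"
    using that by (intro member_le_sum_list) auto
  ultimately have "\<bar>z\<bar> \<le> int S * int (length zs)" by fastforce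
  then show "- (int S * int (length zs)) \<le> z \<and> z \<le> int S * int (length zs)" by auto
qed

lemma finite_l1_ball: "finite (l1_ball k S)"
  by (rule finite_subset[OF l1_ball_subset]) (rule finite_lists_length_eq, simp)

text \<open>Weighting a lattice point \<open>z\<close> by \<open>x\<close> to the power of its \<open>l\<^sup>1\<close> norm, with \<open>x = S / (S + 1)\<close>,
  factorises the count over the coordinates.\<close>

lemma card_l1_ball_le:
  assumes "0 < S"
  shows "real (card (l1_ball k S)) \<le> (exp 1 * (2 * real S + 1)) ^ k"
proof -
  define x where "x = real S / (real S + 1)"
  have x: "0 < x" "x < 1" using assms by (auto simp: x_def)
  define A where "A = {- int (S * k)..int (S * k)}"
  define w where "w = (\<lambda>z::int. x ^ nat \<bar>z\<bar>)"
  have prod: "prod_list (map w zs) = x ^ nat (\<Sum>z\<leftarrow>zs. \<bar>z\<bar>)" for zs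
  proof (induction zs)
    case (Cons z zs)
    have "0 \<le> (\<Sum>z\<leftarrow>zs. \<bar>z\<bar>)" by (rule sum_list_nonneg) auto
    then show ?case using Cons by (simp add: w_def nat_add_distrib power_add)
  qed simp
  have "real (card (l1_ball k S)) * x ^ (S * k) = (\<Sum>zs\<in>l1_ball k S. x ^ (S * k))"
    by simp
  also have "\<dots> \<le> (\<Sum>zs\<in>l1_ball k S. prod_list (map w zs))"
  proof (rule sum_mono)
    fix zs assume "zs \<in> l1_ball k S"
    then have "(\<Sum>z\<leftarrow>zs. \<bar>z\<bar>) \<le> int (S * k)" by (simp add: l1_ball_def)
    then have "nat (\<Sum>z\<leftarrow>zs. \<bar>z\<bar>) \<le> S * k" by (simp only: nat_le_iff)
    then show "x ^ (S * k) \<le> prod_list (map w zs)"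
      unfolding prod using x by (intro power_decreasing) auto
  qed
  also have "\<dots> \<le> (\<Sum>zs\<in>{zs. set zs \<subseteq> A \<and> length zs = k}. prod_list (map w zs))"
    using l1_ball_subset[of k S] x unfolding A_def prod
    by (intro sum_mono2 finite_lists_length_eq) auto
  also have "\<dots> = (\<Sum>z\<in>A. w z) ^ k" by (rule sum_lists_prod) (simp add: A_def)
  also have "\<dots> \<le> ((1 + x) / (1 - x)) ^ k"
    unfolding A_def w_def using x
    by (intro power_mono sum_geometric_two_sided_le sum_nonneg) auto
  also have "(1 + x) / (1 - x) = 2 * real S + 1"
    by (simp add: x_def field_simps)
  finally have "real (card (l1_ball k S)) \<le> (2 * real S + 1) ^ k / x ^ (S * k)"
    using x by (simp add: field_simps)
  also have "\<dots> = ((1 / x) ^ S * (2 * real S + 1)) ^ k"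
    by (simp add: power_mult power_mult_distrib power_divide)
  \<comment> \<open>The choice of \<open>x\<close> balances the two factors:
    \<open>(1 / x) ^ S\<close> is \<open>(1 + 1 / S) ^ S\<close>, at most \<open>exp 1\<close>,
    while the one-dimensional sum is only \<open>2 * S + 1\<close>.\<close>
  also have "\<dots> \<le> (exp 1 * (2 * real S + 1)) ^ k"
  proof (intro power_mono mult_right_mono)
    have "1 / x = 1 + 1 / real S" using assms by (simp add: x_def field_simps)
    also have "(1 + 1 / real S) ^ S \<le> exp (1 / real S) ^ S"
      by (intro power_mono) auto
    also have "\<dots> = exp 1" using assms by (simp flip: exp_of_nat_mult)
    finally show "(1 / x) ^ S \<le> exp 1" .
  qed (use x in auto)
  finally show ?thesis .
qed

section \<open>Multiscale couplings\<close>

text \<open>\<open>h\<close> is the density of the part that is already coupled, \<open>f\<close> and \<open>g\<close> are the densities of what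
  remains of \<open>\<mu>\<close> and \<open>\<nu>\<close>.\<close>

definition partial_plan ::
  "'a measure \<Rightarrow> 'a measure \<Rightarrow> ('a \<Rightarrow> 'c) \<Rightarrow> ('a \<Rightarrow> ennreal) \<Rightarrow> ('a \<Rightarrow> ennreal) \<Rightarrow> ('a \<Rightarrow> 'a \<Rightarrow> ennreal) \<Rightarrow> bool"
  where
  "partial_plan \<mu> \<nu> c f g h \<longleftrightarrow>
     f \<in> borel_measurable \<mu> \<and> g \<in> borel_measurable \<nu> \<and>
     (\<lambda>(x, y). h x y) \<in> borel_measurable (\<mu> \<Otimes>\<^sub>M \<nu>) \<and>
     (\<forall>x\<in>space \<mu>. f x + (\<integral>\<^sup>+ y. h x y \<partial>\<nu>) = 1) \<and>
     (\<forall>y\<in>space \<nu>. g y + (\<integral>\<^sup>+ x. h x y \<partial>\<mu>) = 1) \<and>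
     (\<forall>x y. h x y \<noteq> 0 \<longrightarrow> c x = c y)"

abbreviation cell_int ::
  "'a measure \<Rightarrow> ('a \<Rightarrow> 'c) \<Rightarrow> ('a \<Rightarrow> ennreal) \<Rightarrow> 'c \<Rightarrow> ennreal" where
  "cell_int \<mu> c f j \<equiv> (\<integral>\<^sup>+ x. f x * indicator {c x} j \<partial>\<mu>)"

abbreviation plan_cost ::
  "'a measure \<Rightarrow> 'b measure \<Rightarrow> ('a \<Rightarrow> 'b \<Rightarrow> ennreal) \<Rightarrow> ('a \<Rightarrow> 'b \<Rightarrow> ennreal) \<Rightarrow> ennreal" where
  "plan_cost \<mu> \<nu> cost h \<equiv> (\<integral>\<^sup>+ x. \<integral>\<^sup>+ y. cost x y * h x y \<partial>\<nu> \<partial>\<mu>)"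

text \<open>Subtraction in \<open>ennreal\<close> truncates at 0, so one of the two summands
  vanishes and the sum is the absolute difference of the masses.\<close>

definition mass_gap :: "'a measure \<Rightarrow> 'a measure \<Rightarrow> ('a \<Rightarrow> 'c) \<Rightarrow> 'c \<Rightarrow> ennreal" where
  "mass_gap \<mu> \<nu> c j =
     (emeasure \<mu> {x\<in>space \<mu>. c x = j} - emeasure \<nu> {x\<in>space \<nu>. c x = j}) +
     (emeasure \<nu> {x\<in>space \<nu>. c x = j} - emeasure \<mu> {x\<in>space \<mu>. c x = j})"

lemma ennreal_mult_compl_add:
  fixes a b :: ennreal
  assumes "b \<le> 1"
  shows "a * (1 - b) + a * b = a"
proof -
  have "a * (1 - b) + a * b = a * ((1 - b) + b)" by (simp add: distrib_left)
  also have "(1 - b) + b = 1" using assms by (simp add: diff_add_cancel_ennreal)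
  finally show ?thesis by simp
qed

section \<open>Matching the leftover mass inside the cells of one partition\<close>

locale prob_pair = A: prob_space \<mu> + B: prob_space \<nu>
  for \<mu> \<nu> :: "'a measure" +
  assumes sets_eq: "sets \<mu> = sets \<nu>"
begin

sublocale pair_sigma_finite \<mu> \<nu> ..

context
  fixes c :: "'a \<Rightarrow> 'c::countable" and f g h
  assumes c: "c \<in> \<mu> \<rightarrow>\<^sub>M count_space UNIV" and plan: "partial_plan \<mu> \<nu> c f g h"
begin

lemma c' [measurable]: "c \<in> \<mu> \<rightarrow>\<^sub>M count_space UNIV" "c \<in> \<nu> \<rightarrow>\<^sub>M count_space UNIV"
  using c measurable_cong_sets[OF sets_eq refl] by auto

lemma plan_meas [measurable]:
  "f \<in> borel_measurable \<mu>" "g \<in> borel_measurable \<nu>"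
  "(\<lambda>z. h (fst z) (snd z)) \<in> borel_measurable (\<mu> \<Otimes>\<^sub>M \<nu>)"
  using plan by (auto simp: partial_plan_def case_prod_unfold)

lemma plan_section_meas:
  "x \<in> space \<mu> \<Longrightarrow> (\<lambda>y. h x y) \<in> borel_measurable \<nu>"
  "y \<in> space \<nu> \<Longrightarrow> (\<lambda>x. h x y) \<in> borel_measurable \<mu>"
  using measurable_compose_Pair1[OF _ plan_meas(3)] measurable_Pair1[OF plan_meas(3)] by auto

lemma plan_marginal_meas [measurable]:
  "(\<lambda>x. \<integral>\<^sup>+ y. h x y \<partial>\<nu>) \<in> borel_measurable \<mu>"
  "(\<lambda>y. \<integral>\<^sup>+ x. h x y \<partial>\<mu>) \<in> borel_measurable \<nu>"
  using B.borel_measurable_nn_integral[of h \<mu>] A.borel_measurable_nn_integral[of "\<lambda>y x. h x y" \<nu>]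
    plan_meas(3) measurable_pair_swap[OF plan_meas(3)]
  by (auto simp: case_prod_unfold)

lemma
  shows plan_f: "x \<in> space \<mu> \<Longrightarrow> f x + (\<integral>\<^sup>+ y. h x y \<partial>\<nu>) = 1"
    and plan_g: "y \<in> space \<nu> \<Longrightarrow> g y + (\<integral>\<^sup>+ x. h x y \<partial>\<mu>) = 1"
    and plan_h: "h x y \<noteq> 0 \<Longrightarrow> c x = c y"
  using plan unfolding partial_plan_def by blast+

lemma plan_h0: "c x \<noteq> c y \<Longrightarrow> h x y = 0" "c y \<noteq> c x \<Longrightarrow> h x y = 0"
  by (metis plan_h)+

text \<open>The coupled part never leaves a cell, so by Fubini it takes the same mass
  \<open>H\<close> of cell \<open>j\<close> from both measures. The additive form avoids truncated
  subtraction.\<close>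

lemma plan_balance:
  "cell_int \<mu> c f j + emeasure \<nu> {x\<in>space \<nu>. c x = j}
 = cell_int \<nu> c g j + emeasure \<mu> {x\<in>space \<mu>. c x = j}"
proof -
  define H where "H = (\<integral>\<^sup>+ x. (\<integral>\<^sup>+ y. h x y * indicator {c x} j \<partial>\<nu>) \<partial>\<mu>)"
  have m: "(\<lambda>(x, y). h x y * indicator {c x} j) \<in> borel_measurable (\<mu> \<Otimes>\<^sub>M \<nu>)"
    by (simp add: indicator_def case_prod_unfold)
  have "H = (\<integral>\<^sup>+ y. (\<integral>\<^sup>+ x. h x y * indicator {c x} j \<partial>\<mu>) \<partial>\<nu>)"
    unfolding H_def by (rule Fubini'[OF m, symmetric])
  also have "\<dots> = (\<integral>\<^sup>+ y. (\<integral>\<^sup>+ x. h x y * indicator {c y} j \<partial>\<mu>) \<partial>\<nu>)"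
    by (intro nn_integral_cong) (auto simp: indicator_def intro!: plan_h0)
  also have "\<dots> = (\<integral>\<^sup>+ y. (\<integral>\<^sup>+ x. h x y \<partial>\<mu>) * indicator {c y} j \<partial>\<nu>)"
    using plan_section_meas by (intro nn_integral_cong nn_integral_multc) simp
  finally have H2: "H = (\<integral>\<^sup>+ y. (\<integral>\<^sup>+ x. h x y \<partial>\<mu>) * indicator {c y} j \<partial>\<nu>)" .
  have H1: "H = (\<integral>\<^sup>+ x. (\<integral>\<^sup>+ y. h x y \<partial>\<nu>) * indicator {c x} j \<partial>\<mu>)"
    unfolding H_def using plan_section_meas by (intro nn_integral_cong nn_integral_multc) simp
  have "cell_int \<mu> c f j + H
      = (\<integral>\<^sup>+ x. (f x + (\<integral>\<^sup>+ y. h x y \<partial>\<nu>)) * indicator {c x} j \<partial>\<mu>)"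
    unfolding H1 distrib_right by (subst nn_integral_add) (auto simp: indicator_def)
  also have "\<dots> = (\<integral>\<^sup>+ x. indicator {x\<in>space \<mu>. c x = j} x \<partial>\<mu>)"
    by (intro nn_integral_cong) (auto simp: plan_f indicator_def)
  also have "\<dots> = emeasure \<mu> {x\<in>space \<mu>. c x = j}" by simp
  finally have 1: "cell_int \<mu> c f j + H = emeasure \<mu> {x\<in>space \<mu>. c x = j}" .
  have "cell_int \<nu> c g j + H
      = (\<integral>\<^sup>+ y. (g y + (\<integral>\<^sup>+ x. h x y \<partial>\<mu>)) * indicator {c y} j \<partial>\<nu>)"
    unfolding H2 distrib_right by (subst nn_integral_add) (auto simp: indicator_def)
  also have "\<dots> = (\<integral>\<^sup>+ y. indicator {x\<in>space \<nu>. c x = j} y \<partial>\<nu>)"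
    by (intro nn_integral_cong) (auto simp: plan_g indicator_def)
  also have "\<dots> = emeasure \<nu> {x\<in>space \<nu>. c x = j}" by simp
  finally have 2: "cell_int \<nu> c g j + H = emeasure \<nu> {x\<in>space \<nu>. c x = j}" .
  show ?thesis unfolding 1[symmetric] 2[symmetric] by (simp add: ac_simps)
qed

text \<open>When one side of a cell is exhausted, the balance leaves on the other exactly its excess
  mass. Truncated subtraction gives 0 on the exhausted side, so both formulas hold at once.\<close>

lemma plan_residual:
  assumes z: "cell_int \<mu> c f j = 0 \<or> cell_int \<nu> c g j = 0"
  shows "cell_int \<mu> c f j
      = emeasure \<mu> {x\<in>space \<mu>. c x = j} - emeasure \<nu> {x\<in>space \<nu>. c x = j}"
    and "cell_int \<nu> c g j
      = emeasure \<nu> {x\<in>space \<nu>. c x = j} - emeasure \<mu> {x\<in>space \<mu>. c x = j}"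
proof -
  have ab: "F = m - n \<and> G = n - m" if "F + n = G + m" "F = 0 \<or> G = 0" "m \<noteq> \<top>" "n \<noteq> \<top>" for F G m n :: ennreal
    using that by (auto simp: diff_eq_0_iff_ennreal ennreal_add_diff_cancel_right)
      (metis ennreal_add_diff_cancel_right add.commute le_iff_add diff_eq_0_ennreal top.not_eq_extremum)+
  show "cell_int \<mu> c f j
      = emeasure \<mu> {x\<in>space \<mu>. c x = j} - emeasure \<nu> {x\<in>space \<nu>. c x = j}"
    "cell_int \<nu> c g j
      = emeasure \<nu> {x\<in>space \<nu>. c x = j} - emeasure \<mu> {x\<in>space \<mu>. c x = j}"
    using ab[OF plan_balance z] by simp_all
qed

text \<open>Exactly one label \<open>j\<close> matches \<open>c x\<close>, and the sum over
  countably many labels may be exchanged with the integral.\<close>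

lemma nn_integral_cells:
  assumes [measurable]: "u \<in> borel_measurable N" and [measurable]: "c \<in> N \<rightarrow>\<^sub>M count_space UNIV"
  shows "(\<integral>\<^sup>+ x. e (c x) * u x \<partial>N) = (\<integral>\<^sup>+ j. e j * (\<integral>\<^sup>+ x. u x * indicator {c x} j \<partial>N) \<partial>count_space UNIV)"
proof -
  have "(\<integral>\<^sup>+ x. e (c x) * u x \<partial>N) = (\<integral>\<^sup>+ x. (\<integral>\<^sup>+ j. e j * (u x * indicator {c x} j) \<partial>count_space UNIV) \<partial>N)"
  proof (intro nn_integral_cong)
    fix x
    have "(\<integral>\<^sup>+ j. e j * (u x * indicator {c x} j) \<partial>count_space UNIV)
        = (\<integral>\<^sup>+ j. (e j * u x) * indicator {c x} j \<partial>count_space UNIV)"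
      by (simp add: mult.assoc)
    also have "\<dots> = e (c x) * u x"
      by (subst nn_integral_indicator_singleton) auto
    finally show "e (c x) * u x = (\<integral>\<^sup>+ j. e j * (u x * indicator {c x} j) \<partial>count_space UNIV)" ..
  qed
  also have "\<dots> = (\<integral>\<^sup>+ j. (\<integral>\<^sup>+ x. e j * (u x * indicator {c x} j) \<partial>N) \<partial>count_space UNIV)"
    by (rule nn_integral_count_space_nn_integral) (auto simp: indicator_def)
  also have "\<dots> = (\<integral>\<^sup>+ j. e j * (\<integral>\<^sup>+ x. u x * indicator {c x} j \<partial>N) \<partial>count_space UNIV)"
    by (intro nn_integral_cong nn_integral_cmult) (auto simp: indicator_def)
  finally show ?thesis .
qed

text \<open>Once every cell is exhausted on one side, the price of the leftovers no longer depends
  on the plan, only on the cell masses of the two measures.\<close>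

lemma plan_residual_cost:
  assumes z: "\<And>j. cell_int \<mu> c f j = 0 \<or> cell_int \<nu> c g j = 0"
  shows "(\<integral>\<^sup>+ x. e (c x) * f x \<partial>\<mu>) + (\<integral>\<^sup>+ y. e (c y) * g y \<partial>\<nu>)
       = (\<integral>\<^sup>+ j. e j * mass_gap \<mu> \<nu> c j \<partial>count_space UNIV)"
  by (subst (1 2) nn_integral_cells)
    (simp_all add: plan_residual[OF z] mass_gap_def distrib_left flip: nn_integral_add)

text \<open>Inside each cell the leftovers are matched by a scaled product: \<open>f x * g y\<close>
  divided by the larger of the two remaining masses. The smaller side is used up, and the larger one
  keeps a fixed fraction. Moved mass pays \<open>e\<close> at both of its ends, so the payment is at
  most the integral of \<open>e\<close> against the leftovers.\<close>

lemma partial_plan_step: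
  fixes cost :: "'a \<Rightarrow> 'a \<Rightarrow> ennreal"
  assumes [measurable]: "(\<lambda>z. cost (fst z) (snd z)) \<in> borel_measurable (\<mu> \<Otimes>\<^sub>M \<nu>)"
    and [measurable]: "e \<in> borel_measurable \<mu>" "e \<in> borel_measurable \<nu>"
    and cost: "\<And>x y. x \<in> space \<mu> \<Longrightarrow> y \<in> space \<nu> \<Longrightarrow> c x = c y \<Longrightarrow> cost x y \<le> e x + e y"
  obtains f' g' h' where "partial_plan \<mu> \<nu> c f' g' h'"
    "\<And>j. cell_int \<mu> c f' j = 0 \<or> cell_int \<nu> c g' j = 0"
    "plan_cost \<mu> \<nu> cost h'
      \<le> plan_cost \<mu> \<nu> cost h + ((\<integral>\<^sup>+ x. e x * f x \<partial>\<mu>) + (\<integral>\<^sup>+ y. e y * g y \<partial>\<nu>))"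
proof -
  define F where "F j = cell_int \<mu> c f j" for j
  define G where "G j = cell_int \<nu> c g j" for j
  have fle: "f x \<le> 1" if "x \<in> space \<mu>" for x using plan_f[OF that] by (metis le_iff_add)
  have gle: "g x \<le> 1" if "x \<in> space \<nu>" for x using plan_g[OF that] by (metis le_iff_add)
  have F1: "F j \<le> 1" for j
  proof -
    have "F j \<le> (\<integral>\<^sup>+ x. 1 \<partial>\<mu>)" unfolding F_def
      using fle by (intro nn_integral_mono) (auto simp: indicator_def)
    then show ?thesis by (simp add: A.emeasure_space_1)
  qed
  have G1: "G j \<le> 1" for j
  proof -
    have "G j \<le> (\<integral>\<^sup>+ x. 1 \<partial>\<nu>)" unfolding G_def
      using gle by (intro nn_integral_mono) (auto simp: indicator_def)
    then show ?thesis by (simp add: B.emeasure_space_1)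
  qed
  \<comment> \<open>Zero masses make \<open>f\<close> and \<open>g\<close> vanish in the cell only
    almost everywhere, and the inverse of 0 is infinite; the default 0 keeps \<open>k\<close> zero
    there.\<close>
  define \<rho> where "\<rho> j = (if max (F j) (G j) = 0 then 0 else inverse (max (F j) (G j)))" for j
  have max_fin: "max (F j) (G j) \<noteq> \<top>" for j
    using F1[of j] G1[of j] by (auto simp: max_def top_unique split: if_splits)
  have max_rho: "max (F j) (G j) * \<rho> j \<le> 1" for j
    using max_fin[of j] by (auto simp: \<rho>_def ennreal_mult_divide_eq divide_ennreal_def[symmetric] intro!: ennreal_divide_self[THEN eq_refl] simp: top.not_eq_extremum)
  have Fr: "F j * \<rho> j \<le> 1" and Gr: "G j * \<rho> j \<le> 1" for j
    using max_rho[of j] mult_right_mono[of "F j" "max (F j) (G j)" "\<rho> j"]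
      mult_right_mono[of "G j" "max (F j) (G j)" "\<rho> j"] by (auto intro: order_trans)
  define k where "k x y = f x * g y * (\<rho> (c x) * indicator {c x} (c y))" for x y
  define f' where "f' x = f x * (1 - G (c x) * \<rho> (c x))" for x
  define g' where "g' y = g y * (1 - F (c y) * \<rho> (c y))" for y
  define h' where "h' x y = h x y + k x y" for x y
  have ind: "(\<lambda>z. indicator {c (fst z)} (c (snd z)) :: ennreal) \<in> borel_measurable (\<mu> \<Otimes>\<^sub>M \<nu>)"
  proof -
    have "(\<lambda>z. (c (fst z), c (snd z))) \<in> \<mu> \<Otimes>\<^sub>M \<nu> \<rightarrow>\<^sub>M count_space UNIV \<Otimes>\<^sub>M count_space UNIV"
      by measurable
    then have "(\<lambda>z. (c (fst z), c (snd z))) \<in> \<mu> \<Otimes>\<^sub>M \<nu> \<rightarrow>\<^sub>M count_space UNIV"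
      by (simp add: pair_measure_countable)
    from measurable_compose[OF this, of "\<lambda>(a, b). indicator {a} b" borel]
    show ?thesis by (simp add: case_prod_unfold)
  qed
  note ind [measurable]
  have \<rho>c [measurable]: "(\<lambda>z. \<rho> (c (fst z))) \<in> borel_measurable (\<mu> \<Otimes>\<^sub>M \<nu>)"
    by (rule measurable_compose[of "\<lambda>z. c (fst z)" _ "count_space UNIV"]) auto
  have k_meas [measurable]: "(\<lambda>z. k (fst z) (snd z)) \<in> borel_measurable (\<mu> \<Otimes>\<^sub>M \<nu>)"
    unfolding k_def by measurable
  have k_section: "x \<in> space \<mu> \<Longrightarrow> (\<lambda>y. k x y) \<in> borel_measurable \<nu>"
    "y \<in> space \<nu> \<Longrightarrow> (\<lambda>x. k x y) \<in> borel_measurable \<mu>" for x y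
    using measurable_compose_Pair1[OF _ k_meas] measurable_Pair1[OF k_meas] by auto
  have comp: "(\<lambda>x. u (c x)) \<in> borel_measurable \<mu>" "(\<lambda>x. u (c x)) \<in> borel_measurable \<nu>" for u :: "'c \<Rightarrow> ennreal"
    by (rule measurable_compose[OF c'(1)] measurable_compose[OF c'(2)], simp)+
  have k1: "(\<integral>\<^sup>+ y. k x y \<partial>\<nu>) = f x * (G (c x) * \<rho> (c x))" for x
  proof -
    have "(\<integral>\<^sup>+ y. k x y \<partial>\<nu>) = (\<integral>\<^sup>+ y. (f x * \<rho> (c x)) * (g y * indicator {c y} (c x)) \<partial>\<nu>)"
      unfolding k_def by (intro nn_integral_cong) (auto simp: indicator_def mult_ac)
    also have "\<dots> = (f x * \<rho> (c x)) * G (c x)"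
      unfolding G_def by (rule nn_integral_cmult) (auto simp: indicator_def)
    finally show ?thesis by (simp add: mult_ac)
  qed
  have k2: "(\<integral>\<^sup>+ x. k x y \<partial>\<mu>) = g y * (F (c y) * \<rho> (c y))" for y
  proof -
    have "(\<integral>\<^sup>+ x. k x y \<partial>\<mu>) = (\<integral>\<^sup>+ x. (g y * \<rho> (c y)) * (f x * indicator {c x} (c y)) \<partial>\<mu>)"
      unfolding k_def by (intro nn_integral_cong) (auto simp: indicator_def mult_ac)
    also have "\<dots> = (g y * \<rho> (c y)) * F (c y)"
      unfolding F_def by (rule nn_integral_cmult) (auto simp: indicator_def)
    finally show ?thesis by (simp add: mult_ac)
  qed
  show thesis
  proof (rule that[of f' g' h'])
    show "partial_plan \<mu> \<nu> c f' g' h'"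
      unfolding partial_plan_def
    proof (intro conjI ballI allI impI)
      show "f' \<in> borel_measurable \<mu>" "g' \<in> borel_measurable \<nu>"
        unfolding f'_def g'_def using comp by auto
      show "(\<lambda>(x, y). h' x y) \<in> borel_measurable (\<mu> \<Otimes>\<^sub>M \<nu>)"
        unfolding h'_def case_prod_unfold by measurable
      fix x assume x: "x \<in> space \<mu>"
      have "f' x + (\<integral>\<^sup>+ y. h' x y \<partial>\<nu>) = f' x + ((\<integral>\<^sup>+ y. h x y \<partial>\<nu>) + f x * (G (c x) * \<rho> (c x)))"
        unfolding h'_def k1[symmetric] using x
          plan_section_meas(1)[OF x] k_section(1)[OF x]
        by (subst nn_integral_add) auto
      also have "\<dots> = (f' x + f x * (G (c x) * \<rho> (c x))) + (\<integral>\<^sup>+ y. h x y \<partial>\<nu>)"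
        by (simp only: ac_simps)
      also have "\<dots> = 1"
        unfolding f'_def ennreal_mult_compl_add[OF Gr] by (rule plan_f[OF x])
      finally show "f' x + (\<integral>\<^sup>+ y. h' x y \<partial>\<nu>) = 1" .
    next
      fix y assume y: "y \<in> space \<nu>"
      have "g' y + (\<integral>\<^sup>+ x. h' x y \<partial>\<mu>) = g' y + ((\<integral>\<^sup>+ x. h x y \<partial>\<mu>) + g y * (F (c y) * \<rho> (c y)))"
        unfolding h'_def k2[symmetric] using y
          plan_section_meas(2)[OF y] k_section(2)[OF y]
        by (subst nn_integral_add) auto
      also have "\<dots> = (g' y + g y * (F (c y) * \<rho> (c y))) + (\<integral>\<^sup>+ x. h x y \<partial>\<mu>)"
        by (simp only: ac_simps)
      also have "\<dots> = 1"
        unfolding g'_def ennreal_mult_compl_add[OF Fr] by (rule plan_g[OF y])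
      finally show "g' y + (\<integral>\<^sup>+ x. h' x y \<partial>\<mu>) = 1" .
    next
      fix x y assume "h' x y \<noteq> 0"
      then show "c x = c y"
        using plan_h[of x y] by (auto simp: h'_def k_def indicator_def split: if_splits)
    qed
  next
    fix j
    have F': "cell_int \<mu> c f' j = (1 - G j * \<rho> j) * F j"
    proof -
      have "cell_int \<mu> c f' j = (\<integral>\<^sup>+ x. (1 - G j * \<rho> j) * (f x * indicator {c x} j) \<partial>\<mu>)"
        unfolding f'_def by (intro nn_integral_cong) (auto simp: indicator_def mult_ac)
      also have "\<dots> = (1 - G j * \<rho> j) * F j"
        unfolding F_def by (rule nn_integral_cmult) (auto simp: indicator_def)
      finally show ?thesis .
    qed
    have G': "(\<integral>\<^sup>+ x. g' x * indicator {c x} j \<partial>\<nu>) = (1 - F j * \<rho> j) * G j"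
    proof -
      have "(\<integral>\<^sup>+ x. g' x * indicator {c x} j \<partial>\<nu>) = (\<integral>\<^sup>+ x. (1 - F j * \<rho> j) * (g x * indicator {c x} j) \<partial>\<nu>)"
        unfolding g'_def by (intro nn_integral_cong) (auto simp: indicator_def mult_ac)
      also have "\<dots> = (1 - F j * \<rho> j) * G j"
        unfolding G_def by (rule nn_integral_cmult) (auto simp: indicator_def)
      finally show ?thesis .
    qed
    have one: "m * inverse m = 1" if "m \<noteq> 0" "m \<noteq> \<top>" for m :: ennreal
      using that by (simp add: divide_ennreal_def[symmetric] top.not_eq_extremum)
    show "cell_int \<mu> c f' j = 0 \<or> cell_int \<nu> c g' j = 0"
      unfolding F' G' using one[of "max (F j) (G j)"] max_fin[of j]
      by (auto simp: \<rho>_def max_def split: if_splits)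
  next
    have ck: "plan_cost \<mu> \<nu> cost k \<le> (\<integral>\<^sup>+ x. e x * f x \<partial>\<mu>) + (\<integral>\<^sup>+ y. e y * g y \<partial>\<nu>)"
    proof -
      have "plan_cost \<mu> \<nu> cost k \<le> (\<integral>\<^sup>+ x. \<integral>\<^sup>+ y. e x * k x y + e y * k x y \<partial>\<nu> \<partial>\<mu>)"
      proof (intro nn_integral_mono)
        fix x y assume "x \<in> space \<mu>" "y \<in> space \<nu>"
        then show "cost x y * k x y \<le> e x * k x y + e y * k x y"
          using cost[of x y] by (cases "c x = c y") (auto simp: k_def simp flip: distrib_right intro!: mult_right_mono)
      qed
      also have "\<dots> = (\<integral>\<^sup>+ x. (\<integral>\<^sup>+ y. e x * k x y \<partial>\<nu>) + (\<integral>\<^sup>+ y. e y * k x y \<partial>\<nu>) \<partial>\<mu>)"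
        using k_section by (intro nn_integral_cong nn_integral_add) auto
      also have "\<dots> = (\<integral>\<^sup>+ x. (\<integral>\<^sup>+ y. e x * k x y \<partial>\<nu>) \<partial>\<mu>) + (\<integral>\<^sup>+ x. (\<integral>\<^sup>+ y. e y * k x y \<partial>\<nu>) \<partial>\<mu>)"
        by (rule nn_integral_add) auto
      also have "(\<integral>\<^sup>+ x. (\<integral>\<^sup>+ y. e x * k x y \<partial>\<nu>) \<partial>\<mu>) \<le> (\<integral>\<^sup>+ x. e x * f x \<partial>\<mu>)"
      proof (intro nn_integral_mono)
        fix x assume "x \<in> space \<mu>"
        then have "(\<integral>\<^sup>+ y. e x * k x y \<partial>\<nu>) = e x * (f x * (G (c x) * \<rho> (c x)))"
          using k_section by (subst nn_integral_cmult) (auto simp: k1)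
        also have "\<dots> \<le> e x * (f x * 1)" by (intro mult_left_mono Gr) auto
        finally show "(\<integral>\<^sup>+ y. e x * k x y \<partial>\<nu>) \<le> e x * f x" by simp
      qed
      also have "(\<integral>\<^sup>+ x. (\<integral>\<^sup>+ y. e y * k x y \<partial>\<nu>) \<partial>\<mu>) = (\<integral>\<^sup>+ y. (\<integral>\<^sup>+ x. e y * k x y \<partial>\<mu>) \<partial>\<nu>)"
        by (rule Fubini'[symmetric]) (simp add: case_prod_unfold)
      also have "\<dots> \<le> (\<integral>\<^sup>+ y. e y * g y \<partial>\<nu>)"
      proof (intro nn_integral_mono)
        fix y assume "y \<in> space \<nu>"
        then have "(\<integral>\<^sup>+ x. e y * k x y \<partial>\<mu>) = e y * (g y * (F (c y) * \<rho> (c y)))"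
          using k_section by (subst nn_integral_cmult) (auto simp: k2)
        also have "\<dots> \<le> e y * (g y * 1)" by (intro mult_left_mono Fr) auto
        finally show "(\<integral>\<^sup>+ x. e y * k x y \<partial>\<mu>) \<le> e y * g y" by simp
      qed
      finally show ?thesis by (simp add: add_mono)
    qed
    have cost_section: "(\<lambda>y. cost x y) \<in> borel_measurable \<nu>" if "x \<in> space \<mu>" for x
      using measurable_compose_Pair1[OF that assms(1)] by simp
    have "plan_cost \<mu> \<nu> cost h'
        = (\<integral>\<^sup>+ x. (\<integral>\<^sup>+ y. cost x y * h x y \<partial>\<nu>) + (\<integral>\<^sup>+ y. cost x y * k x y \<partial>\<nu>) \<partial>\<mu>)"
      unfolding h'_def distrib_left using k_section plan_section_meas cost_section
      by (intro nn_integral_cong nn_integral_add) auto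
    also have "\<dots> = plan_cost \<mu> \<nu> cost h + plan_cost \<mu> \<nu> cost k"
      by (rule nn_integral_add) auto
    also have "\<dots> \<le> plan_cost \<mu> \<nu> cost h + ((\<integral>\<^sup>+ x. e x * f x \<partial>\<mu>) + (\<integral>\<^sup>+ y. e y * g y \<partial>\<nu>))"
      by (intro add_mono ck order_refl)
    finally show "plan_cost \<mu> \<nu> cost h'
      \<le> plan_cost \<mu> \<nu> cost h + ((\<integral>\<^sup>+ x. e x * f x \<partial>\<mu>) + (\<integral>\<^sup>+ y. e y * g y \<partial>\<nu>))" .
  qed
qed

end

end

text \<open>The marginal equations are asked almost everywhere because vanishing leftover mass makes
  the leftover densities zero only outside a null set.\<close>

lemma (in prob_pair) coupling_of_full_plan:
  assumes h: "(\<lambda>(x, y). h x y) \<in> borel_measurable (\<mu> \<Otimes>\<^sub>M \<nu>)"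
    and 1: "AE x in \<mu>. (\<integral>\<^sup>+ y. h x y \<partial>\<nu>) = 1" and 2: "AE y in \<nu>. (\<integral>\<^sup>+ x. h x y \<partial>\<mu>) = 1"
  shows "prob_space (density (\<mu> \<Otimes>\<^sub>M \<nu>) (\<lambda>(x, y). h x y))"
    and "distr (density (\<mu> \<Otimes>\<^sub>M \<nu>) (\<lambda>(x, y). h x y)) \<mu> fst = \<mu>"
    and "distr (density (\<mu> \<Otimes>\<^sub>M \<nu>) (\<lambda>(x, y). h x y)) \<nu> snd = \<nu>"
proof -
  define \<pi> where "\<pi> = density (\<mu> \<Otimes>\<^sub>M \<nu>) (\<lambda>(x, y). h x y)"
  have sets_pi [measurable_cong]: "sets \<pi> = sets (\<mu> \<Otimes>\<^sub>M \<nu>)" by (simp add: \<pi>_def)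
  have space_pi: "space \<pi> = space (\<mu> \<Otimes>\<^sub>M \<nu>)" by (simp add: \<pi>_def)
  have h': "(\<lambda>z. h (fst z) (snd z)) \<in> borel_measurable (\<mu> \<Otimes>\<^sub>M \<nu>)"
    using h by (simp only: case_prod_unfold)
  have nn_pi: "(\<integral>\<^sup>+ z. u z \<partial>\<pi>) = (\<integral>\<^sup>+ z. h (fst z) (snd z) * u z \<partial>(\<mu> \<Otimes>\<^sub>M \<nu>))"
    if "u \<in> borel_measurable (\<mu> \<Otimes>\<^sub>M \<nu>)" for u
    unfolding \<pi>_def using nn_integral_density[OF h that] by (simp only: case_prod_unfold)
  have fst_pi: "fst \<in> \<pi> \<rightarrow>\<^sub>M \<mu>" and snd_pi: "snd \<in> \<pi> \<rightarrow>\<^sub>M \<nu>"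
    by (simp_all add: measurable_cong_sets[OF sets_pi refl])
  have h1: "(\<lambda>y. h x y) \<in> borel_measurable \<nu>" if "x \<in> space \<mu>" for x
    using measurable_compose_Pair1[OF that h] by (simp only: case_prod_conv)
  have h2: "(\<lambda>x. h x y) \<in> borel_measurable \<mu>" if "y \<in> space \<nu>" for y
    using measurable_Pair1[OF h that] by (simp only: case_prod_conv)
  have d1: "distr \<pi> \<mu> fst = \<mu>"
  proof (rule measure_eqI)
    fix A assume "A \<in> sets (distr \<pi> \<mu> fst)"
    then have A: "A \<in> sets \<mu>" by (simp only: sets_distr)
    have ind: "(indicator A :: 'a \<Rightarrow> ennreal) \<in> borel_measurable \<mu>"
      by (rule borel_measurable_indicator[OF A])
    note ind' = measurable_compose[OF measurable_fst ind]
    have "emeasure (distr \<pi> \<mu> fst) A = (\<integral>\<^sup>+ z. indicator A z \<partial>distr \<pi> \<mu> fst)"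
      by (rule nn_integral_indicator[symmetric]) (simp only: sets_distr A)
    also have "\<dots> = (\<integral>\<^sup>+ z. indicator A (fst z) \<partial>\<pi>)"
      by (rule nn_integral_distr[OF fst_pi]) (simp only: measurable_distr_eq1 ind)
    also have "\<dots> = (\<integral>\<^sup>+ z. h (fst z) (snd z) * indicator A (fst z) \<partial>(\<mu> \<Otimes>\<^sub>M \<nu>))"
      by (rule nn_pi[OF ind'])
    also have "\<dots> = (\<integral>\<^sup>+ x. \<integral>\<^sup>+ y. h x y * indicator A x \<partial>\<nu> \<partial>\<mu>)"
      using B.nn_integral_fst[OF borel_measurable_times_ennreal[OF h' ind']]
      by (simp only: fst_conv snd_conv)
    also have "\<dots> = (\<integral>\<^sup>+ x. (\<integral>\<^sup>+ y. h x y \<partial>\<nu>) * indicator A x \<partial>\<mu>)"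
      using h1 by (intro nn_integral_cong nn_integral_multc)
    also have "\<dots> = (\<integral>\<^sup>+ x. indicator A x \<partial>\<mu>)"
      by (rule nn_integral_cong_AE) (use 1 in eventually_elim, simp)
    finally show "emeasure (distr \<pi> \<mu> fst) A = emeasure \<mu> A"
      by (simp only: nn_integral_indicator[OF A])
  qed simp
  moreover have "distr \<pi> \<nu> snd = \<nu>"
  proof (rule measure_eqI)
    fix A assume "A \<in> sets (distr \<pi> \<nu> snd)"
    then have A: "A \<in> sets \<nu>" by (simp only: sets_distr)
    have ind: "(indicator A :: 'a \<Rightarrow> ennreal) \<in> borel_measurable \<nu>"
      by (rule borel_measurable_indicator[OF A])
    note ind' = measurable_compose[OF measurable_snd ind]
    have "emeasure (distr \<pi> \<nu> snd) A = (\<integral>\<^sup>+ z. indicator A z \<partial>distr \<pi> \<nu> snd)"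
      by (rule nn_integral_indicator[symmetric]) (simp only: sets_distr A)
    also have "\<dots> = (\<integral>\<^sup>+ z. indicator A (snd z) \<partial>\<pi>)"
      by (rule nn_integral_distr[OF snd_pi]) (simp only: measurable_distr_eq1 ind)
    also have "\<dots> = (\<integral>\<^sup>+ z. h (fst z) (snd z) * indicator A (snd z) \<partial>(\<mu> \<Otimes>\<^sub>M \<nu>))"
      by (rule nn_pi[OF ind'])
    also have "\<dots> = (\<integral>\<^sup>+ y. \<integral>\<^sup>+ x. h x y * indicator A y \<partial>\<mu> \<partial>\<nu>)"
      using nn_integral_snd[OF borel_measurable_times_ennreal[OF h' ind']]
      by (simp only: fst_conv snd_conv)
    also have "\<dots> = (\<integral>\<^sup>+ y. (\<integral>\<^sup>+ x. h x y \<partial>\<mu>) * indicator A y \<partial>\<nu>)"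
      using h2 by (intro nn_integral_cong nn_integral_multc)
    also have "\<dots> = (\<integral>\<^sup>+ y. indicator A y \<partial>\<nu>)"
      by (rule nn_integral_cong_AE) (use 2 in eventually_elim, simp)
    finally show "emeasure (distr \<pi> \<nu> snd) A = emeasure \<nu> A"
      by (simp only: nn_integral_indicator[OF A])
  qed simp
  moreover have "emeasure \<pi> (space \<pi>) = emeasure (distr \<pi> \<mu> fst) (space \<mu>)"
  proof -
    have "fst -` space \<mu> \<inter> space \<pi> = space \<pi>" by (auto simp: space_pi space_pair_measure)
    then show ?thesis using emeasure_distr[OF fst_pi sets.top] by simp
  qed
  then have "prob_space \<pi>"
    unfolding d1 by (intro prob_spaceI) (simp add: A.emeasure_space_1)
  ultimately show "prob_space (density (\<mu> \<Otimes>\<^sub>M \<nu>) (\<lambda>(x, y). h x y))"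
    "distr (density (\<mu> \<Otimes>\<^sub>M \<nu>) (\<lambda>(x, y). h x y)) \<mu> fst = \<mu>"
    "distr (density (\<mu> \<Otimes>\<^sub>M \<nu>) (\<lambda>(x, y). h x y)) \<nu> snd = \<nu>"
    by (simp_all add: \<pi>_def)
qed

text \<open>The plan is built from the finest partition \<open>c L\<close> to the trivial one \<open>c 0\<close>. What is left
  unmatched by \<open>c (Suc l)\<close> has exactly the mass \<open>mass_gap\<close> in each of its cells, and this is the
  mass that is moved inside the cells of \<open>c l\<close>.\<close>

lemma (in prob_pair) multiscale_coupling:
  fixes c :: "nat \<Rightarrow> 'a \<Rightarrow> 'c::countable" and e :: "nat \<Rightarrow> 'a \<Rightarrow> ennreal"
    and \<epsilon> :: "nat \<Rightarrow> 'c \<Rightarrow> ennreal" and cost :: "'a \<Rightarrow> 'a \<Rightarrow> ennreal"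
  assumes c [measurable]: "\<And>l. c l \<in> \<mu> \<rightarrow>\<^sub>M count_space UNIV"
    and c0: "\<And>x y. c 0 x = c 0 y"
    and nested: "\<And>l x y. c (Suc l) x = c (Suc l) y \<Longrightarrow> c l x = c l y"
    and cost_meas [measurable]: "(\<lambda>z. cost (fst z) (snd z)) \<in> borel_measurable (\<mu> \<Otimes>\<^sub>M \<nu>)"
    and e [measurable]: "\<And>l. e l \<in> borel_measurable \<mu>"
    and cost: "\<And>l x y. l \<le> L \<Longrightarrow> x \<in> space \<mu> \<Longrightarrow> y \<in> space \<nu> \<Longrightarrow> c l x = c l y \<Longrightarrow> cost x y \<le> e l x + e l y"
    and e_eq: "\<And>l x. l < L \<Longrightarrow> e l x = \<epsilon> l (c (Suc l) x)"
  obtains \<pi> where "prob_space \<pi>" "sets \<pi> = sets (\<mu> \<Otimes>\<^sub>M \<nu>)" "distr \<pi> \<mu> fst = \<mu>" "distr \<pi> \<nu> snd = \<nu>"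
    "(\<integral>\<^sup>+ z. cost (fst z) (snd z) \<partial>\<pi>)
      \<le> (\<Sum>l<L. \<integral>\<^sup>+ j. \<epsilon> l j * mass_gap \<mu> \<nu> (c (Suc l)) j \<partial>count_space UNIV)
         + ((\<integral>\<^sup>+ x. e L x \<partial>\<mu>) + (\<integral>\<^sup>+ y. e L y \<partial>\<nu>))"
proof -
  have e' [measurable]: "e l \<in> borel_measurable \<nu>" for l
    using e[of l] unfolding measurable_cong_sets[OF sets_eq refl] .
  define R where "R = (\<integral>\<^sup>+ x. e L x \<partial>\<mu>) + (\<integral>\<^sup>+ y. e L y \<partial>\<nu>)"
  define S where "S l = (\<integral>\<^sup>+ j. \<epsilon> l j * mass_gap \<mu> \<nu> (c (Suc l)) j \<partial>count_space UNIV)" for l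
  define van where "van l f g \<longleftrightarrow> (\<forall>j. cell_int \<mu> (c l) f j = 0
      \<or> cell_int \<nu> (c l) g j = 0)" for l and f g :: "'a \<Rightarrow> ennreal"
  have "\<exists>f g h. partial_plan \<mu> \<nu> (c l) f g h \<and> van l f g \<and>
      plan_cost \<mu> \<nu> cost h \<le> (\<Sum>i\<in>{l..<L}. S i) + R" if "l \<le> L" for l
    using that
  proof (induction l rule: inc_induct)
    case base
    \<comment> \<open>Nothing is coupled yet, so matching in the finest cells is charged to the
      whole of both measures; this is the term \<open>R\<close>.\<close>
    have pl: "partial_plan \<mu> \<nu> (c L) (\<lambda>_. 1) (\<lambda>_. 1) (\<lambda>_ _. 0)"
      by (simp add: partial_plan_def)
    obtain f g h where "partial_plan \<mu> \<nu> (c L) f g h"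
      "\<And>j. cell_int \<mu> (c L) f j = 0 \<or> cell_int \<nu> (c L) g j = 0"
      "plan_cost \<mu> \<nu> cost h
        \<le> (\<integral>\<^sup>+ x. \<integral>\<^sup>+ y. cost x y * 0 \<partial>\<nu> \<partial>\<mu>) + ((\<integral>\<^sup>+ x. e L x * 1 \<partial>\<mu>) + (\<integral>\<^sup>+ y. e L y * 1 \<partial>\<nu>))"
      by (rule partial_plan_step[OF c pl cost_meas e e' cost[OF order_refl]]) (assumption+, rule that, assumption+)
    then show ?case
      by (intro exI[of _ f] exI[of _ g] exI[of _ h]) (simp add: R_def van_def)
  next
    case (step l)
    then obtain f g h where p: "partial_plan \<mu> \<nu> (c (Suc l)) f g h" and v: "van (Suc l) f g"
      and b: "plan_cost \<mu> \<nu> cost h \<le> (\<Sum>i\<in>{Suc l..<L}. S i) + R"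
      by blast
    \<comment> \<open>The price \<open>e l\<close> is constant on the cells of level
      \<open>Suc l\<close>, and these are the cells in which the leftover mass is known.\<close>
    have res: "(\<integral>\<^sup>+ x. e l x * f x \<partial>\<mu>) + (\<integral>\<^sup>+ y. e l y * g y \<partial>\<nu>) = S l"
      unfolding S_def e_eq[OF \<open>l < L\<close>] using v
      by (intro plan_residual_cost[OF c p]) (auto simp: van_def)
    \<comment> \<open>Cells of level \<open>l\<close> are unions of cells of level
      \<open>Suc l\<close>, so what was coupled in the finer partition respects the coarser
      one.\<close>
    have pl: "partial_plan \<mu> \<nu> (c l) f g h"
      using p nested unfolding partial_plan_def by blast
    obtain f' g' h' where p': "partial_plan \<mu> \<nu> (c l) f' g' h'" and
      v': "\<And>j. cell_int \<mu> (c l) f' j = 0 \<or> cell_int \<nu> (c l) g' j = 0" and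
      b': "plan_cost \<mu> \<nu> cost h'
        \<le> plan_cost \<mu> \<nu> cost h + ((\<integral>\<^sup>+ x. e l x * f x \<partial>\<mu>) + (\<integral>\<^sup>+ y. e l y * g y \<partial>\<nu>))"
      by (rule partial_plan_step[OF c pl cost_meas e e' cost[OF less_imp_le[OF \<open>l < L\<close>]]]) (assumption+, rule that, assumption+)
    have "plan_cost \<mu> \<nu> cost h' \<le> ((\<Sum>i\<in>{Suc l..<L}. S i) + R) + S l"
      using b' b unfolding res by (meson add_right_mono order_trans)
    also have "\<dots> = (\<Sum>i\<in>{l..<L}. S i) + R"
      using \<open>l < L\<close> by (simp add: sum.atLeast_Suc_lessThan ac_simps)
    finally show ?case using p' v' unfolding van_def by blast
  qed
  from this[OF le0, unfolded atLeast0LessThan] obtain f g h where p: "partial_plan \<mu> \<nu> (c 0) f g h" and v: "van 0 f g"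
      and b: "plan_cost \<mu> \<nu> cost h \<le> (\<Sum>i<L. S i) + R"
    by (elim exE conjE) (rule that)
  have h: "(\<lambda>(x, y). h x y) \<in> borel_measurable (\<mu> \<Otimes>\<^sub>M \<nu>)"
    and f_meas: "f \<in> borel_measurable \<mu>" and g_meas: "g \<in> borel_measurable \<nu>"
    using p unfolding partial_plan_def by blast+
  have h': "(\<lambda>z. h (fst z) (snd z)) \<in> borel_measurable (\<mu> \<Otimes>\<^sub>M \<nu>)"
    using h by (simp only: case_prod_unfold)
  have v': "cell_int \<mu> (c 0) f j = 0 \<or> cell_int \<nu> (c 0) g j = 0" for j
    using v unfolding van_def by blast
  \<comment> \<open>As \<open>c 0\<close> is constant, any point names its single cell. Both
    measures have mass 1 there, so nothing is left over.\<close>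
  define j0 where "j0 = c 0 undefined"
  have j0: "c 0 x = j0" for x unfolding j0_def by (rule c0)
  have "(\<integral>\<^sup>+ x. f x \<partial>\<mu>) = 0" "(\<integral>\<^sup>+ y. g y \<partial>\<nu>) = 0"
    using plan_residual[OF c p v', of j0]
    by (simp_all add: j0 A.emeasure_space_1 B.emeasure_space_1)
  then have fg: "AE x in \<mu>. f x = 0" "AE y in \<nu>. g y = 0"
    using f_meas g_meas by (simp_all only: nn_integral_0_iff_AE)
  have 1: "AE x in \<mu>. (\<integral>\<^sup>+ y. h x y \<partial>\<nu>) = 1"
    using fg(1) AE_space
  proof eventually_elim
    case (elim x) then show ?case using plan_f[OF c p, of x] by simp
  qed
  have 2: "AE y in \<nu>. (\<integral>\<^sup>+ x. h x y \<partial>\<mu>) = 1"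
    using fg(2) AE_space
  proof eventually_elim
    case (elim y) then show ?case using plan_g[OF c p, of y] by simp
  qed
  have "(\<integral>\<^sup>+ z. cost (fst z) (snd z) \<partial>density (\<mu> \<Otimes>\<^sub>M \<nu>) (\<lambda>(x, y). h x y))
      = (\<integral>\<^sup>+ z. h (fst z) (snd z) * cost (fst z) (snd z) \<partial>(\<mu> \<Otimes>\<^sub>M \<nu>))"
    using nn_integral_density[OF h cost_meas] by (simp only: case_prod_unfold)
  also have "\<dots> = (\<integral>\<^sup>+ x. \<integral>\<^sup>+ y. h x y * cost x y \<partial>\<nu> \<partial>\<mu>)"
    using B.nn_integral_fst[OF borel_measurable_times_ennreal[OF h' cost_meas]]
    by (simp only: fst_conv snd_conv)
  also have "\<dots> = plan_cost \<mu> \<nu> cost h"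
    by (simp only: mult.commute)
  finally have "(\<integral>\<^sup>+ z. cost (fst z) (snd z) \<partial>density (\<mu> \<Otimes>\<^sub>M \<nu>) (\<lambda>(x, y). h x y)) \<le> (\<Sum>i<L. S i) + R"
    using b by simp
  then show thesis
    using that[OF coupling_of_full_plan(1)[OF h 1 2] _ coupling_of_full_plan(2,3)[OF h 1 2]]
    by (simp add: S_def R_def)
qed

section \<open>Shells and cells\<close>

text \<open>The origin lies in shell \<open>0\<close>, since \<open>log 2 0 = 0\<close>.\<close>

definition shell :: "real \<Rightarrow> real \<Rightarrow> nat" where
  "shell R t = nat \<lceil>log 2 (t / R)\<rceil>"

lemma le_shell:
  assumes "0 < R" "0 \<le> t"
  shows "t \<le> R * 2 ^ shell R t"
proof (cases "t = 0")
  case False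
  then have t: "0 < t / R" using assms by simp
  have "log 2 (t / R) \<le> real (shell R t)" unfolding shell_def by linarith
  then have "2 powr log 2 (t / R) \<le> 2 powr real (shell R t)" by simp
  then have "t / R \<le> 2 ^ shell R t" using t by (simp add: powr_realpow)
  then show ?thesis using assms by (simp add: field_simps)
qed (use assms in simp)

lemma shell_Suc_less:
  assumes "0 < R" "0 \<le> t" "shell R t = Suc m"
  shows "R * 2 ^ m < t"
proof -
  have "t \<noteq> 0" using assms(3) by (auto simp: shell_def log_def)
  then have t: "0 < t / R" using assms by simp
  have "real m < log 2 (t / R)" using assms(3) unfolding shell_def by linarith
  then have "2 powr real m < 2 powr log 2 (t / R)" by simp
  then have "2 ^ m < t / R" using t by (simp add: powr_realpow)
  then show ?thesis using assms by (simp add: field_simps)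
qed

text \<open>A list of integers is a countable label whatever \<open>k\<close> is, with the dimension
  as a term and not a type.\<close>

definition grid :: "nat \<Rightarrow> real \<Rightarrow> nat \<Rightarrow> nat \<Rightarrow> (nat \<Rightarrow> real) \<Rightarrow> int list" where
  "grid k R m l x = map (\<lambda>i. \<lfloor>x i * (sqrt (real k) * 2 ^ l / (R * 2 ^ m))\<rfloor>) [0..<k]"

text \<open>Within a shell of radius \<open>R * 2 ^ m\<close> the cells of level \<open>Suc l\<close> are cubes of diameter
  \<open>R * 2 ^ m / 2 ^ l\<close>; level \<open>0\<close> is the trivial partition.\<close>

definition cell :: "nat \<Rightarrow> real \<Rightarrow> nat \<Rightarrow> (nat \<Rightarrow> real) \<Rightarrow> nat \<times> int list" where
  "cell k R l x = (case l of 0 \<Rightarrow> (0, [])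
     | Suc l' \<Rightarrow> (let m = shell R (norm_Rn k x) in (m, grid k R m l' x)))"

lemma cell_0 [simp]: "cell k R 0 x = (0, [])"
  by (simp add: cell_def)

lemma cell_Suc: "cell k R (Suc l) x = (shell R (norm_Rn k x), grid k R (shell R (norm_Rn k x)) l x)"
  by (simp add: cell_def Let_def)

lemma norm_Rn_nonneg [simp]: "0 \<le> norm_Rn k x"
  by (simp add: norm_Rn_def L2_set_nonneg)

lemma norm_Rn_diff_le: "norm_Rn k (\<lambda>i. x i - y i) \<le> norm_Rn k x + norm_Rn k y"
proof -
  have "L2_set (\<lambda>i. x i + - y i) {..<k} \<le> L2_set x {..<k} + L2_set (\<lambda>i. - y i) {..<k}"
    by (rule L2_set_triangle_ineq)
  then show ?thesis by (simp add: norm_Rn_def L2_set_def)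
qed

lemma grid_eq_iff:
  "grid k R m l x = zs \<longleftrightarrow> length zs = k \<and> (\<forall>i<k. \<lfloor>x i * (sqrt (real k) * 2 ^ l / (R * 2 ^ m))\<rfloor> = zs ! i)"
  unfolding grid_def by (auto simp: list_eq_iff_nth_eq)

text \<open>Integer division of the finer floor by 2 returns the coarser one, which makes the dyadic
  grids nested.\<close>

lemma floor_double_eq: "\<lfloor>2 * u\<rfloor> = \<lfloor>2 * v\<rfloor> \<Longrightarrow> \<lfloor>u\<rfloor> = \<lfloor>v\<rfloor>" for u v :: real
  using floor_divide_real_eq_div[of 2 "2 * u"] floor_divide_real_eq_div[of 2 "2 * v"] by simp

lemma cell_nested:
  assumes "cell k R (Suc l) x = cell k R (Suc l) y"
  shows "cell k R l x = cell k R l y"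
proof (cases l)
  case (Suc l')
  let ?m = "shell R (norm_Rn k x)"
  have m: "shell R (norm_Rn k y) = ?m" and g: "grid k R ?m (Suc l') x = grid k R ?m (Suc l') y"
    using assms by (auto simp: Suc cell_Suc)
  have "grid k R ?m l' x = grid k R ?m l' y"
    unfolding grid_eq_iff
  proof (intro conjI allI impI)
    fix i assume i: "i < k"
    have "\<lfloor>x i * (sqrt (real k) * 2 ^ Suc l' / (R * 2 ^ ?m))\<rfloor> = \<lfloor>y i * (sqrt (real k) * 2 ^ Suc l' / (R * 2 ^ ?m))\<rfloor>"
      using g i unfolding grid_def by (auto simp: list_eq_iff_nth_eq)
    moreover have "u * (sqrt (real k) * 2 ^ Suc l' / (R * 2 ^ ?m)) = 2 * (u * (sqrt (real k) * 2 ^ l' / (R * 2 ^ ?m)))" for u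
      by simp
    ultimately have "\<lfloor>x i * (sqrt (real k) * 2 ^ l' / (R * 2 ^ ?m))\<rfloor> = \<lfloor>y i * (sqrt (real k) * 2 ^ l' / (R * 2 ^ ?m))\<rfloor>"
      by (metis floor_double_eq)
    then show "\<lfloor>x i * (sqrt (real k) * 2 ^ l' / (R * 2 ^ ?m))\<rfloor> = grid k R ?m l' y ! i"
      using i by (simp add: grid_def)
  qed (simp add: grid_def)
  then show ?thesis using m by (simp add: Suc cell_Suc)
qed simp

text \<open>The number \<open>2 * R * 2 ^ m\<close> is the diameter of the ball containing shell
  \<open>m\<close>. At level \<open>Suc l\<close> the 2 cancels and the diameter of a cube is left.
  The shell is part of the label of a cell of positive level, so the cost is a function of that
  label.\<close>

definition cell_cost :: "real \<Rightarrow> real \<Rightarrow> nat \<Rightarrow> nat \<Rightarrow> real" where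
  "cell_cost p R l m = (2 * R * 2 ^ m / 2 ^ l) powr p"

text \<open>At level 0 the two points may lie in different shells, which is why both costs are
  added: the larger shell bounds the distance, and its cost is one of the summands. At positive
  levels the cube diameter is enough.\<close>

lemma norm_diff_le_cell_cost:
  assumes R: "0 < R" and p: "0 \<le> p" and k: "0 < k" and c: "cell k R l x = cell k R l y"
  shows "norm_Rn k (\<lambda>i. x i - y i) powr p
     \<le> cell_cost p R l (shell R (norm_Rn k x)) + cell_cost p R l (shell R (norm_Rn k y))"
proof (cases l)
  case 0
  let ?a = "shell R (norm_Rn k x)" and ?b = "shell R (norm_Rn k y)"
  have "norm_Rn k (\<lambda>i. x i - y i) \<le> R * 2 ^ ?a + R * 2 ^ ?b"
    using norm_Rn_diff_le[of k x y] le_shell[OF R norm_Rn_nonneg[of k x]] le_shell[OF R norm_Rn_nonneg[of k y]]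
    by linarith
  also have "\<dots> \<le> 2 * R * 2 ^ max ?a ?b"
  proof -
    have "R * 2 ^ ?a \<le> R * 2 ^ max ?a ?b" "R * 2 ^ ?b \<le> R * 2 ^ max ?a ?b"
      using R by (auto intro!: power_increasing)
    then show ?thesis by linarith
  qed
  finally have "norm_Rn k (\<lambda>i. x i - y i) powr p \<le> (2 * R * 2 ^ max ?a ?b) powr p"
    using p by (intro powr_mono2) auto
  also have "\<dots> \<le> (2 * R * 2 ^ ?a) powr p + (2 * R * 2 ^ ?b) powr p"
    by (cases "?a \<le> ?b") (auto simp: max_def)
  finally show ?thesis by (simp add: 0 cell_cost_def)
next
  case (Suc l')
  let ?m = "shell R (norm_Rn k x)"
  \<comment> \<open>The side of the cubes: equal floors force each coordinate to differ by at most
    \<open>s\<close>, hence the norm by at most \<open>sqrt k * s\<close>.\<close>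
  define s where "s = R * 2 ^ ?m / (sqrt (real k) * 2 ^ l')"
  have s: "0 < s" using R k by (simp add: s_def)
  have g: "grid k R ?m l' x = grid k R ?m l' y"
    using c by (auto simp: Suc cell_Suc)
  have xy: "\<bar>x i - y i\<bar> \<le> s" if i: "i < k" for i
  proof -
    have inv: "sqrt (real k) * 2 ^ l' / (R * 2 ^ ?m) = 1 / s" by (simp add: s_def)
    have "\<lfloor>x i * (1 / s)\<rfloor> = \<lfloor>y i * (1 / s)\<rfloor>"
      using g i unfolding grid_def inv by (auto simp: list_eq_iff_nth_eq)
    then have "\<bar>x i * (1 / s) - y i * (1 / s)\<bar> \<le> 1" by linarith
    moreover have "x i * (1 / s) - y i * (1 / s) = (x i - y i) / s" by (simp add: diff_divide_distrib)
    ultimately show ?thesis using s by simp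
  qed
  have "norm_Rn k (\<lambda>i. x i - y i) \<le> L2_set (\<lambda>_. s) {..<k}"
    unfolding norm_Rn_def L2_set_def
  proof (intro real_sqrt_le_mono sum_mono)
    fix i assume "i \<in> {..<k}"
    then have "\<bar>x i - y i\<bar>\<^sup>2 \<le> s\<^sup>2"
      using xy[of i] by (intro power_mono) auto
    then show "(x i - y i)\<^sup>2 \<le> s\<^sup>2" by simp
  qed
  also have "\<dots> = sqrt (real k) * s" using s by (simp add: L2_set_def real_sqrt_mult)
  also have "\<dots> = 2 * R * 2 ^ ?m / 2 ^ l" using k by (simp add: s_def Suc)
  finally have "norm_Rn k (\<lambda>i. x i - y i) powr p \<le> cell_cost p R l ?m"
    unfolding cell_cost_def using p by (intro powr_mono2) auto
  moreover have "0 \<le> cell_cost p R l (shell R (norm_Rn k y))" by (simp add: cell_cost_def)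
  ultimately show ?thesis by linarith
qed

text \<open>Cauchy-Schwarz turns the Euclidean bound into an \<open>l1\<close> bound with a factor
  \<open>sqrt k\<close>, which the grid scale turns into \<open>k * 2 ^ l\<close>. Rounding adds at
  most 1 per coordinate, hence the \<open>+ 1\<close>.\<close>

lemma grid_in_l1_ball:
  assumes R: "0 < R" and k: "0 < k" and n: "norm_Rn k x \<le> R * 2 ^ m"
  shows "grid k R m l x \<in> l1_ball k (2 ^ l + 1)"
proof -
  define s where "s = sqrt (real k) * 2 ^ l / (R * 2 ^ m)"
  have s: "0 \<le> s" using R by (simp add: s_def)
  have "(\<Sum>i<k. \<bar>x i\<bar> * \<bar>1\<bar>) \<le> L2_set x {..<k} * L2_set (\<lambda>_. 1) {..<k}"
    by (rule L2_set_mult_ineq)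
  then have sum: "(\<Sum>i<k. \<bar>x i\<bar>) \<le> norm_Rn k x * sqrt (real k)"
    by (simp add: norm_Rn_def L2_set_def)
  have "real_of_int (\<Sum>i<k. \<bar>\<lfloor>x i * s\<rfloor>\<bar>) = (\<Sum>i<k. real_of_int \<bar>\<lfloor>x i * s\<rfloor>\<bar>)" by simp
  also have "\<dots> \<le> (\<Sum>i<k. \<bar>x i\<bar> * s + 1)"
  proof (rule sum_mono)
    fix i
    have "real_of_int \<bar>\<lfloor>x i * s\<rfloor>\<bar> \<le> \<bar>x i * s\<bar> + 1" by linarith
    then show "real_of_int \<bar>\<lfloor>x i * s\<rfloor>\<bar> \<le> \<bar>x i\<bar> * s + 1" using s by (simp add: abs_mult)
  qed
  also have "\<dots> = (\<Sum>i<k. \<bar>x i\<bar>) * s + real k"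
    by (simp add: sum.distrib sum_distrib_right)
  also have "(\<Sum>i<k. \<bar>x i\<bar>) * s \<le> (R * 2 ^ m * sqrt (real k)) * s"
    using sum n s by (intro mult_right_mono order_trans[OF sum] mult_right_mono) auto
  also have "(R * 2 ^ m * sqrt (real k)) * s = real k * 2 ^ l"
    using R by (simp add: s_def field_simps)
  also have "real k * 2 ^ l + real k = real_of_int (int ((2 ^ l + 1) * k))"
    by (simp add: algebra_simps)
  finally have "(\<Sum>i<k. \<bar>\<lfloor>x i * s\<rfloor>\<bar>) \<le> int ((2 ^ l + 1) * k)"
    by (simp only: of_int_le_iff)
  then show ?thesis
    by (simp add: l1_ball_def grid_def s_def interv_sum_list_conv_sum_set_nat atLeast0LessThan comp_def)
qed

text \<open>The base is \<open>15 = 3 * 5\<close>: \<open>exp 1\<close> is at most 3, and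
  \<open>2 * (2 ^ l + 1) + 1\<close> is at most \<open>5 * 2 ^ l\<close>.\<close>

lemma card_cells_le: "real (card (l1_ball k (2 ^ l + 1))) \<le> (15 * 2 ^ l) ^ k"
proof -
  have "real (card (l1_ball k (2 ^ l + 1))) \<le> (exp 1 * (2 * real (2 ^ l + 1) + 1)) ^ k"
    by (rule card_l1_ball_le) simp
  also have "\<dots> \<le> (15 * 2 ^ l) ^ k"
  proof (rule power_mono)
    have "exp 1 * (2 * real (2 ^ l + 1) + 1) \<le> 3 * (5 * 2 ^ l)"
      using exp_le by (intro mult_mono) auto
    then show "exp 1 * (2 * real (2 ^ l + 1) + 1) \<le> 15 * 2 ^ l" by simp
  qed auto
  finally show ?thesis .
qed

lemma norm_Rn_measurable: "norm_Rn k \<in> borel_measurable (borel_Rn k)"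
  unfolding norm_Rn_def[abs_def] L2_set_def by measurable

lemma norm_Rn_diff_measurable:
  "(\<lambda>z. norm_Rn k (\<lambda>i. fst z i - snd z i)) \<in> borel_measurable (borel_Rn k \<Otimes>\<^sub>M borel_Rn k)"
  unfolding norm_Rn_def L2_set_def by measurable

lemma shell_measurable: "(\<lambda>x. shell R (norm_Rn k x)) \<in> borel_Rn k \<rightarrow>\<^sub>M count_space UNIV"
  unfolding shell_def using norm_Rn_measurable[of k] by measurable

text \<open>Labels are countable, so preimages of single labels suffice. Fixing the shell first
  makes the grid scale constant and leaves finitely many conditions on floors.\<close>

lemma cell_measurable: "cell k R l \<in> borel_Rn k \<rightarrow>\<^sub>M count_space UNIV"
proof (cases l)
  case 0
  then have "cell k R l = (\<lambda>_. (0, []))" by (simp add: fun_eq_iff)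
  then show ?thesis by simp
next
  case (Suc l')
  have "(cell k R l -` {j}) \<inter> space (borel_Rn k) \<in> sets (borel_Rn k)" for j
  proof -
    obtain m zs where j: "j = (m, zs)" by (cases j)
    have "(cell k R l -` {j}) \<inter> space (borel_Rn k) =
        {x \<in> space (borel_Rn k). shell R (norm_Rn k x) = m} \<inter>
        {x \<in> space (borel_Rn k). length zs = k \<and> (\<forall>i\<in>{..<k}. \<lfloor>x i * (sqrt (real k) * 2 ^ l' / (R * 2 ^ m))\<rfloor> = zs ! i)}"
      by (auto simp: j Suc cell_Suc grid_eq_iff)
    also have "\<dots> \<in> sets (borel_Rn k)"
    proof (rule sets.Int)
      show "{x \<in> space (borel_Rn k). shell R (norm_Rn k x) = m} \<in> sets (borel_Rn k)"
        using measurable_sets[OF shell_measurable[of R k], of "{m}"]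
        by (simp add: vimage_def Int_def conj_commute)
      show "{x \<in> space (borel_Rn k). length zs = k \<and> (\<forall>i\<in>{..<k}. \<lfloor>x i * (sqrt (real k) * 2 ^ l' / (R * 2 ^ m))\<rfloor> = zs ! i)} \<in> sets (borel_Rn k)"
        by measurable
    qed
    finally show ?thesis .
  qed
  then show ?thesis by (subst measurable_count_space_eq2_countable) auto
qed

section \<open>The Wasserstein cost of the multiscale plan\<close>

lemma epowr_epowr_inverse:
  assumes "0 < p"
  shows "epowr (epowr x (1 / p)) p = x"
proof (cases "x = \<top>")
  case False
  then have "epowr x (1 / p) \<noteq> \<top>" by (simp add: epowr_def)
  then have "epowr (epowr x (1 / p)) p = ennreal (enn2real (ennreal (enn2real x powr (1 / p))) powr p)"
    using False by (simp add: epowr_def)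
  also have "\<dots> = ennreal (enn2real x)"
    using assms by (simp add: powr_powr)
  finally show ?thesis using False by (simp add: less_top)
qed (simp add: epowr_def)

text \<open>The right-hand side of \<open>multiscale_coupling\<close> for these cells; the last two
  integrals pay for the matching at the finest level.\<close>

definition multiscale_bound ::
  "nat \<Rightarrow> real \<Rightarrow> real \<Rightarrow> nat \<Rightarrow> (nat \<Rightarrow> real) measure \<Rightarrow> (nat \<Rightarrow> real) measure \<Rightarrow> ennreal" where
  "multiscale_bound k p R L \<mu> \<nu> =
     (\<Sum>l<L. \<integral>\<^sup>+ j. ennreal (cell_cost p R l (fst j)) * mass_gap \<mu> \<nu> (cell k R (Suc l)) j \<partial>count_space UNIV)
     + ((\<integral>\<^sup>+ x. ennreal (cell_cost p R L (shell R (norm_Rn k x))) \<partial>\<mu>)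
       + (\<integral>\<^sup>+ x. ennreal (cell_cost p R L (shell R (norm_Rn k x))) \<partial>\<nu>))"

text \<open>The multiscale plan is one candidate in the infimum; the depth \<open>L\<close> stays
  free.\<close>

lemma wasserstein_powr_le_multiscale:
  assumes R: "0 < R" and p: "1 \<le> p" and k: "0 < k"
    and \<mu>: "\<mu> \<in> prob_Rn k" and \<nu>: "\<nu> \<in> prob_Rn k"
  shows "epowr (wasserstein k p \<mu> \<nu>) p \<le> multiscale_bound k p R L \<mu> \<nu>"
proof -
  have sets: "sets \<mu> = sets (borel_Rn k)" "sets \<nu> = sets (borel_Rn k)"
    and pr: "prob_space \<mu>" "prob_space \<nu>"
    using \<mu> \<nu> by (auto simp: prob_Rn_def)
  have pm: "sets (\<mu> \<Otimes>\<^sub>M \<nu>) = sets (borel_Rn k \<Otimes>\<^sub>M borel_Rn k)"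
    using sets by (rule sets_pair_measure_cong)
  interpret prob_pair \<mu> \<nu>
    by (intro prob_pair.intro prob_pair_axioms.intro pr) (simp only: sets)
  define cost where "cost x y = ennreal (norm_Rn k (\<lambda>i. x i - y i) powr p)" for x y :: "nat \<Rightarrow> real"
  define e where "e l x = ennreal (cell_cost p R l (shell R (norm_Rn k x)))" for l x
  define \<epsilon> where "\<epsilon> l j = ennreal (cell_cost p R l (fst j))" for l and j :: "nat \<times> int list"
  have c: "cell k R l \<in> \<mu> \<rightarrow>\<^sub>M count_space UNIV" for l
    unfolding measurable_cong_sets[OF sets(1) refl] by (rule cell_measurable)
  have cost_meas: "(\<lambda>z. cost (fst z) (snd z)) \<in> borel_measurable (\<mu> \<Otimes>\<^sub>M \<nu>)"
    unfolding measurable_cong_sets[OF pm refl] cost_def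
    using norm_Rn_diff_measurable[of k] by measurable
  have e: "e l \<in> borel_measurable \<mu>" for l
  proof -
    have "(\<lambda>m. ennreal (cell_cost p R l m)) \<in> count_space UNIV \<rightarrow>\<^sub>M borel" by simp
    from measurable_compose[OF shell_measurable this]
    show ?thesis unfolding measurable_cong_sets[OF sets(1) refl] e_def .
  qed
  have cost: "cost x y \<le> e l x + e l y" if "cell k R l x = cell k R l y" for l x y
  proof -
    have "norm_Rn k (\<lambda>i. x i - y i) powr p
      \<le> cell_cost p R l (shell R (norm_Rn k x)) + cell_cost p R l (shell R (norm_Rn k y))"
      using R p k that by (intro norm_diff_le_cell_cost) auto
    then show ?thesis unfolding cost_def e_def
      by (simp add: cell_cost_def ennreal_leI flip: ennreal_plus)
  qed
  obtain \<pi> where \<pi>: "prob_space \<pi>" "sets \<pi> = sets (\<mu> \<Otimes>\<^sub>M \<nu>)" "distr \<pi> \<mu> fst = \<mu>" "distr \<pi> \<nu> snd = \<nu>"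
    "(\<integral>\<^sup>+ z. cost (fst z) (snd z) \<partial>\<pi>)
      \<le> (\<Sum>l<L. \<integral>\<^sup>+ j. \<epsilon> l j * mass_gap \<mu> \<nu> (cell k R (Suc l)) j \<partial>count_space UNIV)
         + ((\<integral>\<^sup>+ x. e L x \<partial>\<mu>) + (\<integral>\<^sup>+ y. e L y \<partial>\<nu>))"
  proof (rule multiscale_coupling[where c="cell k R" and e=e and \<epsilon>=\<epsilon> and cost=cost and L=L])
    show "e l x = \<epsilon> l (cell k R (Suc l) x)" for l x by (simp add: e_def \<epsilon>_def cell_Suc)
    show "cell k R 0 x = cell k R 0 y" for x y by simp
  qed (rule c cost_meas e; fail | erule cell_nested | rule cost, assumption | rule that, assumption+)+
  have "\<pi> \<in> couplings k \<mu> \<nu>"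
    unfolding couplings_def
  proof (intro CollectI conjI)
    show "sets \<pi> = sets (borel_Rn k \<Otimes>\<^sub>M borel_Rn k)" by (simp only: \<pi>(2) pm)
    have "distr \<pi> (borel_Rn k) fst = distr \<pi> \<mu> fst" by (rule distr_cong) (simp_all only: sets)
    then show "distr \<pi> (borel_Rn k) fst = \<mu>" by (simp only: \<pi>(3))
    have "distr \<pi> (borel_Rn k) snd = distr \<pi> \<nu> snd" by (rule distr_cong) (simp_all only: sets)
    then show "distr \<pi> (borel_Rn k) snd = \<nu>" by (simp only: \<pi>(4))
  qed (rule \<pi>(1))
  then have "(INF \<pi>\<in>couplings k \<mu> \<nu>. \<integral>\<^sup>+ (x, y). ennreal (norm_Rn k (\<lambda>i. x i - y i) powr p) \<partial>\<pi>)
      \<le> (\<integral>\<^sup>+ (x, y). ennreal (norm_Rn k (\<lambda>i. x i - y i) powr p) \<partial>\<pi>)"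
    by (rule INF_lower)
  also have "\<dots> = (\<integral>\<^sup>+ z. cost (fst z) (snd z) \<partial>\<pi>)"
    by (simp add: cost_def case_prod_unfold)
  also have "\<dots> \<le> multiscale_bound k p R L \<mu> \<nu>"
    using \<pi>(5) unfolding e_def \<epsilon>_def multiscale_bound_def .
  finally show ?thesis
    unfolding wasserstein_def using p by (subst epowr_epowr_inverse) auto
qed

section \<open>Empirical frequencies\<close>

text \<open>Two estimates of one deviation: the triangle inequality gives twice the mass, which is
  better for rare cells, and the variance of a mean of independent indicators gives the square
  root.\<close>

lemma (in prob_space) frequency_deviation_le:
  fixes X :: "nat \<Rightarrow> 'a \<Rightarrow> 'b" and a :: real
  assumes indep: "indep_vars (\<lambda>_. N) X {1..n}" and n: "1 \<le> n" and A: "A \<in> sets N"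
    and a: "\<And>i. i \<in> {1..n} \<Longrightarrow> prob (X i -` A \<inter> space M) = a"
  shows "integrable M (\<lambda>\<omega>. \<bar>(\<Sum>i=1..n. indicator A (X i \<omega>)) / real n - a\<bar>)"
    and "expectation (\<lambda>\<omega>. \<bar>(\<Sum>i=1..n. indicator A (X i \<omega>)) / real n - a\<bar>) \<le> 2 * min a (sqrt (a / real n))"
proof -
  define Z where "Z i \<omega> = (indicator A (X i \<omega>) :: real) - a" for i \<omega>
  define W where "W \<omega> = (\<Sum>i=1..n. indicator A (X i \<omega>)) / real n - a" for \<omega>
  have X: "X i \<in> M \<rightarrow>\<^sub>M N" if "i \<in> {1..n}" for i
    using indep that by (simp add: indep_vars_def2)
  have ind: "(\<lambda>\<omega>. indicator A (X i \<omega>) :: real) \<in> borel_measurable M" if "i \<in> {1..n}" for i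
    using measurable_compose[OF X[OF that] borel_measurable_indicator[OF A]] .
  have a01: "0 \<le> a" "a \<le> 1"
    using a[of 1] n prob_le_1[of "X 1 -` A \<inter> space M"] measure_nonneg[of M "X 1 -` A \<inter> space M"] by auto
  have int_ind: "integrable M (\<lambda>\<omega>. indicator A (X i \<omega>) :: real)" if "i \<in> {1..n}" for i
    by (rule integrable_const_bound[where B=1]) (use ind[OF that] in \<open>auto simp: indicator_def\<close>)
  have E_ind: "expectation (\<lambda>\<omega>. indicator A (X i \<omega>)) = a" if "i \<in> {1..n}" for i
  proof -
    have "expectation (\<lambda>\<omega>. indicator A (X i \<omega>)) = expectation (indicator (X i -` A \<inter> space M))"
      by (intro Bochner_Integration.integral_cong) (auto simp: indicator_def)
    also have "\<dots> = a" using a[OF that] by simp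
    finally show ?thesis .
  qed
  have Zm: "Z i \<in> borel_measurable M" if "i \<in> {1..n}" for i
    unfolding Z_def[abs_def] using ind[OF that] by simp
  have Zb: "\<bar>Z i \<omega>\<bar> \<le> 1" for i \<omega>
    using a01 by (auto simp: Z_def indicator_def)
  have ZZ: "integrable M (\<lambda>\<omega>. Z i \<omega> * Z j \<omega>)" if "i \<in> {1..n}" "j \<in> {1..n}" for i j
  proof (rule integrable_const_bound[where B=1])
    show "AE \<omega> in M. norm (Z i \<omega> * Z j \<omega>) \<le> 1"
      using Zb mult_mono[OF Zb Zb] by (auto simp: abs_mult)
  qed (use Zm that in simp)
  have Zi: "integrable M (Z i)" if "i \<in> {1..n}" for i
    unfolding Z_def[abs_def] using int_ind[OF that] by simp
  have EZ: "expectation (Z i) = 0" if "i \<in> {1..n}" for i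
    unfolding Z_def[abs_def] using int_ind[OF that] E_ind[OF that] by (simp add: prob_space)
  \<comment> \<open>Independence of the centred indicators removes the mixed terms from the squared
    mean.\<close>
  have off: "expectation (\<lambda>\<omega>. Z i \<omega> * Z j \<omega>) = 0" if "i \<in> {1..n}" "j \<in> {1..n}" "i \<noteq> j" for i j
  proof -
    have "indep_vars (\<lambda>_. borel) Z {i, j}"
    proof -
      have "indep_vars (\<lambda>_. N) X {i, j}" using that by (intro indep_vars_subset[OF indep]) auto
      then have "indep_vars (\<lambda>_. borel) (\<lambda>i \<omega>. (\<lambda>y. indicator A y - a) (X i \<omega>)) {i, j}"
        by (rule indep_vars_compose2) (use A in simp)
      then show ?thesis by (simp add: Z_def[abs_def])
    qed
    then have "expectation (\<lambda>\<omega>. \<Prod>l\<in>{i, j}. Z l \<omega>) = (\<Prod>l\<in>{i, j}. expectation (Z l))"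
      using Zi that by (intro indep_vars_lebesgue_integral) auto
    then show ?thesis using that EZ by simp
  qed
  have diag: "expectation (\<lambda>\<omega>. Z i \<omega> * Z i \<omega>) \<le> a" if "i \<in> {1..n}" for i
  proof -
    have "expectation (\<lambda>\<omega>. Z i \<omega> * Z i \<omega>) = expectation (\<lambda>\<omega>. (1 - 2 * a) * indicator A (X i \<omega>) + a * a)"
      by (intro Bochner_Integration.integral_cong) (auto simp: Z_def indicator_def algebra_simps)
    also have "\<dots> = (1 - 2 * a) * a + a * a"
      using int_ind[OF that] E_ind[OF that] by (simp add: prob_space)
    also have "\<dots> \<le> a" using a01 by (simp add: algebra_simps)
    finally show ?thesis .
  qed
  have W_eq: "W \<omega> = (\<Sum>i=1..n. Z i \<omega>) / real n" for \<omega>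
    using n by (simp add: W_def Z_def sum_subtractf diff_divide_distrib)
  have Wm: "W \<in> borel_measurable M"
    unfolding W_eq[abs_def] using Zm by (intro borel_measurable_divide borel_measurable_sum) auto
  have int_W: "integrable M W"
    unfolding W_eq[abs_def] using Zi by (intro integrable_divide Bochner_Integration.integrable_sum) auto
  have W2: "(W \<omega>)\<^sup>2 = (\<Sum>i=1..n. \<Sum>j=1..n. Z i \<omega> * Z j \<omega>) / (real n)\<^sup>2" for \<omega>
    by (simp add: W_eq power_divide power2_eq_square sum_product)
  have int_W2: "integrable M (\<lambda>\<omega>. (W \<omega>)\<^sup>2)"
    unfolding W2 using ZZ by (intro integrable_divide Bochner_Integration.integrable_sum) auto
  have "expectation (\<lambda>\<omega>. (W \<omega>)\<^sup>2) = (\<Sum>i=1..n. \<Sum>j=1..n. expectation (\<lambda>\<omega>. Z i \<omega> * Z j \<omega>)) / (real n)\<^sup>2"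
  proof -
    have "expectation (\<lambda>\<omega>. \<Sum>i=1..n. \<Sum>j=1..n. Z i \<omega> * Z j \<omega>)
        = (\<Sum>i=1..n. expectation (\<lambda>\<omega>. \<Sum>j=1..n. Z i \<omega> * Z j \<omega>))"
      by (intro Bochner_Integration.integral_sum Bochner_Integration.integrable_sum ZZ)
    also have "\<dots> = (\<Sum>i=1..n. \<Sum>j=1..n. expectation (\<lambda>\<omega>. Z i \<omega> * Z j \<omega>))"
      by (intro sum.cong refl Bochner_Integration.integral_sum ZZ)
    finally show ?thesis unfolding W2 by simp
  qed
  also have "(\<Sum>i=1..n. \<Sum>j=1..n. expectation (\<lambda>\<omega>. Z i \<omega> * Z j \<omega>)) \<le> (\<Sum>i=1..n. \<Sum>j=1..n. if i = j then a else 0)"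
    using off diag by (intro sum_mono) auto
  also have "\<dots> = real n * a" by simp
  finally have EW2: "expectation (\<lambda>\<omega>. (W \<omega>)\<^sup>2) \<le> a / real n"
    using n by (simp add: power2_eq_square divide_right_mono)
  \<comment> \<open>Nonnegativity of the variance of \<open>\<bar>W \<omega>\<bar>\<close> is
    Jensen's inequality for the square.\<close>
  have "0 \<le> variance (\<lambda>\<omega>. \<bar>W \<omega>\<bar>)" by (rule variance_positive)
  also have "variance (\<lambda>\<omega>. \<bar>W \<omega>\<bar>) = expectation (\<lambda>\<omega>. \<bar>W \<omega>\<bar>\<^sup>2) - (expectation (\<lambda>\<omega>. \<bar>W \<omega>\<bar>))\<^sup>2"
    using int_W int_W2 by (intro variance_eq) auto
  finally have "(expectation (\<lambda>\<omega>. \<bar>W \<omega>\<bar>))\<^sup>2 \<le> a / real n" using EW2 by simp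
  then have 1: "expectation (\<lambda>\<omega>. \<bar>W \<omega>\<bar>) \<le> sqrt (a / real n)" by (rule real_le_rsqrt)
  have "expectation (\<lambda>\<omega>. \<bar>W \<omega>\<bar>) \<le> expectation (\<lambda>\<omega>. (\<Sum>i=1..n. indicator A (X i \<omega>)) / real n + a)"
  proof (rule integral_mono)
    show "integrable M (\<lambda>\<omega>. (\<Sum>i=1..n. indicator A (X i \<omega>)) / real n + a)"
      using int_ind by (intro Bochner_Integration.integrable_add integrable_divide Bochner_Integration.integrable_sum) auto
    fix \<omega>
    have "0 \<le> (\<Sum>i=1..n. indicator A (X i \<omega>)) / real n" by (intro divide_nonneg_nonneg sum_nonneg) auto
    then show "\<bar>W \<omega>\<bar> \<le> (\<Sum>i=1..n. indicator A (X i \<omega>)) / real n + a"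
      using a01 unfolding W_def by linarith
  qed (use int_W in simp)
  also have "\<dots> = (\<Sum>i=1..n. expectation (\<lambda>\<omega>. indicator A (X i \<omega>))) / real n + a"
  proof -
    have "integrable M (\<lambda>\<omega>. (\<Sum>i=1..n. indicator A (X i \<omega>)) / real n)"
      by (intro integrable_divide Bochner_Integration.integrable_sum int_ind)
    then have "expectation (\<lambda>\<omega>. (\<Sum>i=1..n. indicator A (X i \<omega>)) / real n + a)
        = expectation (\<lambda>\<omega>. (\<Sum>i=1..n. indicator A (X i \<omega>))) / real n + a"
      by (subst Bochner_Integration.integral_add) (simp_all add: prob_space)
    also have "expectation (\<lambda>\<omega>. (\<Sum>i=1..n. indicator A (X i \<omega>) :: real))
        = (\<Sum>i=1..n. expectation (\<lambda>\<omega>. indicator A (X i \<omega>)))"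
      by (intro Bochner_Integration.integral_sum int_ind)
    finally show ?thesis .
  qed
  also have "\<dots> = 2 * a" using E_ind n by simp
  finally have 2: "expectation (\<lambda>\<omega>. \<bar>W \<omega>\<bar>) \<le> 2 * a" .
  have "0 \<le> sqrt (a / real n)" using a01 by simp
  then have "expectation (\<lambda>\<omega>. \<bar>W \<omega>\<bar>) \<le> 2 * min a (sqrt (a / real n))"
    using 1 2 by linarith
  then show "expectation (\<lambda>\<omega>. \<bar>(\<Sum>i=1..n. indicator A (X i \<omega>)) / real n - a\<bar>) \<le> 2 * min a (sqrt (a / real n))"
    by (simp add: W_def)
  show "integrable M (\<lambda>\<omega>. \<bar>(\<Sum>i=1..n. indicator A (X i \<omega>)) / real n - a\<bar>)"
    using integrable_abs[OF int_W] by (simp only: W_def)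
qed

section \<open>Empirical measures as images of a uniform index\<close>

lemma ennreal_gap_eq:
  assumes "0 \<le> a" "0 \<le> b"
  shows "(ennreal a - ennreal b) + (ennreal b - ennreal a) = ennreal \<bar>a - b\<bar>"
  using assms by (cases "a \<le> b") (auto simp: ennreal_minus ennreal_neg abs_if)

lemma emeasure_empirical_real:
  assumes "A \<in> sets (borel_Rn d)" "1 \<le> n"
  shows "emeasure (empirical d n y) A = ennreal ((\<Sum>i=1..n. indicator A (y i)) / real n)"
proof -
  have "emeasure (empirical d n y) A = (\<Sum>i=1..n. indicator A (y i)) / of_nat n"
    using assms by (simp add: emeasure_empirical)
  also have "(\<Sum>i=1..n. indicator A (y i) :: ennreal) = ennreal (\<Sum>i=1..n. indicator A (y i))"
    by (simp add: ennreal_indicator flip: sum_ennreal)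
  also have "\<dots> / of_nat n = ennreal ((\<Sum>i=1..n. indicator A (y i)) / real n)"
    using assms by (simp add: divide_ennreal sum_nonneg ennreal_of_nat_eq_real_of_nat)
  finally show ?thesis .
qed

lemma sample_measurable:
  assumes "\<And>i. i \<in> {1..n} \<Longrightarrow> y i \<in> space N"
  shows "y \<in> uniform_count_measure {1..n} \<rightarrow>\<^sub>M N"
  using assms by (auto simp: measurable_def space_uniform_count_measure sets_uniform_count_measure)

text \<open>Written as an image of the uniform law on the indices, the empirical measure inherits
  its integrals and its further images from \<open>distr\<close>.\<close>

lemma empirical_eq_distr:
  assumes n: "1 \<le> n" and y: "\<And>i. i \<in> {1..n} \<Longrightarrow> y i \<in> space (borel_Rn d)"
  shows "empirical d n y = distr (uniform_count_measure {1..n}) (borel_Rn d) y"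
proof (rule measure_eqI)
  fix A assume "A \<in> sets (empirical d n y)"
  then have A: "A \<in> sets (borel_Rn d)" by simp
  have ym: "y \<in> uniform_count_measure {1..n} \<rightarrow>\<^sub>M borel_Rn d" by (rule sample_measurable[OF y])
  have "emeasure (distr (uniform_count_measure {1..n}) (borel_Rn d) y) A
      = emeasure (uniform_count_measure {1..n}) (y -` A \<inter> {1..n})"
    using emeasure_distr[OF ym A] by (simp add: space_uniform_count_measure)
  also have "\<dots> = ennreal (real (card (y -` A \<inter> {1..n})) / real n)"
    by (subst emeasure_uniform_count_measure) auto
  also have "real (card (y -` A \<inter> {1..n})) = (\<Sum>i=1..n. indicator A (y i))"
    by (simp add: indicator_def sum.If_cases Int_commute vimage_def Int_def)
  also have "ennreal ((\<Sum>i=1..n. indicator A (y i)) / real n) = emeasure (empirical d n y) A"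
    using emeasure_empirical_real[OF A n] by simp
  finally show "emeasure (empirical d n y) A = emeasure (distr (uniform_count_measure {1..n}) (borel_Rn d) y) A" ..
qed simp

lemma empirical_prob_Rn:
  assumes n: "1 \<le> n" and y: "\<And>i. i \<in> {1..n} \<Longrightarrow> y i \<in> space (borel_Rn d)"
  shows "empirical d n y \<in> prob_Rn d"
proof -
  have eq: "empirical d n y = distr (uniform_count_measure {1..n}) (borel_Rn d) y"
    by (rule empirical_eq_distr[OF n]) (rule y)
  have "prob_space (uniform_count_measure {1..n})"
    using n by (intro prob_space_uniform_count_measure) auto
  then have "prob_space (empirical d n y)"
    unfolding eq
    by (rule prob_space.prob_space_distr)
      (rule sample_measurable[OF y])
  then show ?thesis by (simp add: prob_Rn_def)
qed

lemma nn_integral_empirical: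
  assumes n: "1 \<le> n" and y: "\<And>i. i \<in> {1..n} \<Longrightarrow> y i \<in> space (borel_Rn d)"
    and f: "f \<in> borel_measurable (borel_Rn d)"
  shows "(\<integral>\<^sup>+ x. f x \<partial>empirical d n y) = (\<Sum>i=1..n. f (y i)) / of_nat n"
proof -
  have eq: "empirical d n y = distr (uniform_count_measure {1..n}) (borel_Rn d) y"
    by (rule empirical_eq_distr[OF n]) (rule y)
  have ym: "y \<in> uniform_count_measure {1..n} \<rightarrow>\<^sub>M borel_Rn d" by (rule sample_measurable[OF y])
  have "(\<integral>\<^sup>+ x. f x \<partial>empirical d n y) = (\<integral>\<^sup>+ i. f (y i) \<partial>uniform_count_measure {1..n})"
    unfolding eq using f by (subst nn_integral_distr[OF ym]) auto
  also have "\<dots> = (\<Sum>i=1..n. f (y i) * ennreal (1 / real n))"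
    unfolding uniform_count_measure_def using n by (subst nn_integral_point_measure_finite) (auto simp: mult.commute)
  also have "\<dots> = (\<Sum>i=1..n. f (y i)) / of_nat n"
  proof -
    have "ennreal (1 / real n) = inverse (of_nat n)"
      using n by (simp add: ennreal_of_nat_eq_real_of_nat inverse_ennreal inverse_eq_divide)
    then show ?thesis by (simp add: divide_ennreal_def sum_distrib_right)
  qed
  finally show ?thesis .
qed

lemma distr_empirical:
  assumes n: "1 \<le> n" and y: "\<And>i. i \<in> {1..n} \<Longrightarrow> y i \<in> space (borel_Rn d)"
    and T: "T \<in> borel_Rn d \<rightarrow>\<^sub>M borel_Rn k"
  shows "distr (empirical d n y) (borel_Rn k) T = empirical k n (\<lambda>i. T (y i))"
proof -
  have eq: "empirical d n y = distr (uniform_count_measure {1..n}) (borel_Rn d) y"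
    by (rule empirical_eq_distr[OF n]) (rule y)
  have ym: "y \<in> uniform_count_measure {1..n} \<rightarrow>\<^sub>M borel_Rn d" by (rule sample_measurable[OF y])
  have "distr (empirical d n y) (borel_Rn k) T = distr (uniform_count_measure {1..n}) (borel_Rn k) (T \<circ> y)"
    unfolding eq by (rule distr_distr[OF T ym])
  also have "\<dots> = empirical k n (\<lambda>i. T (y i))"
    unfolding comp_def using measurable_space[OF T y] by (intro empirical_eq_distr[OF n, symmetric])
  finally show ?thesis .
qed

text \<open>A concave power lies below its tangent at 1. This serves both to compare moments of
  orders \<open>p\<close> and \<open>q\<close> and to prove Jensen's inequality for the
  root.\<close>

lemma powr_le_affine:
  fixes s t :: real
  assumes "0 \<le> s" "0 \<le> t" "t \<le> 1"
  shows "s powr t \<le> (1 - t) + t * s"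
proof (cases "s = 0")
  case False
  then have "1 powr (1 - t) * s powr t \<le> (1 - t) * 1 + t * s"
    using assms by (intro Youngs_inequality_0) auto
  then show ?thesis by simp
qed (use assms in simp)

text \<open>Cauchy-Schwarz against the constant 1 brings in the number of cells.\<close>

lemma sum_min_sqrt_le:
  fixes r :: "'a \<Rightarrow> real"
  assumes "\<And>z. z \<in> B \<Longrightarrow> 0 \<le> r z" "0 < n"
  shows "(\<Sum>z\<in>B. min (r z) (sqrt (r z / real n)))
       \<le> min (\<Sum>z\<in>B. r z) (sqrt (real (card B) * (\<Sum>z\<in>B. r z) / real n))"
proof -
  have "(\<Sum>z\<in>B. sqrt (r z / real n))\<^sup>2 \<le> (\<Sum>z\<in>B. (sqrt (r z / real n))\<^sup>2) * real (card B)"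
    using Cauchy_Schwarz_ineq_sum[of "\<lambda>z. sqrt (r z / real n)" "\<lambda>_. 1" B] by simp
  also have "(\<Sum>z\<in>B. (sqrt (r z / real n))\<^sup>2) = (\<Sum>z\<in>B. r z) / real n"
    using assms by (simp add: sum_divide_distrib)
  finally have "(\<Sum>z\<in>B. sqrt (r z / real n)) \<le> sqrt (real (card B) * (\<Sum>z\<in>B. r z) / real n)"
    by (intro real_le_rsqrt) (simp add: mult.commute)
  moreover have "(\<Sum>z\<in>B. min (r z) (sqrt (r z / real n))) \<le> (\<Sum>z\<in>B. sqrt (r z / real n))"
    by (intro sum_mono) simp
  moreover have "(\<Sum>z\<in>B. min (r z) (sqrt (r z / real n))) \<le> (\<Sum>z\<in>B. r z)"
    by (intro sum_mono) simp
  ultimately show ?thesis by simp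
qed

lemma cell_cost_eq:
  assumes "0 < R"
  shows "cell_cost p R l m = (2 * R) powr p * (2 powr (p * real m) * 2 powr (- p * real l))"
proof -
  have "2 * R * 2 ^ m / 2 ^ l = (2 * R) * (2 powr real m * 2 powr (- real l))"
    by (simp add: powr_realpow powr_minus divide_simps)
  then show ?thesis unfolding cell_cost_def
    using assms by (simp add: powr_mult powr_powr mult.commute)
qed

section \<open>Shell and cell masses of a law with bounded moment of order \<open>q\<close>\<close>

context
  fixes k :: nat and p q R :: real and \<rho> :: "(nat \<Rightarrow> real) measure"
  assumes pq: "1 \<le> p" "p \<le> q" and R: "0 < R" and k: "1 \<le> k"
    and \<rho>: "\<rho> \<in> prob_Rn k" and mom: "moment k q \<rho> \<le> ennreal (R powr q)"
begin

interpretation prob_space \<rho> using \<rho> by (simp add: prob_Rn_def)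

lemma sets_rho: "sets \<rho> = sets (borel_Rn k)" using \<rho> by (simp add: prob_Rn_def)

definition shell_mass :: "nat \<Rightarrow> real" where
  "shell_mass m = measure \<rho> {x \<in> space \<rho>. shell R (norm_Rn k x) = m}"

lemma shell_set: "{x \<in> space \<rho>. shell R (norm_Rn k x) = m} \<in> sets \<rho>"
proof -
  have "(\<lambda>x. shell R (norm_Rn k x)) \<in> \<rho> \<rightarrow>\<^sub>M count_space UNIV"
    unfolding measurable_cong_sets[OF sets_rho refl] by (rule shell_measurable)
  from measurable_sets[OF this, of "{m}"] show ?thesis
    by (simp add: vimage_def Int_def conj_commute)
qed

lemma norm_meas: "norm_Rn k \<in> borel_measurable \<rho>"
  unfolding measurable_cong_sets[OF sets_rho refl] by (rule norm_Rn_measurable)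

lemma shell_fun_meas: "(\<lambda>x. ennreal (u (shell R (norm_Rn k x)))) \<in> borel_measurable \<rho>"
  unfolding measurable_cong_sets[OF sets_rho refl]
  by (rule measurable_compose[OF shell_measurable]) simp

lemma shell_mass_nonneg: "0 \<le> shell_mass m" by (simp add: shell_mass_def)

text \<open>Markov's inequality at the inner radius \<open>R * 2 ^ (m - 1)\<close> of the shell; the
  shift by one is the factor \<open>2 powr q\<close>. Shell 0 has no positive inner radius and is
  bounded by the total mass.\<close>

lemma shell_mass_le: "shell_mass m \<le> 2 powr q * 2 powr (- q * real m)"
proof (cases m)
  case 0
  have "shell_mass m \<le> 1" by (simp add: shell_mass_def)
  also have "1 \<le> 2 powr q" using pq by (simp add: ge_one_powr_ge_zero)
  finally show ?thesis by (simp add: 0)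
next
  case (Suc m')
  let ?A = "{x \<in> space \<rho>. shell R (norm_Rn k x) = m}"
  define c where "c = (R * 2 ^ m') powr q"
  have c: "0 < c" using R by (simp add: c_def)
  have "ennreal c * emeasure \<rho> ?A = (\<integral>\<^sup>+ x. ennreal c * indicator ?A x \<partial>\<rho>)"
    using shell_set by (rule nn_integral_cmult_indicator[symmetric])
  also have "\<dots> \<le> moment k q \<rho>"
    unfolding moment_def
  proof (intro nn_integral_mono)
    fix x
    show "ennreal c * indicator ?A x \<le> ennreal (norm_Rn k x powr q)"
    proof (cases "x \<in> ?A")
      case True
      then have "R * 2 ^ m' < norm_Rn k x"
        using R Suc by (intro shell_Suc_less) auto
      then have "c \<le> norm_Rn k x powr q" unfolding c_def using R pq by (intro powr_mono2) auto
      then show ?thesis using True by (simp add: ennreal_leI)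
    next
      case False
      then show ?thesis by (simp only: indicator_simps(2)[OF False] mult_zero_right zero_le)
    qed
  qed
  also have "\<dots> \<le> ennreal (R powr q)" by (rule mom)
  finally have "ennreal (c * shell_mass m) \<le> ennreal (R powr q)"
    using c by (simp add: shell_mass_def emeasure_eq_measure ennreal_mult)
  then have "c * shell_mass m \<le> R powr q" by simp
  moreover have "c = R powr q * 2 powr (q * real m')"
    using R by (simp add: c_def powr_mult powr_powr mult.commute flip: powr_realpow)
  ultimately have "R powr q * (2 powr (q * real m') * shell_mass m) \<le> R powr q * 1"
    by (simp add: mult.assoc)
  then have "2 powr (q * real m') * shell_mass m \<le> 1"
    using R by (subst (asm) mult_le_cancel_left_pos) auto
  then have "shell_mass m \<le> 2 powr (- (q * real m'))"
    by (simp add: powr_minus field_simps)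
  also have "2 powr (- (q * real m')) = 2 powr q * 2 powr (- q * real m)"
    by (simp add: Suc algebra_simps flip: powr_add)
  finally show ?thesis .
qed

text \<open>Outside shell 0 the number \<open>2 ^ shell\<close> is at most twice the norm over
  \<open>R\<close>, and the tangent inequality passes from order \<open>p\<close> to order
  \<open>q\<close>. The moment of order \<open>q\<close> of the norm over \<open>R\<close> is at
  most 1, so the constants recombine to \<open>1 + 2 powr p\<close>.\<close>

lemma nn_integral_shell_powr_le:
  "(\<integral>\<^sup>+ x. ennreal (2 powr (p * real (shell R (norm_Rn k x)))) \<partial>\<rho>) \<le> ennreal (1 + 2 powr p)"
proof -
  \<comment> \<open>Coefficients of the majorant of the integrand as an affine function of the
    \<open>q\<close>-th power of the norm.\<close>
  define \<alpha> where "\<alpha> = 1 + 2 powr p * (1 - p / q)"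
  define \<beta> where "\<beta> = 2 powr p * (p / q) * R powr (- q)"
  have "p / q \<le> 1" using pq by simp
  then have \<alpha>: "0 \<le> \<alpha>" by (simp add: \<alpha>_def)
  have \<beta>: "0 \<le> \<beta>" using pq by (simp add: \<beta>_def)
  have "(\<integral>\<^sup>+ x. ennreal (2 powr (p * real (shell R (norm_Rn k x)))) \<partial>\<rho>)
      \<le> (\<integral>\<^sup>+ x. ennreal \<alpha> + ennreal \<beta> * ennreal (norm_Rn k x powr q) \<partial>\<rho>)"
  proof (intro nn_integral_mono)
    fix x
    define t where "t = norm_Rn k x"
    have t: "0 \<le> t" by (simp add: t_def)
    have "2 powr (p * real (shell R t)) \<le> 1 + 2 powr p * (t / R) powr p"
    proof (cases "shell R t")
      case (Suc m)
      have "2 ^ m \<le> t / R" using shell_Suc_less[OF R t Suc] R by (simp add: field_simps)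
      then have "(2 ^ m) powr p \<le> (t / R) powr p" using pq by (intro powr_mono2) auto
      moreover have "2 powr (p * real (shell R t)) = 2 powr p * (2 ^ m) powr p"
        by (simp add: Suc powr_powr distrib_left powr_add mult.commute flip: powr_realpow)
      ultimately show ?thesis by (simp add: add_increasing)
    qed simp
    also have "(t / R) powr p = ((t / R) powr q) powr (p / q)"
      using pq by (simp add: powr_powr)
    also have "\<dots> \<le> (1 - p / q) + p / q * (t / R) powr q"
      using pq by (intro powr_le_affine) auto
    also have "1 + 2 powr p * ((1 - p / q) + p / q * (t / R) powr q) = \<alpha> + \<beta> * t powr q"
      using t R by (simp add: \<alpha>_def \<beta>_def powr_divide powr_minus_divide distrib_left)
    finally have "2 powr (p * real (shell R t)) \<le> \<alpha> + \<beta> * t powr q" by simp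
    then show "ennreal (2 powr (p * real (shell R (norm_Rn k x)))) \<le> ennreal \<alpha> + ennreal \<beta> * ennreal (norm_Rn k x powr q)"
      using \<alpha> \<beta> by (simp add: t_def ennreal_leI flip: ennreal_mult ennreal_plus)
  qed
  also have "\<dots> = ennreal \<alpha> + ennreal \<beta> * moment k q \<rho>"
  proof -
    have m: "(\<lambda>x. ennreal (norm_Rn k x powr q)) \<in> borel_measurable \<rho>"
      using norm_meas by measurable
    show ?thesis unfolding moment_def
      by (subst nn_integral_add) (use m in \<open>auto simp: nn_integral_cmult emeasure_space_1\<close>)
  qed
  also have "\<dots> \<le> ennreal \<alpha> + ennreal \<beta> * ennreal (R powr q)"
    by (intro add_left_mono mult_left_mono mom) simp
  also have "\<dots> = ennreal (\<alpha> + \<beta> * R powr q)"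
    using \<alpha> \<beta> by (simp add: ennreal_mult)
  also have "\<alpha> + \<beta> * R powr q = 1 + 2 powr p"
    using R by (simp add: \<alpha>_def \<beta>_def powr_minus algebra_simps)
  finally show ?thesis .
qed

lemma sum_shell_mass_le: "(\<Sum>m<M. 2 powr (p * real m) * shell_mass m) \<le> 1 + 2 powr p"
proof -
  let ?A = "\<lambda>m. {x \<in> space \<rho>. shell R (norm_Rn k x) = m}"
  have "ennreal (\<Sum>m<M. 2 powr (p * real m) * shell_mass m) = (\<Sum>m<M. ennreal (2 powr (p * real m)) * emeasure \<rho> (?A m))"
    by (subst sum_ennreal[symmetric]) (auto simp: shell_mass_def emeasure_eq_measure ennreal_mult)
  also have "\<dots> = (\<Sum>m<M. \<integral>\<^sup>+ x. ennreal (2 powr (p * real m)) * indicator (?A m) x \<partial>\<rho>)"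
    by (intro sum.cong refl nn_integral_cmult_indicator[symmetric] shell_set)
  also have "\<dots> = (\<integral>\<^sup>+ x. (\<Sum>m<M. ennreal (2 powr (p * real m)) * indicator (?A m) x) \<partial>\<rho>)"
    by (intro nn_integral_sum[symmetric] borel_measurable_times_ennreal borel_measurable_const borel_measurable_indicator shell_set)
  also have "\<dots> \<le> (\<integral>\<^sup>+ x. ennreal (2 powr (p * real (shell R (norm_Rn k x)))) \<partial>\<rho>)"
  proof (intro nn_integral_mono)
    fix x
    have "(\<Sum>m<M. ennreal (2 powr (p * real m)) * indicator (?A m) x)
        \<le> (\<Sum>m\<in>{..<M}. if shell R (norm_Rn k x) = m then ennreal (2 powr (p * real m)) else 0)"
      by (intro sum_mono) (auto simp: indicator_def)
    also have "\<dots> \<le> ennreal (2 powr (p * real (shell R (norm_Rn k x))))"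
      by (simp add: sum.delta')
    finally show "(\<Sum>m<M. ennreal (2 powr (p * real m)) * indicator (?A m) x) \<le> ennreal (2 powr (p * real (shell R (norm_Rn k x))))" .
  qed
  also have "\<dots> \<le> ennreal (1 + 2 powr p)" by (rule nn_integral_shell_powr_le)
  finally show ?thesis by (subst (asm) ennreal_le_iff) simp_all
qed

lemma nn_integral_cell_cost_le:
  "(\<integral>\<^sup>+ x. ennreal (cell_cost p R L (shell R (norm_Rn k x))) \<partial>\<rho>)
    \<le> ennreal ((2 * R) powr p * (1 + 2 powr p) * 2 powr (- p * real L))"
proof -
  define c where "c = (2 * R) powr p * 2 powr (- p * real L)"
  have "(\<integral>\<^sup>+ x. ennreal (cell_cost p R L (shell R (norm_Rn k x))) \<partial>\<rho>)
      = (\<integral>\<^sup>+ x. ennreal c * ennreal (2 powr (p * real (shell R (norm_Rn k x)))) \<partial>\<rho>)"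
    by (intro nn_integral_cong) (simp add: cell_cost_eq[OF R] c_def mult_ac flip: ennreal_mult)
  also have "\<dots> = ennreal c * (\<integral>\<^sup>+ x. ennreal (2 powr (p * real (shell R (norm_Rn k x)))) \<partial>\<rho>)"
    by (rule nn_integral_cmult) (rule shell_fun_meas)
  also have "\<dots> \<le> ennreal c * ennreal (1 + 2 powr p)"
    by (intro mult_left_mono nn_integral_shell_powr_le) simp
  also have "\<dots> = ennreal (c * (1 + 2 powr p))"
    by (rule ennreal_mult[symmetric]) (simp_all add: c_def)
  also have "c * (1 + 2 powr p) = (2 * R) powr p * (1 + 2 powr p) * 2 powr (- p * real L)"
    by (simp only: c_def mult_ac)
  finally show ?thesis .
qed

text \<open>The index is shifted: mass gaps of the partition of level \<open>Suc l\<close> are moved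
  at the price of level \<open>l\<close>.\<close>

definition cell_mass :: "nat \<Rightarrow> nat \<times> int list \<Rightarrow> real" where
  "cell_mass l j = measure \<rho> {x \<in> space \<rho>. cell k R (Suc l) x = j}"

lemma cell_set: "{x \<in> space \<rho>. cell k R l x = j} \<in> sets \<rho>"
proof -
  have "cell k R l \<in> \<rho> \<rightarrow>\<^sub>M count_space UNIV"
    unfolding measurable_cong_sets[OF sets_rho refl] by (rule cell_measurable)
  from measurable_sets[OF this, of "{j}"] show ?thesis
    by (simp add: vimage_def Int_def conj_commute)
qed

lemma cell_mass_0:
  assumes "zs \<notin> l1_ball k (2 ^ l + 1)"
  shows "cell_mass l (m, zs) = 0"
proof -
  have "{x \<in> space \<rho>. cell k R (Suc l) x = (m, zs)} = {}"
    using assms grid_in_l1_ball[OF R _ le_shell[OF R norm_Rn_nonneg], of k _ l] k by (auto simp: cell_Suc)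
  then show ?thesis by (simp only: cell_mass_def measure_empty)
qed

lemma sum_cell_mass_le: "(\<Sum>zs\<in>l1_ball k S. cell_mass l (m, zs)) \<le> shell_mass m"
proof -
  have "(\<Sum>zs\<in>l1_ball k S. cell_mass l (m, zs))
      = measure \<rho> (\<Union>zs\<in>l1_ball k S. {x \<in> space \<rho>. cell k R (Suc l) x = (m, zs)})"
    unfolding cell_mass_def
    by (rule finite_measure_finite_Union[symmetric])
      (use cell_set finite_l1_ball in \<open>auto simp: disjoint_family_on_def\<close>)
  also have "\<dots> \<le> shell_mass m"
    unfolding shell_mass_def by (rule finite_measure_mono[OF _ shell_set]) (auto simp: cell_Suc)
  finally show ?thesis .
qed

text \<open>Labels outside the lattice ball have mass 0, so each shell contributes a finite sum;
  Cauchy-Schwarz over its labels yields the summand of \<open>level_sum\<close>.\<close>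

lemma cell_sum_le:
  assumes n: "1 \<le> n"
  shows "(\<integral>\<^sup>+ j. ennreal (cell_cost p R l (fst j)) * ennreal (2 * min (cell_mass l j) (sqrt (cell_mass l j / real n))) \<partial>count_space UNIV)
     \<le> (\<Sum>m. ennreal (2 * (2 * R) powr p * (2 powr (p * real m) *
            (2 powr (- p * real l) * min (shell_mass m) (sqrt ((15 * 2 ^ l) ^ k * shell_mass m / real n))))))"
    (is "_ \<le> (\<Sum>m. ennreal (?g m))")
proof -
  let ?B = "l1_ball k (2 ^ l + 1)"
  let ?M = "\<lambda>m. min (shell_mass m) (sqrt ((15 * 2 ^ l) ^ k * shell_mass m / real n))"
  define r where "r j = min (cell_mass l j) (sqrt (cell_mass l j / real n))" for j
  define f where "f j = ennreal (cell_cost p R l (fst j)) * ennreal (2 * r j)" for j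
  have nn: "0 \<le> r j" for j by (simp add: r_def cell_mass_def)
  have cc: "0 \<le> cell_cost p R l m" for m by (simp add: cell_cost_def)
  have "(\<integral>\<^sup>+ j. f j \<partial>count_space UNIV) = (\<integral>\<^sup>+ m. \<integral>\<^sup>+ zs. f (m, zs) \<partial>count_space UNIV \<partial>count_space UNIV)"
    by (rule nn_integral_fst_count_space[symmetric])
  also have "\<dots> = (\<Sum>m. \<integral>\<^sup>+ zs. f (m, zs) \<partial>count_space UNIV)"
    by (rule nn_integral_count_space_nat)
  also have "\<dots> \<le> (\<Sum>m. ennreal (?g m))"
  proof (intro suminf_le summableI)
    fix m
    have "(\<integral>\<^sup>+ zs. f (m, zs) \<partial>count_space UNIV) = (\<Sum>zs\<in>?B. f (m, zs))"
      by (rule nn_integral_count_space') (auto simp: finite_l1_ball f_def r_def cell_mass_0)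
    also have "\<dots> = (\<Sum>zs\<in>?B. ennreal (cell_cost p R l m * 2 * r (m, zs)))"
      unfolding f_def using nn cc by (intro sum.cong refl) (simp add: mult.assoc flip: ennreal_mult)
    also have "\<dots> = ennreal (\<Sum>zs\<in>?B. cell_cost p R l m * 2 * r (m, zs))"
      using nn cc by (intro sum_ennreal mult_nonneg_nonneg) auto
    also have "\<dots> = ennreal (cell_cost p R l m * 2 * (\<Sum>zs\<in>?B. r (m, zs)))"
      by (simp add: sum_distrib_left)
    also have "\<dots> \<le> ennreal (cell_cost p R l m * 2 * ?M m)"
    proof (intro ennreal_leI mult_left_mono)
      have "(\<Sum>zs\<in>?B. r (m, zs))
          \<le> min (\<Sum>zs\<in>?B. cell_mass l (m, zs)) (sqrt (real (card ?B) * (\<Sum>zs\<in>?B. cell_mass l (m, zs)) / real n))"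
        unfolding r_def using n by (intro sum_min_sqrt_le) (auto simp: cell_mass_def)
      also have "\<dots> \<le> ?M m"
        using card_cells_le[of k l]
        by (intro min.mono sum_cell_mass_le real_sqrt_le_mono divide_right_mono mult_mono)
          (auto simp: cell_mass_def intro!: sum_nonneg)
      finally show "(\<Sum>zs\<in>?B. r (m, zs))
          \<le> ?M m" .
    qed (use cc in simp)
    also have "\<dots> = ennreal (?g m)"
      by (simp add: cell_cost_eq[OF R] mult_ac)
    finally show "(\<integral>\<^sup>+ zs. f (m, zs) \<partial>count_space UNIV) \<le> ennreal (?g m)" .
  qed
  finally show ?thesis by (simp add: f_def r_def)
qed

text \<open>Exchanging levels and shells makes \<open>level_sum\<close> appear. The series over the
  shells is a supremum of partial sums, so a bound uniform in \<open>M\<close> is enough.\<close>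

lemma cell_sums_le:
  assumes n: "1 \<le> n"
    and B: "\<And>M. (\<Sum>m<M. 2 powr (p * real m) * level_sum p k n L (shell_mass m)) \<le> B"
  shows "(\<Sum>l<L. \<integral>\<^sup>+ j. ennreal (cell_cost p R l (fst j)) * ennreal (2 * min (cell_mass l j) (sqrt (cell_mass l j / real n))) \<partial>count_space UNIV)
     \<le> ennreal (2 * (2 * R) powr p * B)"
    (is "(\<Sum>l<L. \<integral>\<^sup>+ j. ?f l j \<partial>_) \<le> _")
proof -
  define g where "g l m = 2 * (2 * R) powr p * (2 powr (p * real m) *
            (2 powr (- p * real l) * min (shell_mass m) (sqrt ((15 * 2 ^ l) ^ k * shell_mass m / real n))))" for l m
  have g: "0 \<le> g l m" for l m using shell_mass_nonneg by (simp add: g_def)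
  have "(\<Sum>l<L. \<integral>\<^sup>+ j. ?f l j \<partial>count_space UNIV)
     \<le> (\<Sum>l<L. \<Sum>m. ennreal (g l m))"
    unfolding g_def by (intro sum_mono cell_sum_le n)
  also have "\<dots> = (\<Sum>m. \<Sum>l<L. ennreal (g l m))"
    by (rule suminf_sum[symmetric]) (rule summableI)
  also have "\<dots> = (\<Sum>m. ennreal (\<Sum>l<L. g l m))"
    using g by (simp add: sum_ennreal)
  also have "\<dots> \<le> ennreal (2 * (2 * R) powr p * B)"
    unfolding suminf_eq_SUP
  proof (rule SUP_least)
    fix M
    have "(\<Sum>m<M. ennreal (\<Sum>l<L. g l m)) = ennreal (\<Sum>m<M. \<Sum>l<L. g l m)"
      using g by (intro sum_ennreal sum_nonneg)
    also have "(\<Sum>m<M. \<Sum>l<L. g l m) = 2 * (2 * R) powr p * (\<Sum>m<M. 2 powr (p * real m) * level_sum p k n L (shell_mass m))"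
      by (simp add: g_def level_sum_def sum_distrib_left)
    also have "ennreal \<dots> \<le> ennreal (2 * (2 * R) powr p * B)"
      by (intro ennreal_leI mult_left_mono B) simp
    finally show "(\<Sum>m<M. ennreal (\<Sum>l<L. g l m)) \<le> ennreal (2 * (2 * R) powr p * B)" .
  qed
  finally show ?thesis .
qed

end

text \<open>A countable count space is sigma-finite, so the sum over labels is a partial integral of
  a jointly measurable function.\<close>

lemma borel_measurable_nn_integral_count_space:
  fixes f :: "'a \<Rightarrow> 'c::countable \<Rightarrow> ennreal"
  assumes "\<And>j. (\<lambda>x. f x j) \<in> borel_measurable M"
  shows "(\<lambda>x. \<integral>\<^sup>+ j. f x j \<partial>count_space UNIV) \<in> borel_measurable M"
proof -
  interpret sigma_finite_measure "count_space UNIV :: 'c measure"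
    by (rule sigma_finite_measure_count_space_countable) simp
  have "(\<lambda>z. f (snd z) (fst z)) \<in> borel_measurable (count_space UNIV \<Otimes>\<^sub>M M)"
    by (rule measurable_pair_measure_countable1) (simp_all add: assms)
  from measurable_pair_swap[OF this]
  have "(\<lambda>(x, j). f x j) \<in> borel_measurable (M \<Otimes>\<^sub>M count_space UNIV)"
    by (simp add: case_prod_unfold)
  then show ?thesis by (rule borel_measurable_nn_integral)
qed

section \<open>Expectation of the multiscale bound\<close>

abbreviation expected_bound ::
  "nat \<Rightarrow> real \<Rightarrow> real \<Rightarrow> nat \<Rightarrow> nat \<Rightarrow> (nat \<Rightarrow> real) measure \<Rightarrow> 'w measure \<Rightarrow> (nat \<Rightarrow> 'w \<Rightarrow> nat \<Rightarrow> real) \<Rightarrow> ennreal"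
  where
  "expected_bound k p R L n \<rho> P Y \<equiv>
     (\<integral>\<^sup>+ \<omega>. multiscale_bound k p R L (empirical k n (\<lambda>i. Y i \<omega>)) \<rho> \<partial>P)"

text \<open>Depth \<open>n\<close> makes the remainder exponentially small. Comparing it with
  \<open>1 / n\<close> suffices, since \<open>p * rate_exponent p q k\<close> is at most 1.\<close>

lemma two_powr_neg_le_rate:
  assumes p: "1 \<le> p" and n: "1 \<le> n"
  shows "2 powr (- p * real n) \<le> real n powr (- (p * rate_exponent p q k))"
proof -
  have "rate_exponent p q k \<le> 1 / max (2 * p) (real k)" by (simp add: rate_exponent_def)
  also have "\<dots> \<le> 1 / (2 * p)" using p by (intro divide_left_mono) auto
  finally have "p * rate_exponent p q k \<le> p * (1 / (2 * p))" using p by (intro mult_left_mono) auto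
  also have "\<dots> \<le> 1" using p by simp
  finally have r: "p * rate_exponent p q k \<le> 1" .
  have "2 powr (- p * real n) \<le> 2 powr (- real n)" using p n by simp
  also have "\<dots> = 1 / 2 ^ n" by (simp add: powr_minus_divide powr_realpow)
  also have "\<dots> \<le> 1 / real n"
    using n of_nat_less_two_power[of n, where 'a=real] by (intro divide_left_mono) auto
  also have "\<dots> = real n powr (- 1)" using n by (simp add: powr_minus_divide)
  also have "\<dots> \<le> real n powr (- (p * rate_exponent p q k))"
    using n r by (intro powr_mono) auto
  finally show ?thesis .
qed

lemma log_factor_powr_ge_1: "1 \<le> log_factor n powr log_exponent p q k"
  using log_factor_ge_1[of n] by (intro ge_one_powr_ge_zero) (auto simp: log_exponent_def)

lemma cell_set_borel: "{x \<in> space (borel_Rn k). cell k R l x = j} \<in> sets (borel_Rn k)"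
  using measurable_sets[OF cell_measurable[of k R l], of "{j}"]
  by (simp add: vimage_def Int_def conj_commute)

lemma cell_cost_fun_measurable:
  "(\<lambda>x. ennreal (cell_cost p R L (shell R (norm_Rn k x)))) \<in> borel_measurable (borel_Rn k)"
  by (rule measurable_compose[OF shell_measurable]) simp

lemma emeasure_empirical_cell:
  assumes "1 \<le> n"
  shows "emeasure (empirical k n y) {x \<in> space (empirical k n y). cell k R l x = j}
       = ennreal ((\<Sum>i=1..n. indicator {x \<in> space (borel_Rn k). cell k R l x = j} (y i)) / real n)"
  unfolding space_empirical by (rule emeasure_empirical_real[OF cell_set_borel assms])

text \<open>The mass gaps are deviations of frequencies, whose expectations are bounded cell by
  cell. The remainder counts twice because the expected remainder of the empirical measure is that
  of \<rho>.\<close>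

lemma expected_multiscale_bound_le:
  fixes P :: "'w measure"
  assumes pq: "1 \<le> p" "p \<le> q" and R: "0 < R" and k: "1 \<le> k" and n: "1 \<le> n"
    and \<rho>: "\<rho> \<in> prob_Rn k" and mom: "moment k q \<rho> \<le> ennreal (R powr q)"
    and Y: "iid_sample P k \<rho> n Y"
    and B: "\<And>M. (\<Sum>m<M. 2 powr (p * real m) * level_sum p k n L (shell_mass k R \<rho> m)) \<le> B"
  shows "expected_bound k p R L n \<rho> P Y
     \<le> ennreal (2 * (2 * R) powr p * B) + 2 * ennreal ((2 * R) powr p * (1 + 2 powr p) * 2 powr (- p * real L))"
proof -
  interpret P: prob_space P using Y by (simp add: iid_sample_def)
  interpret \<rho>: prob_space \<rho> using \<rho> by (simp add: prob_Rn_def)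
  have sets_rho: "sets \<rho> = sets (borel_Rn k)" using \<rho> by (simp add: prob_Rn_def)
  then have space_rho: "space \<rho> = space (borel_Rn k)" by (rule sets_eq_imp_space_eq)
  have indep: "P.indep_vars (\<lambda>_. borel_Rn k) Y {1..n}"
    and dist: "\<And>i. i \<in> {1..n} \<Longrightarrow> distr P (borel_Rn k) (Y i) = \<rho>"
    using Y by (auto simp: iid_sample_def)
  have Ym: "Y i \<in> P \<rightarrow>\<^sub>M borel_Rn k" if "i \<in> {1..n}" for i
    using indep that by (simp add: P.indep_vars_def2)
  define A where "A l j = {x \<in> space (borel_Rn k). cell k R (Suc l) x = j}" for l j
  have A: "A l j \<in> sets (borel_Rn k)" for l j unfolding A_def by (rule cell_set_borel)
  define c where "c l j = cell_mass k R \<rho> l j" for l j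
  have c: "measure \<rho> (A l j) = c l j" for l j
    unfolding c_def cell_mass_def[OF pq R k \<rho> mom] A_def space_rho ..
  define W where "W l j \<omega> = \<bar>(\<Sum>i=1..n. indicator (A l j) (Y i \<omega>)) / real n - c l j\<bar>" for l j \<omega>
  define M where "M l j = 2 * min (c l j) (sqrt (c l j / real n))" for l j
  have prob_c: "P.prob (Y i -` A l j \<inter> space P) = c l j" if "i \<in> {1..n}" for i l j
    using measure_distr[OF Ym[OF that] A[of l j]] dist[OF that] c by simp
  have int_W: "integrable P (W l j)" for l j
    unfolding W_def[abs_def] by (rule P.frequency_deviation_le(1)[OF indep n A prob_c])
  have EW: "P.expectation (W l j) \<le> M l j" for l j
    unfolding W_def[abs_def] M_def by (rule P.frequency_deviation_le(2)[OF indep n A prob_c])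
  have Wm: "W l j \<in> borel_measurable P" for l j using int_W by (rule borel_measurable_integrable)
  have nnW: "(\<integral>\<^sup>+ \<omega>. ennreal (W l j \<omega>) \<partial>P) \<le> ennreal (M l j)" for l j
  proof -
    have "(\<integral>\<^sup>+ \<omega>. ennreal (W l j \<omega>) \<partial>P) = ennreal (P.expectation (W l j))"
      by (rule nn_integral_eq_integral[OF int_W]) (simp add: W_def)
    then show ?thesis using EW[of l j] by (simp add: ennreal_leI)
  qed
  define e where "e x = ennreal (cell_cost p R L (shell R (norm_Rn k x)))" for x
  have em: "e \<in> borel_measurable (borel_Rn k)"
    unfolding e_def[abs_def] by (rule cell_cost_fun_measurable)
  define K where "K = (\<integral>\<^sup>+ x. e x \<partial>\<rho>)"
  have K: "K \<le> ennreal ((2 * R) powr p * (1 + 2 powr p) * 2 powr (- p * real L))"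
    unfolding K_def e_def by (rule nn_integral_cell_cost_le[OF pq R k \<rho> mom])
  define G where "G l \<omega> = (\<integral>\<^sup>+ j. ennreal (cell_cost p R l (fst j)) * ennreal (W l j \<omega>) \<partial>count_space UNIV)" for l \<omega>
  have eYm: "(\<lambda>\<omega>. e (Y i \<omega>)) \<in> borel_measurable P" if "i \<in> {1..n}" for i
    using measurable_compose[OF Ym[OF that] em] .
  let ?J = "\<lambda>\<omega>. (\<Sum>i=1..n. e (Y i \<omega>)) / of_nat n"
  have Jm: "?J \<in> borel_measurable P"
    by (intro borel_measurable_divide_ennreal borel_measurable_sum eYm borel_measurable_const)
  \<comment> \<open>For a fixed outcome the mass gaps are the deviations \<open>W\<close>, and in
    this form measurability in \<open>\<omega>\<close> follows from that of the sample.\<close>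
  have eq: "multiscale_bound k p R L (empirical k n (\<lambda>i. Y i \<omega>)) \<rho>
      = (\<Sum>l<L. G l \<omega>) + (?J \<omega> + K)" if \<omega>: "\<omega> \<in> space P" for \<omega>
  proof -
    have Ys: "Y i \<omega> \<in> space (borel_Rn k)" if "i \<in> {1..n}" for i
      using measurable_space[OF Ym[OF that] \<omega>] .
    have "mass_gap (empirical k n (\<lambda>i. Y i \<omega>)) \<rho> (cell k R (Suc l)) j = ennreal (W l j \<omega>)" for l j
    proof -
      have 1: "emeasure \<rho> {x \<in> space \<rho>. cell k R (Suc l) x = j} = ennreal (c l j)"
        unfolding c_def cell_mass_def[OF pq R k \<rho> mom] by (rule \<rho>.emeasure_eq_measure)
      have 2: "0 \<le> (\<Sum>i=1..n. indicator (A l j) (Y i \<omega>)) / real n"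
        by (intro divide_nonneg_nonneg sum_nonneg) auto
      have 3: "0 \<le> c l j" unfolding c[symmetric] by simp
      show ?thesis
        unfolding mass_gap_def emeasure_empirical_cell[OF n] 1 A_def[symmetric] ennreal_gap_eq[OF 2 3] W_def ..
    qed
    moreover have "(\<integral>\<^sup>+ x. e x \<partial>empirical k n (\<lambda>i. Y i \<omega>)) = ?J \<omega>"
      by (rule nn_integral_empirical[OF n Ys em])
    ultimately show ?thesis
      unfolding multiscale_bound_def G_def K_def e_def by simp
  qed
  have Gm: "G l \<in> borel_measurable P" for l
    unfolding G_def[abs_def]
    using Wm by (intro borel_measurable_nn_integral_count_space borel_measurable_times_ennreal borel_measurable_const) simp
  have "expected_bound k p R L n \<rho> P Y
      = (\<integral>\<^sup>+ \<omega>. (\<Sum>l<L. G l \<omega>) + (?J \<omega> + K) \<partial>P)"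
    by (rule nn_integral_cong) (rule eq)
  also have "\<dots> = (\<integral>\<^sup>+ \<omega>. (\<Sum>l<L. G l \<omega>) \<partial>P) + (\<integral>\<^sup>+ \<omega>. ?J \<omega> + K \<partial>P)"
    by (rule nn_integral_add) (intro borel_measurable_sum Gm borel_measurable_add Jm borel_measurable_const)+
  also have "(\<integral>\<^sup>+ \<omega>. ?J \<omega> + K \<partial>P)
      = (\<integral>\<^sup>+ \<omega>. ?J \<omega> \<partial>P) + K"
    using Jm by (subst nn_integral_add) (auto simp: P.emeasure_space_1)
  also have "(\<integral>\<^sup>+ \<omega>. ?J \<omega> \<partial>P) = K"
  proof -
    have "(\<integral>\<^sup>+ \<omega>. ?J \<omega> \<partial>P) = (\<integral>\<^sup>+ \<omega>. (\<Sum>i=1..n. e (Y i \<omega>)) \<partial>P) / of_nat n"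
      by (rule nn_integral_divide) (intro borel_measurable_sum eYm)
    also have "(\<integral>\<^sup>+ \<omega>. (\<Sum>i=1..n. e (Y i \<omega>)) \<partial>P) = (\<Sum>i=1..n. \<integral>\<^sup>+ \<omega>. e (Y i \<omega>) \<partial>P)"
      by (rule nn_integral_sum) (rule eYm)
    also have "\<dots> = (\<Sum>i=1..n. K)"
    proof (rule sum.cong[OF refl])
      fix i assume i: "i \<in> {1..n}"
      have "(\<integral>\<^sup>+ \<omega>. e (Y i \<omega>) \<partial>P) = (\<integral>\<^sup>+ x. e x \<partial>distr P (borel_Rn k) (Y i))"
        by (rule nn_integral_distr[OF Ym[OF i], symmetric]) (simp only: measurable_distr_eq1 em)
      then show "(\<integral>\<^sup>+ \<omega>. e (Y i \<omega>) \<partial>P) = K" unfolding dist[OF i] K_def .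
    qed
    also have "\<dots> / of_nat n = K"
    proof -
      have "of_nat n * K / of_nat n = K"
        using n by (simp add: mult.commute[of "of_nat n"] ennreal_mult_divide_eq ennreal_of_nat_neq_top)
      then show ?thesis by simp
    qed
    finally show ?thesis .
  qed
  also have "(\<integral>\<^sup>+ \<omega>. (\<Sum>l<L. G l \<omega>) \<partial>P) = (\<Sum>l<L. \<integral>\<^sup>+ \<omega>. G l \<omega> \<partial>P)"
    by (rule nn_integral_sum) (rule Gm)
  also have "\<dots> \<le> (\<Sum>l<L. \<integral>\<^sup>+ j. ennreal (cell_cost p R l (fst j)) * ennreal (M l j) \<partial>count_space UNIV)"
  proof (rule sum_mono)
    fix l
    have m: "(\<lambda>\<omega>. ennreal (W l j \<omega>)) \<in> borel_measurable P" for j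
      using Wm[of l j] by simp
    have "(\<integral>\<^sup>+ \<omega>. G l \<omega> \<partial>P) = (\<integral>\<^sup>+ j. \<integral>\<^sup>+ \<omega>. ennreal (cell_cost p R l (fst j)) * ennreal (W l j \<omega>) \<partial>P \<partial>count_space UNIV)"
      unfolding G_def by (rule nn_integral_count_space_nn_integral) (simp, intro borel_measurable_times_ennreal borel_measurable_const m)
    also have "\<dots> = (\<integral>\<^sup>+ j. ennreal (cell_cost p R l (fst j)) * (\<integral>\<^sup>+ \<omega>. ennreal (W l j \<omega>) \<partial>P) \<partial>count_space UNIV)"
      by (intro nn_integral_cong nn_integral_cmult m)
    also have "\<dots> \<le> (\<integral>\<^sup>+ j. ennreal (cell_cost p R l (fst j)) * ennreal (M l j) \<partial>count_space UNIV)"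
      by (intro nn_integral_mono mult_left_mono nnW) simp
    finally show "(\<integral>\<^sup>+ \<omega>. G l \<omega> \<partial>P) \<le> (\<integral>\<^sup>+ j. ennreal (cell_cost p R l (fst j)) * ennreal (M l j) \<partial>count_space UNIV)" .
  qed
  also have "\<dots> \<le> ennreal (2 * (2 * R) powr p * B)"
    unfolding M_def c_def by (rule cell_sums_le[OF pq R k \<rho> mom n B])
  finally have "expected_bound k p R L n \<rho> P Y
      \<le> ennreal (2 * (2 * R) powr p * B) + (K + K)"
    by (simp add: add_right_mono)
  also have "\<dots> \<le> ennreal (2 * (2 * R) powr p * B) + 2 * ennreal ((2 * R) powr p * (1 + 2 powr p) * 2 powr (- p * real L))"
    using add_mono[OF K K] by (intro add_left_mono) (simp only: mult_2)
  finally show ?thesis .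
qed

text \<open>The depth is set to \<open>n\<close>, which absorbs the remainder into the rate. The
  constant precedes \<open>k\<close>, \<open>R\<close> and \<rho> so that it applies to every
  projection at once.\<close>

lemma expected_multiscale_bound_rate:
  fixes p q :: real
  assumes pq: "1 \<le> p" "p \<le> q"
  shows "\<exists>C>0. \<forall>k n R \<rho> (P :: 'w measure) Y. 1 \<le> k \<longrightarrow> 1 \<le> n \<longrightarrow> 0 < R \<longrightarrow> \<rho> \<in> prob_Rn k \<longrightarrow>
      moment k q \<rho> \<le> ennreal (R powr q) \<longrightarrow> iid_sample P k \<rho> n Y \<longrightarrow>
      expected_bound k p R n n \<rho> P Y
        \<le> ennreal (C * R powr p * real n powr (- (p * rate_exponent p q k)) * log_factor n powr log_exponent p q k)"
proof -
  obtain C0 where C0: "0 < C0" and ms: "\<And>k n M L (a :: nat \<Rightarrow> real). 1 \<le> k \<Longrightarrow> 1 \<le> n \<Longrightarrow>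
      (\<And>m. 0 \<le> a m \<and> a m \<le> 2 powr q * 2 powr (- q * real m)) \<Longrightarrow>
      (\<Sum>m<M. 2 powr (p * real m) * a m) \<le> 1 + 2 powr p \<Longrightarrow>
      (\<Sum>m<M. 2 powr (p * real m) * level_sum p k n L (a m))
        \<le> C0 * real n powr (- (p * rate_exponent p q k)) * log_factor n powr log_exponent p q k"
    using multiscale_sum_bound[OF pq] by blast
  define C where "C = 2 powr p * (2 * C0 + 2 * (1 + 2 powr p))"
  have D: "0 < 1 + (2::real) powr p" by (simp add: add_pos_nonneg)
  show ?thesis
  proof (intro exI[of _ C] conjI allI impI)
    show "0 < C" unfolding C_def using C0 D by (intro mult_pos_pos add_pos_pos) auto
    fix k n :: nat and R :: real and \<rho> and P :: "'w measure" and Y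
    assume k: "1 \<le> k" and n: "1 \<le> n" and R: "0 < R" and \<rho>: "\<rho> \<in> prob_Rn k"
      and mom: "moment k q \<rho> \<le> ennreal (R powr q)" and Y: "iid_sample P k \<rho> n Y"
    define E where "E = real n powr (- (p * rate_exponent p q k)) * log_factor n powr log_exponent p q k"
    have E: "0 \<le> E" by (simp add: E_def)
    have "(\<Sum>m<M. 2 powr (p * real m) * level_sum p k n n (shell_mass k R \<rho> m)) \<le> C0 * E" for M
      unfolding E_def mult.assoc[symmetric]
      by (rule ms[OF k n])
        (intro conjI shell_mass_nonneg[OF pq R k \<rho> mom] shell_mass_le[OF pq R k \<rho> mom] sum_shell_mass_le[OF pq R k \<rho> mom])+
    from expected_multiscale_bound_le[OF pq R k n \<rho> mom Y this]
    have "expected_bound k p R n n \<rho> P Y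
      \<le> ennreal (2 * (2 * R) powr p * (C0 * E)) + 2 * ennreal ((2 * R) powr p * (1 + 2 powr p) * 2 powr (- p * real n))" .
    also have "\<dots> \<le> ennreal (2 * (2 * R) powr p * (C0 * E)) + 2 * ennreal ((2 * R) powr p * (1 + 2 powr p) * E)"
    proof (intro add_left_mono mult_left_mono ennreal_leI)
      have "2 powr (- p * real n) \<le> real n powr (- (p * rate_exponent p q k)) * 1"
        using two_powr_neg_le_rate[OF pq(1) n] by simp
      also have "\<dots> \<le> E" unfolding E_def by (intro mult_left_mono log_factor_powr_ge_1) simp
      finally show "2 powr (- p * real n) \<le> E" .
    qed (use D in auto)
    also have "\<dots> = ennreal (2 * (2 * R) powr p * (C0 * E) + 2 * ((2 * R) powr p * (1 + 2 powr p) * E))"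
    proof -
      have "0 \<le> 2 * (2 * R) powr p * (C0 * E)" "0 \<le> (2 * R) powr p * (1 + 2 powr p) * E"
        using C0 E D by (auto intro!: mult_nonneg_nonneg)
      then show ?thesis by (simp only: mult_2[of "ennreal _"] mult_2[of "_ * E"] ennreal_plus[symmetric] add_nonneg_nonneg)
    qed
    also have "2 * (2 * R) powr p * (C0 * E) + 2 * ((2 * R) powr p * (1 + 2 powr p) * E) = C * R powr p * E"
      using R by (simp add: C_def powr_mult algebra_simps)
    finally show "expected_bound k p R n n \<rho> P Y
        \<le> ennreal (C * R powr p * real n powr (- (p * rate_exponent p q k)) * log_factor n powr log_exponent p q k)"
      by (simp add: E_def mult.assoc)
  qed
qed

section \<open>Projections\<close>

lemma transpose_apply_measurable:
  "(\<lambda>z. transpose_apply d k (fst z) (snd z)) \<in> borel_mat d k \<Otimes>\<^sub>M borel_Rn d \<rightarrow>\<^sub>M borel_Rn k"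
  unfolding transpose_apply_def
proof (rule measurable_restrict)
  fix j assume j: "j \<in> {..<k}"
  show "(\<lambda>z. \<Sum>i<d. fst z (i, j) * snd z i) \<in> borel_measurable (borel_mat d k \<Otimes>\<^sub>M borel_Rn d)"
  proof (intro borel_measurable_sum borel_measurable_times)
    fix i assume i: "i \<in> {..<d}"
    show "(\<lambda>z. fst z (i, j)) \<in> borel_measurable (borel_mat d k \<Otimes>\<^sub>M borel_Rn d)"
      using i j by (intro measurable_compose[OF measurable_fst measurable_component_singleton]) auto
    show "(\<lambda>z. snd z i) \<in> borel_measurable (borel_mat d k \<Otimes>\<^sub>M borel_Rn d)"
      using i by (intro measurable_compose[OF measurable_snd measurable_component_singleton])
  qed
qed

lemma transpose_apply_measurable2:
  assumes "E \<in> space (borel_mat d k)"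
  shows "transpose_apply d k E \<in> borel_Rn d \<rightarrow>\<^sub>M borel_Rn k"
  using measurable_compose_Pair1[OF assms transpose_apply_measurable] by simp

text \<open>Bessel's inequality: with \<open>y\<close> the image of \<open>x\<close>, the squared
  distance from \<open>x\<close> to \<open>E y\<close> is nonnegative and equals the difference of
  the squared norms of \<open>x\<close> and \<open>y\<close>.\<close>

lemma norm_transpose_apply_le:
  assumes E: "E \<in> stiefel d k"
  shows "norm_Rn k (transpose_apply d k E x) \<le> norm_Rn d x"
proof -
  define y where "y j = (\<Sum>i<d. E (i, j) * x i)" for j
  have orth: "(\<Sum>i<d. E (i, a) * E (i, b)) = (if a = b then 1 else 0)" if "a < k" "b < k" for a b
    using E that by (auto simp: stiefel_def)
  have mid: "(\<Sum>i<d. x i * (\<Sum>j<k. E (i, j) * y j)) = (\<Sum>j<k. (y j)\<^sup>2)"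
  proof -
    have "(\<Sum>i<d. x i * (\<Sum>j<k. E (i, j) * y j)) = (\<Sum>i<d. \<Sum>j<k. y j * (E (i, j) * x i))"
      by (simp add: sum_distrib_left mult_ac)
    also have "\<dots> = (\<Sum>j<k. \<Sum>i<d. y j * (E (i, j) * x i))" by (rule sum.swap)
    also have "\<dots> = (\<Sum>j<k. (y j)\<^sup>2)"
      by (simp add: y_def power2_eq_square flip: sum_distrib_left)
    finally show ?thesis .
  qed
  have last: "(\<Sum>i<d. (\<Sum>j<k. E (i, j) * y j)\<^sup>2) = (\<Sum>j<k. (y j)\<^sup>2)"
  proof -
    have "(\<Sum>i<d. (\<Sum>j<k. E (i, j) * y j)\<^sup>2) = (\<Sum>i<d. \<Sum>a<k. \<Sum>b<k. y a * y b * (E (i, a) * E (i, b)))"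
      by (simp add: power2_eq_square sum_product mult_ac)
    also have "\<dots> = (\<Sum>a<k. \<Sum>i<d. \<Sum>b<k. y a * y b * (E (i, a) * E (i, b)))" by (rule sum.swap)
    also have "\<dots> = (\<Sum>a<k. \<Sum>b<k. \<Sum>i<d. y a * y b * (E (i, a) * E (i, b)))"
      by (intro sum.cong refl sum.swap)
    also have "\<dots> = (\<Sum>a<k. \<Sum>b<k. y a * y b * (if a = b then 1 else 0))"
      by (intro sum.cong refl) (simp add: orth flip: sum_distrib_left)
    also have "\<dots> = (\<Sum>j<k. (y j)\<^sup>2)"
      by (simp add: power2_eq_square if_distrib[of "\<lambda>t. _ * t"] cong: if_cong)
    finally show ?thesis .
  qed
  have "0 \<le> (\<Sum>i<d. (x i - (\<Sum>j<k. E (i, j) * y j))\<^sup>2)" by (intro sum_nonneg) simp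
  also have "\<dots> = (\<Sum>i<d. (x i)\<^sup>2) - 2 * (\<Sum>i<d. x i * (\<Sum>j<k. E (i, j) * y j)) + (\<Sum>i<d. (\<Sum>j<k. E (i, j) * y j)\<^sup>2)"
    unfolding power2_diff by (simp add: sum.distrib sum_subtractf sum_distrib_left mult.assoc)
  finally have "(\<Sum>j<k. (y j)\<^sup>2) \<le> (\<Sum>i<d. (x i)\<^sup>2)" unfolding mid last by simp
  moreover have "(\<Sum>j<k. (transpose_apply d k E x j)\<^sup>2) = (\<Sum>j<k. (y j)\<^sup>2)"
    by (simp add: transpose_apply_def y_def)
  ultimately show ?thesis by (simp add: norm_Rn_def L2_set_def)
qed

section \<open>Jensen's inequality and a majorant that is measurable in the frame\<close>

lemma epowr_mono: "x \<le> y \<Longrightarrow> 0 \<le> r \<Longrightarrow> epowr x r \<le> epowr y r"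
  by (auto simp: epowr_def top_unique less_top intro!: ennreal_leI powr_mono2 enn2real_mono)

text \<open>The tangent of \<open>t powr (1 / p)\<close> at \<open>B\<close> lies above the graph.\<close>

lemma (in prob_space) nn_integral_epowr_le:
  assumes g: "g \<in> borel_measurable M" and p: "1 \<le> p" and B: "0 < B"
    and le: "(\<integral>\<^sup>+ x. g x \<partial>M) \<le> ennreal B"
  shows "(\<integral>\<^sup>+ x. epowr (g x) (1 / p) \<partial>M) \<le> ennreal (B powr (1 / p))"
proof -
  define a where "a = B powr (1 / p) * (1 - 1 / p)"
  define b where "b = B powr (1 / p) * (1 / p) / B"
  have a: "0 \<le> a" using p by (simp add: a_def)
  have b: "0 < b" using p B by (simp add: b_def)
  have "(\<integral>\<^sup>+ x. epowr (g x) (1 / p) \<partial>M) \<le> (\<integral>\<^sup>+ x. ennreal a + ennreal b * g x \<partial>M)"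
  proof (intro nn_integral_mono)
    fix x
    show "epowr (g x) (1 / p) \<le> ennreal a + ennreal b * g x"
    proof (cases "g x = \<top>")
      case True
      then show ?thesis using b by (simp add: ennreal_mult_top)
    next
      case False
      then obtain u where u: "g x = ennreal u" "0 \<le> u" by (cases "g x") auto
      have "u powr (1 / p) = B powr (1 / p) * (u / B) powr (1 / p)"
        using B u by (simp add: powr_divide)
      also have "\<dots> \<le> B powr (1 / p) * ((1 - 1 / p) + 1 / p * (u / B))"
        using p B u by (intro mult_left_mono powr_le_affine) auto
      also have "\<dots> = a + b * u" by (simp add: a_def b_def distrib_left)
      finally have "ennreal (u powr (1 / p)) \<le> ennreal (a + b * u)" by (rule ennreal_leI)
      also have "\<dots> = ennreal a + ennreal b * ennreal u"
        using a b u by (simp add: ennreal_mult)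
      finally show ?thesis using u by (simp add: epowr_def)
    qed
  qed
  also have "\<dots> = ennreal a + ennreal b * (\<integral>\<^sup>+ x. g x \<partial>M)"
    using g by (subst nn_integral_add) (auto simp: nn_integral_cmult emeasure_space_1)
  also have "\<dots> \<le> ennreal a + ennreal b * ennreal B"
    by (intro add_left_mono mult_left_mono le) simp
  also have "\<dots> = ennreal (a + b * B)" using a b B by (simp add: ennreal_mult)
  also have "a + b * B = B powr (1 / p)"
    using B by (simp add: a_def b_def algebra_simps)
  finally show ?thesis .
qed

text \<open>\<open>multiscale_bound\<close> is written out so that its joint measurability in the matrix and the sample can be
  read off; the distance itself need not be measurable in the matrix.\<close>

definition projected_bound ::
  "nat \<Rightarrow> nat \<Rightarrow> real \<Rightarrow> real \<Rightarrow> nat \<Rightarrow> (nat \<Rightarrow> real) measure \<Rightarrow> (nat \<times> nat \<Rightarrow> real) \<Rightarrow> (nat \<Rightarrow> nat \<Rightarrow> real) \<Rightarrow> ennreal"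
  where
  "projected_bound d k p R n \<mu> E x =
    (let frq = (\<lambda>l j. (\<Sum>i=1..n. indicator {j} (cell k R (Suc l) (transpose_apply d k E (x i)))) / of_nat n);
         mass = (\<lambda>l j. \<integral>\<^sup>+ y. indicator {j} (cell k R (Suc l) (transpose_apply d k E y)) \<partial>\<mu>);
         e = (\<lambda>y. ennreal (cell_cost p R n (shell R (norm_Rn k (transpose_apply d k E y)))))
     in (\<Sum>l<n. \<integral>\<^sup>+ j. ennreal (cell_cost p R l (fst j)) * ((frq l j - mass l j) + (mass l j - frq l j)) \<partial>count_space UNIV)
        + ((\<Sum>i=1..n. e (x i)) / of_nat n + (\<integral>\<^sup>+ y. e y \<partial>\<mu>)))"

text \<open>A change of variables on both measures moves the frame from the measures into the
  integrands.\<close>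

lemma multiscale_bound_projected:
  assumes n: "1 \<le> n" and E: "E \<in> stiefel d k" and \<mu>: "\<mu> \<in> prob_Rn d"
    and x: "\<And>i. i \<in> {1..n} \<Longrightarrow> x i \<in> space (borel_Rn d)"
  shows "multiscale_bound k p R n (empirical k n (\<lambda>i. transpose_apply d k E (x i)))
           (distr \<mu> (borel_Rn k) (transpose_apply d k E)) = projected_bound d k p R n \<mu> E x"
proof -
  let ?T = "transpose_apply d k E"
  let ?N = "empirical k n (\<lambda>i. ?T (x i))" and ?D = "distr \<mu> (borel_Rn k) ?T"
  let ?A = "\<lambda>l j. {y \<in> space (borel_Rn k). cell k R (Suc l) y = j}"
  have "E \<in> space (borel_mat d k)" using E by (simp add: stiefel_def)
  then have T': "?T \<in> borel_Rn d \<rightarrow>\<^sub>M borel_Rn k" by (rule transpose_apply_measurable2)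
  have sets_mu: "sets \<mu> = sets (borel_Rn d)" using \<mu> by (simp add: prob_Rn_def)
  then have space_mu: "space \<mu> = space (borel_Rn d)" by (rule sets_eq_imp_space_eq)
  have T: "?T \<in> \<mu> \<rightarrow>\<^sub>M borel_Rn k"
    using T' unfolding measurable_cong_sets[OF sets_mu refl] .
  have Tx: "?T (x i) \<in> space (borel_Rn k)" if "i \<in> {1..n}" for i
    using measurable_space[OF T' x[OF that]] .
  have 1: "emeasure ?N {y \<in> space ?N. cell k R (Suc l) y = j}
      = (\<Sum>i=1..n. indicator {j} (cell k R (Suc l) (?T (x i)))) / of_nat n" for l j
  proof -
    have "emeasure ?N {y \<in> space ?N. cell k R (Suc l) y = j}
        = (\<Sum>i=1..n. indicator (?A l j) (?T (x i))) / of_nat n"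
      unfolding space_empirical using cell_set_borel[of k R "Suc l" j] by (simp add: emeasure_empirical)
    also have "(\<Sum>i=1..n. indicator (?A l j) (?T (x i)) :: ennreal)
        = (\<Sum>i=1..n. indicator {j} (cell k R (Suc l) (?T (x i))))"
      using Tx by (intro sum.cong refl) (auto simp: indicator_def)
    finally show ?thesis .
  qed
  have 2: "emeasure ?D {y \<in> space ?D. cell k R (Suc l) y = j}
      = (\<integral>\<^sup>+ y. indicator {j} (cell k R (Suc l) (?T y)) \<partial>\<mu>)" for l j
  proof -
    have "emeasure ?D {y \<in> space ?D. cell k R (Suc l) y = j}
        = emeasure \<mu> (?T -` (?A l j) \<inter> space \<mu>)"
      unfolding space_distr by (rule emeasure_distr[OF T cell_set_borel])
    also have "\<dots> = (\<integral>\<^sup>+ y. indicator (?T -` (?A l j) \<inter> space \<mu>) y \<partial>\<mu>)"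
      by (rule nn_integral_indicator[symmetric]) (rule measurable_sets[OF T cell_set_borel])
    also have "\<dots> = (\<integral>\<^sup>+ y. indicator {j} (cell k R (Suc l) (?T y)) \<partial>\<mu>)"
      using measurable_space[OF T] by (intro nn_integral_cong) (auto simp: indicator_def)
    finally show ?thesis .
  qed
  have 3: "(\<integral>\<^sup>+ y. ennreal (cell_cost p R n (shell R (norm_Rn k y))) \<partial>?N)
      = (\<Sum>i=1..n. ennreal (cell_cost p R n (shell R (norm_Rn k (?T (x i)))))) / of_nat n"
    by (rule nn_integral_empirical[OF n Tx cell_cost_fun_measurable])
  have 4: "(\<integral>\<^sup>+ y. ennreal (cell_cost p R n (shell R (norm_Rn k y))) \<partial>?D)
      = (\<integral>\<^sup>+ y. ennreal (cell_cost p R n (shell R (norm_Rn k (?T y)))) \<partial>\<mu>)"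
    by (rule nn_integral_distr[OF T]) (simp only: measurable_distr_eq1 cell_cost_fun_measurable)
  show ?thesis
    unfolding multiscale_bound_def mass_gap_def projected_bound_def Let_def 1 2 3 4 ..
qed

lemma projected_bound_measurable:
  fixes \<sigma> :: "(nat \<times> nat \<Rightarrow> real) measure" and P :: "'w measure"
  assumes \<mu>: "\<mu> \<in> prob_Rn d" and \<sigma>: "sets \<sigma> = sets (restrict_space (borel_mat d k) (stiefel d k))"
    and X: "\<And>i. i \<in> {1..n} \<Longrightarrow> X i \<in> P \<rightarrow>\<^sub>M borel_Rn d"
  shows "(\<lambda>z. projected_bound d k p R n \<mu> (fst z) (\<lambda>i. X i (snd z))) \<in> borel_measurable (\<sigma> \<Otimes>\<^sub>M P)"
proof -
  interpret \<mu>: prob_space \<mu> using \<mu> by (simp add: prob_Rn_def)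
  have sets_mu: "sets \<mu> = sets (borel_Rn d)" using \<mu> by (simp add: prob_Rn_def)
  have id: "(\<lambda>E. E) \<in> \<sigma> \<rightarrow>\<^sub>M borel_mat d k"
    unfolding measurable_cong_sets[OF \<sigma> refl] by (rule measurable_restrict_space1) simp
  have T: "(\<lambda>z. transpose_apply d k (u z) (v z)) \<in> N \<rightarrow>\<^sub>M borel_Rn k"
    if "u \<in> N \<rightarrow>\<^sub>M \<sigma>" "v \<in> N \<rightarrow>\<^sub>M borel_Rn d" for u v and N :: "'c measure"
    using measurable_compose[OF measurable_Pair[OF measurable_compose[OF that(1) id] that(2)] transpose_apply_measurable]
    by simp
  have Tx: "(\<lambda>z. transpose_apply d k (fst z) (X i (snd z))) \<in> \<sigma> \<Otimes>\<^sub>M P \<rightarrow>\<^sub>M borel_Rn k" if "i \<in> {1..n}" for i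
    by (rule T[OF measurable_fst measurable_compose[OF measurable_snd X[OF that]]])
  have Ty: "(\<lambda>z. transpose_apply d k (fst z) (snd z)) \<in> \<sigma> \<Otimes>\<^sub>M \<mu> \<rightarrow>\<^sub>M borel_Rn k"
    by (rule T[OF measurable_fst]) (simp only: measurable_cong_sets[OF refl sets_mu[symmetric]] measurable_snd)
  have cellm: "(\<lambda>y. indicator {j} (cell k R l y) :: ennreal) \<in> borel_measurable (borel_Rn k)" for l j
    by (rule measurable_compose[OF cell_measurable]) simp
  have frq: "(\<lambda>z. (\<Sum>i=1..n. indicator {j} (cell k R (Suc l) (transpose_apply d k (fst z) (X i (snd z))))) / of_nat n :: ennreal)
      \<in> borel_measurable (\<sigma> \<Otimes>\<^sub>M P)" for l j
    by (intro borel_measurable_divide_ennreal borel_measurable_sum borel_measurable_const measurable_compose[OF Tx cellm])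
  \<comment> \<open>The integral over \<mu> depends on the frame alone: it is measurable there as a
    partial integral and is then lifted to the product through \<open>fst\<close>.\<close>
  have int: "(\<lambda>z. \<integral>\<^sup>+ y. f (transpose_apply d k (fst z) y) \<partial>\<mu>) \<in> borel_measurable (\<sigma> \<Otimes>\<^sub>M P)"
    if f: "f \<in> borel_measurable (borel_Rn k)" for f :: "(nat \<Rightarrow> real) \<Rightarrow> ennreal"
  proof -
    have "(\<lambda>(E, y). f (transpose_apply d k E y)) \<in> borel_measurable (\<sigma> \<Otimes>\<^sub>M \<mu>)"
      using measurable_compose[OF Ty f] by (simp only: case_prod_unfold)
    then have "(\<lambda>E. \<integral>\<^sup>+ y. f (transpose_apply d k E y) \<partial>\<mu>) \<in> borel_measurable \<sigma>"
      by (rule \<mu>.borel_measurable_nn_integral)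
    from measurable_compose[OF measurable_fst this] show ?thesis .
  qed
  show ?thesis
    unfolding projected_bound_def Let_def
    by (intro borel_measurable_add borel_measurable_sum borel_measurable_nn_integral_count_space
        borel_measurable_times_ennreal borel_measurable_minus_ennreal borel_measurable_divide_ennreal
        borel_measurable_const frq int cellm cell_cost_fun_measurable
        measurable_compose[OF Tx cell_cost_fun_measurable])
qed

text \<open>The comparison is pointwise in the frame, and \<open>nn_integral_mono\<close> asks for
  no measurability of the smaller integrand; thus the Wasserstein distance itself never has to be
  measurable.\<close>

lemma iprw_le_projected_bound:
  assumes p: "1 \<le> p" and R: "0 < R" and k: "1 \<le> k" and n: "1 \<le> n"
    and \<mu>: "\<mu> \<in> prob_Rn d" and \<sigma>: "sets \<sigma> = sets (restrict_space (borel_mat d k) (stiefel d k))"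
    and x: "\<And>i. i \<in> {1..n} \<Longrightarrow> x i \<in> space (borel_Rn d)"
  shows "iprw \<sigma> d k p (empirical d n x) \<mu> \<le> epowr (\<integral>\<^sup>+ E. projected_bound d k p R n \<mu> E x \<partial>\<sigma>) (1 / p)"
  unfolding iprw_def
proof (intro epowr_mono nn_integral_mono)
  fix E assume "E \<in> space \<sigma>"
  then have E: "E \<in> stiefel d k" "E \<in> space (borel_mat d k)"
    using sets_eq_imp_space_eq[OF \<sigma>] by (auto simp: space_restrict_space)
  have T: "transpose_apply d k E \<in> borel_Rn d \<rightarrow>\<^sub>M borel_Rn k"
    by (rule transpose_apply_measurable2[OF E(2)])
  have sets_mu: "sets \<mu> = sets (borel_Rn d)" using \<mu> by (simp add: prob_Rn_def)
  have T\<mu>: "transpose_apply d k E \<in> \<mu> \<rightarrow>\<^sub>M borel_Rn k"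
    using T unfolding measurable_cong_sets[OF sets_mu refl] .
  have e: "distr (empirical d n x) (borel_Rn k) (transpose_apply d k E) = empirical k n (\<lambda>i. transpose_apply d k E (x i))"
    by (rule distr_empirical[OF n x T])
  have 1: "empirical k n (\<lambda>i. transpose_apply d k E (x i)) \<in> prob_Rn k"
    by (rule empirical_prob_Rn[OF n measurable_space[OF T x]])
  have "prob_space \<mu>" using \<mu> by (simp add: prob_Rn_def)
  then have 2: "distr \<mu> (borel_Rn k) (transpose_apply d k E) \<in> prob_Rn k"
    using prob_space.prob_space_distr[OF _ T\<mu>] by (simp add: prob_Rn_def)
  have k0: "0 < k" using k by simp
  have pb: "multiscale_bound k p R n (empirical k n (\<lambda>i. transpose_apply d k E (x i)))
      (distr \<mu> (borel_Rn k) (transpose_apply d k E)) = projected_bound d k p R n \<mu> E x"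
    by (rule multiscale_bound_projected[OF n E(1) \<mu> x])
  show "epowr (wasserstein k p (distr (empirical d n x) (borel_Rn k) (transpose_apply d k E))
        (distr \<mu> (borel_Rn k) (transpose_apply d k E))) p \<le> projected_bound d k p R n \<mu> E x"
    unfolding e pb[symmetric]
    by (rule wasserstein_powr_le_multiscale[OF R p k0 1 2])
qed (use p in simp)

text \<open>The bound \<open>B\<close> is kept abstract: what matters is its validity for all laws
  with the moment bound given by \<open>R\<close>, and the projected law is one of them.\<close>

lemma expected_projected_bound_le:
  fixes P :: "'w measure"
  assumes pq: "1 \<le> p" "p \<le> q" and n: "1 \<le> n" and \<mu>: "\<mu> \<in> prob_Rn d"
    and mom: "moment d q \<mu> \<le> ennreal (R powr q)" and X: "iid_sample P d \<mu> n X"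
    and E: "E \<in> stiefel d k"
    and rate: "\<And>\<rho> (Y :: nat \<Rightarrow> 'w \<Rightarrow> nat \<Rightarrow> real). \<rho> \<in> prob_Rn k \<Longrightarrow> moment k q \<rho> \<le> ennreal (R powr q) \<Longrightarrow>
        iid_sample P k \<rho> n Y \<Longrightarrow>
        expected_bound k p R n n \<rho> P Y \<le> B"
  shows "(\<integral>\<^sup>+ \<omega>. projected_bound d k p R n \<mu> E (\<lambda>i. X i \<omega>) \<partial>P) \<le> B"
proof -
  let ?T = "transpose_apply d k E"
  let ?D = "distr \<mu> (borel_Rn k) ?T"
  interpret P: prob_space P using X by (simp add: iid_sample_def)
  have indep: "P.indep_vars (\<lambda>_. borel_Rn d) X {1..n}"
    and dist: "\<And>i. i \<in> {1..n} \<Longrightarrow> distr P (borel_Rn d) (X i) = \<mu>"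
    using X by (auto simp: iid_sample_def)
  have Xm: "X i \<in> P \<rightarrow>\<^sub>M borel_Rn d" if "i \<in> {1..n}" for i
    using indep that by (simp add: P.indep_vars_def2)
  have sets_mu: "sets \<mu> = sets (borel_Rn d)" using \<mu> by (simp add: prob_Rn_def)
  have "E \<in> space (borel_mat d k)" using E by (simp add: stiefel_def)
  then have T: "?T \<in> borel_Rn d \<rightarrow>\<^sub>M borel_Rn k" by (rule transpose_apply_measurable2)
  have T\<mu>: "?T \<in> \<mu> \<rightarrow>\<^sub>M borel_Rn k"
    using T unfolding measurable_cong_sets[OF sets_mu refl] .
  have "prob_space \<mu>" using \<mu> by (simp add: prob_Rn_def)
  then have D: "?D \<in> prob_Rn k"
    using prob_space.prob_space_distr[OF _ T\<mu>] by (simp add: prob_Rn_def)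
  have "moment k q ?D = (\<integral>\<^sup>+ x. ennreal (norm_Rn k (?T x) powr q) \<partial>\<mu>)"
    unfolding moment_def
  proof (rule nn_integral_distr[OF T\<mu>])
    have "(\<lambda>x. ennreal (norm_Rn k x powr q)) \<in> borel_measurable (borel_Rn k)"
      using norm_Rn_measurable[of k] by measurable
    then show "(\<lambda>x. ennreal (norm_Rn k x powr q)) \<in> borel_measurable ?D"
      by (simp only: measurable_distr_eq1)
  qed
  also have "\<dots> \<le> moment d q \<mu>"
    unfolding moment_def using pq norm_transpose_apply_le[OF E]
    by (intro nn_integral_mono ennreal_leI powr_mono2) auto
  also have "\<dots> \<le> ennreal (R powr q)" by (rule mom)
  finally have momD: "moment k q ?D \<le> ennreal (R powr q)" .
  have "iid_sample P k ?D n (\<lambda>i \<omega>. ?T (X i \<omega>))"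
    unfolding iid_sample_def
  proof (intro conjI ballI P.prob_space_axioms)
    show "P.indep_vars (\<lambda>_. borel_Rn k) (\<lambda>i \<omega>. ?T (X i \<omega>)) {1..n}"
      by (rule P.indep_vars_compose2[OF indep]) (rule T)
    fix i assume i: "i \<in> {1..n}"
    have "?D = distr (distr P (borel_Rn d) (X i)) (borel_Rn k) ?T" using dist[OF i] by simp
    also have "\<dots> = distr P (borel_Rn k) (\<lambda>\<omega>. ?T (X i \<omega>))"
      using distr_distr[OF T Xm[OF i]] by (simp add: comp_def)
    finally show "distr P (borel_Rn k) (\<lambda>\<omega>. ?T (X i \<omega>)) = ?D" ..
  qed
  from rate[OF D momD this]
  have "(\<integral>\<^sup>+ \<omega>. multiscale_bound k p R n (empirical k n (\<lambda>i. ?T (X i \<omega>))) ?D \<partial>P) \<le> B" .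
  moreover have "(\<integral>\<^sup>+ \<omega>. projected_bound d k p R n \<mu> E (\<lambda>i. X i \<omega>) \<partial>P)
      = (\<integral>\<^sup>+ \<omega>. multiscale_bound k p R n (empirical k n (\<lambda>i. ?T (X i \<omega>))) ?D \<partial>P)"
    by (intro nn_integral_cong multiscale_bound_projected[OF n E \<mu>, symmetric] measurable_space[OF Xm])
  ultimately show ?thesis by simp
qed

theorem theorem3p4:
  fixes p q :: real
  assumes "1 \<le> p" and "p \<le> q"
  shows "\<exists>C>0. \<forall>(d::nat) (k::nat) (n::nat) \<mu> \<sigma> (P :: 'w measure) X.
           1 \<le> d \<longrightarrow> 1 \<le> k \<longrightarrow> k \<le> d \<longrightarrow> 1 \<le> n \<longrightarrow>
           \<mu> \<in> prob_Rn_moment d q \<longrightarrow> uniform_stiefel d k \<sigma> \<longrightarrow> iid_sample P d \<mu> n X \<longrightarrow>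
           (\<integral>\<^sup>+ \<omega>. iprw \<sigma> d k p (empirical d n (\<lambda>i. X i \<omega>)) \<mu> \<partial>P)
             \<le> ennreal (C * real n powr (- rate_exponent p q k)
                          * (max 1 (ln (real n))) powr (log_exponent p q k / p))
                 * epowr (moment d q \<mu>) (1 / q)"
proof -
  obtain C where C: "0 < C" and rate: "\<And>k n R \<rho> (P :: 'w measure) Y. 1 \<le> k \<Longrightarrow> 1 \<le> n \<Longrightarrow> 0 < R \<Longrightarrow> \<rho> \<in> prob_Rn k \<Longrightarrow>
      moment k q \<rho> \<le> ennreal (R powr q) \<Longrightarrow> iid_sample P k \<rho> n Y \<Longrightarrow>
      expected_bound k p R n n \<rho> P Y
        \<le> ennreal (C * R powr p * real n powr (- (p * rate_exponent p q k)) * log_factor n powr log_exponent p q k)"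
    using expected_multiscale_bound_rate[OF assms, where 'w='w] by blast
  have p0: "0 < p" using assms by simp
  show ?thesis
  proof (intro exI[of _ "C powr (1 / p)"] conjI allI impI)
    show "0 < C powr (1 / p)" using C by simp
    fix d k n :: nat and \<mu> \<sigma> and P :: "'w measure" and X
    assume k: "1 \<le> k" and n: "1 \<le> n" and \<mu>q: "\<mu> \<in> prob_Rn_moment d q"
      and unif: "uniform_stiefel d k \<sigma>" and X: "iid_sample P d \<mu> n X"
    have \<mu>: "\<mu> \<in> prob_Rn d" and fin: "moment d q \<mu> < \<infinity>"
      using \<mu>q by (auto simp: prob_Rn_moment_def)
    have \<sigma>: "sets \<sigma> = sets (restrict_space (borel_mat d k) (stiefel d k))" and "prob_space \<sigma>"
      using unif by (auto simp: uniform_stiefel_def)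
    interpret \<sigma>: prob_space \<sigma> by fact
    interpret P: prob_space P using X by (simp add: iid_sample_def)
    interpret pair_sigma_finite \<sigma> P ..
    have Xm: "X i \<in> P \<rightarrow>\<^sub>M borel_Rn d" if "i \<in> {1..n}" for i
      using X that by (simp add: iid_sample_def P.indep_vars_def2)
    define F where "F = C powr (1 / p) * real n powr (- rate_exponent p q k)
                          * (max 1 (ln (real n))) powr (log_exponent p q k / p)"
    have F: "0 < F" using C n by (simp add: F_def)
    \<comment> \<open>The shells need a positive scale, so the estimate is first proved for every
      positive \<open>R\<close> whose \<open>q\<close>-th power dominates the moment.\<close>
    have main: "(\<integral>\<^sup>+ \<omega>. iprw \<sigma> d k p (empirical d n (\<lambda>i. X i \<omega>)) \<mu> \<partial>P) \<le> ennreal (F * R)"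
      if R: "0 < R" and mom: "moment d q \<mu> \<le> ennreal (R powr q)" for R
    proof -
      define B where "B = C * R powr p * real n powr (- (p * rate_exponent p q k)) * log_factor n powr log_exponent p q k"
      define V where "V E \<omega> = projected_bound d k p R n \<mu> E (\<lambda>i. X i \<omega>)" for E \<omega>
      have lf: "0 < log_factor n" using log_factor_ge_1[of n] by linarith
      have B: "0 < B" using C R n lf by (simp add: B_def)
      \<comment> \<open>Joint measurability permits the exchange of integrals, which reduces the
        average over frames to a bound for each single frame.\<close>
      have Vm: "(\<lambda>(E, \<omega>). V E \<omega>) \<in> borel_measurable (\<sigma> \<Otimes>\<^sub>M P)"
        unfolding V_def case_prod_unfold by (rule projected_bound_measurable[OF \<mu> \<sigma> Xm])
      have VmP: "(\<lambda>\<omega>. \<integral>\<^sup>+ E. V E \<omega> \<partial>\<sigma>) \<in> borel_measurable P"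
        using measurable_pair_swap[OF Vm] by (intro \<sigma>.borel_measurable_nn_integral) (simp only: case_prod_unfold fst_conv snd_conv)
      have "(\<integral>\<^sup>+ \<omega>. \<integral>\<^sup>+ E. V E \<omega> \<partial>\<sigma> \<partial>P) = (\<integral>\<^sup>+ E. \<integral>\<^sup>+ \<omega>. V E \<omega> \<partial>P \<partial>\<sigma>)"
        by (rule Fubini'[OF Vm])
      also have "\<dots> \<le> (\<integral>\<^sup>+ E. ennreal B \<partial>\<sigma>)"
      proof (rule nn_integral_mono)
        fix E assume "E \<in> space \<sigma>"
        then have "E \<in> stiefel d k"
          using sets_eq_imp_space_eq[OF \<sigma>] by (auto simp: space_restrict_space)
        then show "(\<integral>\<^sup>+ \<omega>. V E \<omega> \<partial>P) \<le> ennreal B"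
          unfolding V_def B_def
          by (rule expected_projected_bound_le[OF assms n \<mu> mom X]) (rule rate[OF k n R])
      qed
      also have "\<dots> = ennreal B" by (simp add: \<sigma>.emeasure_space_1)
      finally have EV: "(\<integral>\<^sup>+ \<omega>. \<integral>\<^sup>+ E. V E \<omega> \<partial>\<sigma> \<partial>P) \<le> ennreal B" .
      have "(\<integral>\<^sup>+ \<omega>. iprw \<sigma> d k p (empirical d n (\<lambda>i. X i \<omega>)) \<mu> \<partial>P)
          \<le> (\<integral>\<^sup>+ \<omega>. epowr (\<integral>\<^sup>+ E. V E \<omega> \<partial>\<sigma>) (1 / p) \<partial>P)"
        unfolding V_def
        by (intro nn_integral_mono iprw_le_projected_bound[OF assms(1) R k n \<mu> \<sigma>] measurable_space[OF Xm])
      also have "\<dots> \<le> ennreal (B powr (1 / p))"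
        by (rule P.nn_integral_epowr_le[OF VmP assms(1) B EV])
      \<comment> \<open>The root turns \<open>R powr p\<close> into \<open>R\<close> and divides the
        exponents of \<open>n\<close> and of the logarithm by \<open>p\<close>.\<close>
      also have "B powr (1 / p) = F * R"
        using C R n lf p0 by (simp add: B_def F_def powr_mult powr_powr log_factor_def[symmetric])
      finally show ?thesis .
    qed
    define m where "m = enn2real (moment d q \<mu>)"
    define s where "s = m powr (1 / q)"
    have q0: "0 < q" using assms by simp
    have m: "moment d q \<mu> = ennreal m" "0 \<le> m" using fin by (simp_all add: m_def)
    have rhs: "ennreal F * epowr (moment d q \<mu>) (1 / q) = ennreal (F * s)"
      using F m by (simp add: epowr_def s_def ennreal_mult)
    have "(\<integral>\<^sup>+ \<omega>. iprw \<sigma> d k p (empirical d n (\<lambda>i. X i \<omega>)) \<mu> \<partial>P) \<le> ennreal (F * s)"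
    \<comment> \<open>The moment vanishes for the point mass at the origin, so \<open>s\<close>
      itself may fail to be a positive scale. The scale \<open>s + e / F\<close> is positive, and
      its excess costs exactly \<open>e\<close>.\<close>
    proof (rule ennreal_le_epsilon)
      fix e :: real assume e: "0 < e"
      have s0: "0 \<le> s" by (simp add: s_def)
      have "m = s powr q" using m q0 by (simp add: s_def powr_powr)
      also have "\<dots> \<le> (s + e / F) powr q" using s0 e F q0 by (intro powr_mono2) auto
      finally have "moment d q \<mu> \<le> ennreal ((s + e / F) powr q)" unfolding m(1) by (rule ennreal_leI)
      moreover have "0 < s + e / F" using s0 e F by (simp add: add_nonneg_pos)
      ultimately have "(\<integral>\<^sup>+ \<omega>. iprw \<sigma> d k p (empirical d n (\<lambda>i. X i \<omega>)) \<mu> \<partial>P) \<le> ennreal (F * (s + e / F))"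
        by (rule main[rotated])
      also have "F * (s + e / F) = F * s + e" using F by (simp add: distrib_left)
      also have "ennreal (F * s + e) = ennreal (F * s) + ennreal e"
        using F s0 e by (intro ennreal_plus) auto
      finally show "(\<integral>\<^sup>+ \<omega>. iprw \<sigma> d k p (empirical d n (\<lambda>i. X i \<omega>)) \<mu> \<partial>P) \<le> ennreal (F * s) + ennreal e" .
    qed
    then show "(\<integral>\<^sup>+ \<omega>. iprw \<sigma> d k p (empirical d n (\<lambda>i. X i \<omega>)) \<mu> \<partial>P)
             \<le> ennreal (C powr (1 / p) * real n powr (- rate_exponent p q k)
                          * (max 1 (ln (real n))) powr (log_exponent p q k / p))
                 * epowr (moment d q \<mu>) (1 / q)"
      unfolding F_def[symmetric] rhs .
  qed
qed

end
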